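(* Let $\Omega=C_0(\mathbb{R}_+,\mathbb{R}^d)$ be the Wiener space with Wiener measure and canonical Brownian motion $W_t(\omega)=\omega(t)$. Let $b:\mathbb{R}^m\to\mathbb{R}^m$ and $\sigma:\mathbb{R}^m\to\mathcal{M}_{m,d}(\mathbb{R})$ be locally Lipschitz (for each $N>0$ there is $K_N$ with $|b(x)-b(y)|\le K_N|x-y|$, $\|\sigma(x)-\sigma(y)\|\le K_N|x-y|$ for $|x|,|y|\le N$) and of linear growth ($|b(x)|\le K_1(1+|x|)$, $\|\sigma(x)\|\le K_1(1+|x|)$), and for each $h>0$ let $\eta^{(h)}:\mathbb{R}^m\times\mathbb{R}^d\to\mathbb{R}^m$ be measurable with $|\eta^{(h)}(x,y)|\le K_2(h^\alpha|x|+|y|)$ for some $\alpha\in(0,+\infty]$, $K_2$ and all $h,x,y$. Suppose that the repeated-interaction dynamics with time step $h$ acts on the system component through \[U^{(h)}(x,y)=x+\sigma(x)y+hb(x)+h\eta^{(h)}(x,y),\] i.e. for an initial state $x_0\in\mathbb{R}^m$, $X^h_0=x_0$ and $X^h_{(n+1)h}=U^{(h)}(X^h_{nh},W_{(n+1)h}-W_{nh})$, and let $\overline{X}^h_t=X^h_{\lfloor t/h\rfloor h}+\frac{t-\lfloor t/h\rfloor h}{h}\{X^h_{(\lfloor t/h\rfloor+1)h}-X^h_{\lfloor t/h\rfloor h}\}$. For $\tau>0$ let $(X^{x_0}_t)$ be the solution on $[0,\tau]$ of $dX^{x_0}_t=b(X^{x_0}_t)dt+\sigma(X^{x_0}_t)dW_t$,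 $X^{x_0}_0=x_0$. Then $(\overline{X}^h_t)$ converges to $(X^{x_0}_t)$ in $L^p$ on $[0,\tau]$ for all $p>2$ as $h\to0$.
   Context: $|\cdot|$ is the Euclidean norm; $\|\cdot\|$ is the Hilbert–Schmidt norm on $m\times d$ real matrices. When $\alpha=+\infty$, $h^\alpha$ is interpreted as $0$. Convergence in $L^p$ on $[0,\tau]$ means $\mathbb{E}[(\sup_{t\in[0,\tau]}|X^{x_0}_t-\overline{X}^h_t|)^p]\to0$. *)

theory Defs
  imports "HOL-Probability.Probability"
begin

definition C0_paths :: "(real \<Rightarrow> real^'d) set" where
  "C0_paths = {\<omega>. continuous_on UNIV \<omega> \<and> (\<forall>t\<le>0. \<omega> t = 0)}"

definition path_gen :: "(real \<Rightarrow> real^'d) set \<Rightarrow> real set \<Rightarrow> (real \<Rightarrow> real^'d) set set" where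
  "path_gen S T = {{\<omega>\<in>S. \<omega> s \<in> A} | s A. s \<in> T \<and> A \<in> sets borel}"

definition wiener_measure :: "(real \<Rightarrow> real^'d) measure \<Rightarrow> bool" where
  "wiener_measure M \<longleftrightarrow> prob_space M \<and> space M = C0_paths \<and>
     sets M = sigma_sets C0_paths (path_gen C0_paths {0..}) \<and>
     (\<forall>ts::real list. sorted_wrt (<) ts \<longrightarrow> (\<forall>t\<in>set ts. 0 \<le> t) \<longrightarrow>
        prob_space.indep_vars M (\<lambda>_. borel)
          (\<lambda>(i, j) \<omega>. (\<omega> (ts ! Suc i) - \<omega> (ts ! i)) $ j) ({..<length ts - 1} \<times> UNIV) \<and>
        (\<forall>i < length ts - 1. \<forall>j. distributed M lborel (\<lambda>\<omega>. (\<omega> (ts ! Suc i) - \<omega> (ts ! i)) $ j)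
            (\<lambda>x. ennreal (normal_density 0 (sqrt (ts ! Suc i - ts ! i)) x))))"

text \<open>Natural filtration of the canonical process, and adaptedness to its augmentation
  (a random variable is measurable for the augmented sigma-algebra iff it is a.s. equal
  to a measurable one).\<close>
definition nat_filt :: "(real \<Rightarrow> real^'d) measure \<Rightarrow> real \<Rightarrow> (real \<Rightarrow> real^'d) measure" where
  "nat_filt M t = sigma (space M) (path_gen (space M) {0..t})"

definition adapted_aug :: "(real \<Rightarrow> real^'d) measure \<Rightarrow> real \<Rightarrow> (real \<Rightarrow> (real \<Rightarrow> real^'d) \<Rightarrow> 'b::topological_space) \<Rightarrow> bool" where
  "adapted_aug M \<tau> X \<longleftrightarrow> (\<forall>t\<in>{0..\<tau>}. \<exists>Y. Y \<in> borel_measurable (nat_filt M t) \<and> (AE \<omega> in M. X t \<omega> = Y \<omega>))"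

text \<open>Convergence in probability (robust to measurability: exceptional sets are covered
  by measurable sets of vanishing measure).\<close>
definition conv_in_prob :: "'a measure \<Rightarrow> (nat \<Rightarrow> 'a \<Rightarrow> 'b::real_normed_vector) \<Rightarrow> ('a \<Rightarrow> 'b) \<Rightarrow> bool" where
  "conv_in_prob M S L \<longleftrightarrow> (\<forall>\<epsilon>>0. \<exists>A. (\<forall>n. A n \<in> sets M \<and> {\<omega>\<in>space M. \<epsilon> < norm (S n \<omega> - L \<omega>)} \<subseteq> A n)
       \<and> (\<lambda>n. measure M (A n)) \<longlonglongrightarrow> 0)"

text \<open>Strong solution on [0,tau] of dX = b(X)dt + sigma(X)dW, X_0 = x0. The Ito integral of
  the continuous adapted integrand sigma(X) is the limit in probability of left-point
  Riemann sums along uniform partitions of [0,t].\<close>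
definition sde_solution :: "(real \<Rightarrow> real^'d) measure \<Rightarrow> (real^'m \<Rightarrow> real^'m) \<Rightarrow> (real^'m \<Rightarrow> real^'d^'m)
    \<Rightarrow> real^'m \<Rightarrow> real \<Rightarrow> (real \<Rightarrow> (real \<Rightarrow> real^'d) \<Rightarrow> real^'m) \<Rightarrow> bool" where
  "sde_solution M b \<sigma> x0 \<tau> X \<longleftrightarrow>
     (\<forall>t\<in>{0..\<tau>}. X t \<in> borel_measurable M) \<and>
     (\<forall>\<omega>\<in>space M. continuous_on {0..\<tau>} (\<lambda>t. X t \<omega>)) \<and>
     adapted_aug M \<tau> X \<and>
     (\<forall>t\<in>{0..\<tau>}. conv_in_prob M
        (\<lambda>n \<omega>. \<Sum>k<n. \<sigma> (X (t * real k / real n) \<omega>) *v (\<omega> (t * real (Suc k) / real n) - \<omega> (t * real k / real n)))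
        (\<lambda>\<omega>. X t \<omega> - x0 - integral {0..t} (\<lambda>s. b (X s \<omega>))))"

definition h_pow :: "ereal \<Rightarrow> real \<Rightarrow> real" where
  "h_pow \<alpha> h = (if \<alpha> = \<infinity> then 0 else h powr real_of_ereal \<alpha>)"

definition U_map :: "(real^'m \<Rightarrow> real^'m) \<Rightarrow> (real^'m \<Rightarrow> real^'d^'m) \<Rightarrow> (real \<Rightarrow> real^'m \<Rightarrow> real^'d \<Rightarrow> real^'m)
    \<Rightarrow> real \<Rightarrow> real^'m \<Rightarrow> real^'d \<Rightarrow> real^'m" where
  "U_map b \<sigma> \<eta> h x y = x + \<sigma> x *v y + h *\<^sub>R b x + h *\<^sub>R \<eta> h x y"

fun scheme :: "(real \<Rightarrow> real^'m \<Rightarrow> real^'d \<Rightarrow> real^'m) \<Rightarrow> real \<Rightarrow> real^'m \<Rightarrow> (real \<Rightarrow> real^'d) \<Rightarrow> nat \<Rightarrow> real^'m" where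
  "scheme U h x0 \<omega> 0 = x0"
| "scheme U h x0 \<omega> (Suc n) = U h (scheme U h x0 \<omega> n) (\<omega> (real (Suc n) * h) - \<omega> (real n * h))"

definition interp :: "(real \<Rightarrow> real^'m \<Rightarrow> real^'d \<Rightarrow> real^'m) \<Rightarrow> real \<Rightarrow> real^'m \<Rightarrow> (real \<Rightarrow> real^'d) \<Rightarrow> real \<Rightarrow> real^'m" where
  "interp U h x0 \<omega> t = (let n = nat \<lfloor>t / h\<rfloor> in
     scheme U h x0 \<omega> n + ((t - real n * h) / h) *\<^sub>R (scheme U h x0 \<omega> (Suc n) - scheme U h x0 \<omega> n))"

end

theory Submission
  imports Defs
begin

text \<open>
  No stochastic integration is needed: everything reduces to recursions driven by independent noise,
  and to one maximal inequality. If \<open>V j\<close> is a nonnegative adapted process with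
  \<open>V (j + 1) \<le> V j + g j \<bullet> \<xi> j + V j * w (\<xi> j)\<close>, where \<open>g j\<close> is adapted and \<open>\<xi> j\<close> is centred and independent of the past,
  then freezing \<open>V\<close> when it first reaches a level shows that the level is reached within \<open>n\<close> steps with
  probability at most \<open>(1 + C) ^ n * V 0 / lev\<close>, \<open>C\<close> being a bound for the mean of \<open>w (\<xi> j)\<close>. The inequality is used three times.

  With \<open>V = (1 + |Y|^2) ^ r\<close> it gives tail bounds for the maximum of the scheme \<open>Y\<close>, uniform in the
  time step. With \<open>V = |D|^2 + \<delta>^2\<close>, where \<open>D\<close> is the difference of the left-point sums of \<open>\<sigma>(X)\<close> for
  the steps \<open>h\<close> and \<open>h/n\<close>, and \<open>n\<close> tending to infinity, it shows that the solution nearly satisfies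
  the Euler recursion, uniformly over the grid. With \<open>D\<close> the difference between scheme and solution,
  corrected by this residual and by the accumulated \<open>\<eta>\<close> terms, it gives uniform convergence in probability.
  The tail bounds of the scheme pass to the solution in the limit \<open>h \<rightarrow> 0\<close>, and all moments of the
  error being bounded, convergence in probability improves to convergence in \<open>L^p\<close>.
\<close>

text \<open>The coefficients are Lipschitz only on balls, and the solution is a priori just a
  continuous adapted process without known moments. Every comparison with it therefore runs on paths
  that are bounded so far, and this restriction has to be decided at time \<open>j\<close>: hence
  the sets \<open>G j\<close> in the maximal inequality. The weight \<open>w\<close> always has mean
  of order \<open>h\<close>, so the growth factor stays below \<open>exp (C * T)\<close> for all
  \<open>h\<close>. The offset \<open>\<delta>^2\<close> in \<open>V\<close> makes additive errors
  multiplicative: an error of size \<open>\<delta>\<close> multiplying the noise is bounded in terms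
  of \<open>V\<close>, and the starting value \<open>\<delta>^2\<close> returns as a probability
  bound of order \<open>\<delta>^2 / \<rho>^2\<close>. Its factor is fixed by the Lipschitz
  constant, so \<open>\<delta>\<close> can be chosen after the ball. The refinement estimate is
  uniform in \<open>n\<close>. Thus \<open>n\<close> may tend to infinity while \<open>h\<close>
  stays fixed, and only at that point does the definition of the stochastic integral enter. Since
  \<open>r\<close> is arbitrary in the tail bounds, moments of order \<open>2 * p\<close> and higher
  are available for every \<open>p\<close>.\<close>

section \<open>Matrix-vector products: norm bounds and measurability\<close>

lemma norm_matrix_vector_mult_le:
  fixes A :: "real^'n^'m"
  shows "norm (A *v x) \<le> norm A * norm x"
proof -
  have "norm (A *v x) = L2_set (\<lambda>i. \<bar>inner (A $ i) x\<bar>) UNIV"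
    by (simp add: norm_vec_def matrix_vector_mul_component)
  also have "\<dots> \<le> L2_set (\<lambda>i. norm (A $ i) * norm x) UNIV"
    by (rule L2_set_mono) (auto simp: Cauchy_Schwarz_ineq2)
  also have "\<dots> = norm A * norm x"
    by (simp add: norm_vec_def L2_set_left_distrib)
  finally show ?thesis .
qed

text \<open>Duality: the squared norm of \<open>x v* A\<close> is \<open>x\<close> paired with
  \<open>A *v (x v* A)\<close>, to which the bound for \<open>A *v _\<close> applies. The product
  \<open>x v* A\<close> is the transpose acting on \<open>x\<close>; it turns an inner product with
  \<open>A *v z\<close> into one with the noise \<open>z\<close>.\<close>

lemma norm_vector_matrix_mult_le:
  fixes A :: "real^'n^'m"
  shows "norm (x v* A) \<le> norm x * norm A"
proof -
  let ?g = "x v* A"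
  have "norm ?g ^ 2 = inner ?g ?g"
    by (simp add: power2_norm_eq_inner)
  also have "\<dots> = inner x (A *v ?g)"
    by (rule dot_lmul_matrix)
  also have "\<dots> \<le> norm x * (norm A * norm ?g)"
    by (meson mult_left_mono norm_cauchy_schwarz norm_ge_zero norm_matrix_vector_mult_le order_trans)
  finally have "norm ?g * norm ?g \<le> (norm x * norm A) * norm ?g"
    by (simp add: power2_eq_square ac_simps)
  then show ?thesis
    by (cases "norm ?g = 0") auto
qed

lemma borel_measurable_matrix_vector_mult [measurable (raw)]:
  fixes A :: "'a \<Rightarrow> real^'n^'m"
  assumes "A \<in> borel_measurable M" "x \<in> borel_measurable M"
  shows "(\<lambda>\<omega>. A \<omega> *v x \<omega>) \<in> borel_measurable M"
proof -
  have "continuous_on UNIV (\<lambda>p::(real^'n^'m) \<times> (real^'n). fst p *v snd p)"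
    unfolding matrix_vector_mult_def by (intro continuous_intros)
  then show ?thesis
    using borel_measurable_continuous_Pair[OF assms, of "\<lambda>A x. A *v x"] by simp
qed

lemma borel_measurable_vector_matrix_mult [measurable (raw)]:
  fixes A :: "'a \<Rightarrow> real^'n^'m"
  assumes "A \<in> borel_measurable M" "x \<in> borel_measurable M"
  shows "(\<lambda>\<omega>. x \<omega> v* A \<omega>) \<in> borel_measurable M"
proof -
  have "continuous_on UNIV (\<lambda>p::(real^'m) \<times> (real^'n^'m). fst p v* snd p)"
    unfolding vector_matrix_mult_def by (intro continuous_intros)
  then show ?thesis
    using borel_measurable_continuous_Pair[OF assms(2,1), of "\<lambda>x A. x v* A"] by simp
qed

lemma borel_measurable_vec_nth' [measurable (raw)]:
  fixes f :: "'a \<Rightarrow> real^'n"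
  shows "f \<in> borel_measurable M \<Longrightarrow> (\<lambda>\<omega>. f \<omega> $ i) \<in> borel_measurable M"
  using borel_measurable_continuous_on[of "\<lambda>v::real^'n. v $ i" f M]
  by (simp add: continuous_on_component continuous_on_id)

section \<open>A maximal inequality for processes driven by independent noise\<close>

text \<open>The abstract form in which Brownian increments enter. Independence from the past is
  asked only between real functions of the two, since it serves only to factor expectations of
  products. \<open>\<xi> j\<close> is the increment after time \<open>j\<close>: independent of
  \<open>F j\<close>, measurable for \<open>F (Suc j)\<close>.\<close>

locale noise_filtration = prob_space M
  for M :: "'a measure" +
  fixes F :: "nat \<Rightarrow> 'a measure" and \<xi> :: "nat \<Rightarrow> 'a \<Rightarrow> real^'d"
  assumes subalg: "subalgebra M (F j)"
    and filt_mono: "i \<le> j \<Longrightarrow> sets (F i) \<subseteq> sets (F j)"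
    and noise_meas: "\<xi> j \<in> borel_measurable (F (Suc j))"
    and noise_indep: "\<And>(f::'a \<Rightarrow> real) (w::real^'d \<Rightarrow> real). f \<in> borel_measurable (F j) \<Longrightarrow> w \<in> borel_measurable borel \<Longrightarrow>
      indep_var borel f borel (\<lambda>\<omega>. w (\<xi> j \<omega>))"
    and noise_integrable: "integrable M (\<lambda>\<omega>. \<xi> j \<omega> $ l)"
    and noise_mean: "(\<integral>\<omega>. \<xi> j \<omega> $ l \<partial>M) = 0"
begin

lemma space_filt [simp]: "space (F j) = space M"
  using subalg[of j] by (simp add: subalgebra_def)

lemma measurable_filt: "f \<in> measurable (F j) N \<Longrightarrow> f \<in> measurable M N"
  using subalg measurable_from_subalg by blast

lemma measurable_filt_mono: "f \<in> measurable (F i) N \<Longrightarrow> i \<le> j \<Longrightarrow> f \<in> measurable (F j) N"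
  using filt_mono[of i j] unfolding measurable_def by auto

lemma sets_filtD: "A \<in> sets (F j) \<Longrightarrow> A \<in> sets M"
  using subalg[of j] by (auto simp: subalgebra_def)

lemma maximal_event:
  fixes V :: "nat \<Rightarrow> 'a \<Rightarrow> real"
  assumes V: "\<And>j. j \<le> n \<Longrightarrow> V j \<in> borel_measurable (F j)" and G: "\<And>j. j < n \<Longrightarrow> G j \<in> sets (F j)"
  shows "{\<omega>\<in>space M. (\<forall>j<n. \<omega> \<in> G j) \<and> (\<exists>j\<le>n. lev \<le> V j \<omega>)} \<in> events"
proof -
  have "{\<omega>\<in>space M. (\<forall>j\<in>{..<n}. \<omega> \<in> G j) \<and> (\<exists>j\<in>{..n}. lev \<le> V j \<omega>)} \<in> events"
  proof (intro sets.sets_Collect_conj sets.sets_Collect_finite_All sets.sets_Collect_finite_Ex)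
    fix j assume "j \<in> {..<n}"
    then have "G j \<in> events" using sets_filtD G by auto
    moreover from this have "{\<omega>\<in>space M. \<omega> \<in> G j} = G j" using sets.sets_into_space by blast
    ultimately show "{\<omega>\<in>space M. \<omega> \<in> G j} \<in> events" by simp
  next
    fix j assume "j \<in> {..n}"
    then have [measurable]: "V j \<in> borel_measurable M" using measurable_filt V by blast
    show "{\<omega>\<in>space M. lev \<le> V j \<omega>} \<in> events" by measurable
  qed auto
  then show ?thesis unfolding Ball_def Bex_def lessThan_iff atMost_iff .
qed

lemma expectation_times_noise:
  fixes f :: "'a \<Rightarrow> real" and w :: "real^'d \<Rightarrow> real"
  assumes "f \<in> borel_measurable (F j)" "w \<in> borel_measurable borel"
    and "integrable M f" "integrable M (\<lambda>\<omega>. w (\<xi> j \<omega>))"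
  shows "integrable M (\<lambda>\<omega>. f \<omega> * w (\<xi> j \<omega>))"
    and "(\<integral>\<omega>. f \<omega> * w (\<xi> j \<omega>) \<partial>M) = (\<integral>\<omega>. f \<omega> \<partial>M) * (\<integral>\<omega>. w (\<xi> j \<omega>) \<partial>M)"
  using indep_var_integrable[OF noise_indep[OF assms(1,2)] assms(3,4)]
    indep_var_lebesgue_integral[OF noise_indep[OF assms(1,2)] assms(3,4)] by auto

text \<open>Each coordinate of \<open>g\<close> is integrable because \<open>V\<close> dominates it,
  so its product with the centred coordinate of \<open>\<xi> j\<close> has expectation zero by
  independence.\<close>

lemma expectation_inner_noise:
  fixes g :: "'a \<Rightarrow> real^'d"
  assumes [measurable]: "g \<in> borel_measurable (F j)"
    and V: "integrable M V" "\<And>\<omega>. \<omega> \<in> space M \<Longrightarrow> norm (g \<omega>) \<le> V \<omega>"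
  shows "integrable M (\<lambda>\<omega>. inner (g \<omega>) (\<xi> j \<omega>))" "(\<integral>\<omega>. inner (g \<omega>) (\<xi> j \<omega>) \<partial>M) = 0"
proof -
  have gM: "g \<in> borel_measurable M"
    using measurable_filt assms(1) by blast
  have ig: "integrable M (\<lambda>\<omega>. g \<omega> $ l)" for l
    by (rule Bochner_Integration.integrable_bound[OF V(1)])
      (use gM V(2) component_le_norm_cart in \<open>auto intro!: AE_I2 order_trans[OF component_le_norm_cart]
        order_trans[OF V(2)] borel_measurable_vec_nth'\<close>)
  have i: "integrable M (\<lambda>\<omega>. g \<omega> $ l * \<xi> j \<omega> $ l)"
    and e: "(\<integral>\<omega>. g \<omega> $ l * \<xi> j \<omega> $ l \<partial>M) = 0" for l
    using expectation_times_noise[of "\<lambda>\<omega>. g \<omega> $ l" j "\<lambda>z. z $ l"] ig[of l] noise_integrable[of j l] noise_mean[of j l]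
    by auto
  show "integrable M (\<lambda>\<omega>. inner (g \<omega>) (\<xi> j \<omega>))" "(\<integral>\<omega>. inner (g \<omega>) (\<xi> j \<omega>) \<partial>M) = 0"
    using i e by (simp_all add: inner_vec_def)
qed

text \<open>In the expectation of the right side of \<open>step\<close> the term linear in the noise
  vanishes and \<open>V * w\<close> factorises. Integrability of \<open>V'\<close> is a conclusion,
  as \<open>V'\<close> lies between 0 and an integrable bound. The constant \<open>c\<close> serves
  the integrability of the linear term and leaves no trace in the growth factor.\<close>

lemma expectation_step:
  fixes g :: "'a \<Rightarrow> real^'d"
  assumes [measurable]: "V \<in> borel_measurable (F j)" "g \<in> borel_measurable (F j)"
      "V' \<in> borel_measurable M" "w \<in> borel_measurable borel"
    and V: "integrable M V" "\<And>\<omega>. \<omega> \<in> space M \<Longrightarrow> 0 \<le> V \<omega>"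
    and V': "\<And>\<omega>. \<omega> \<in> space M \<Longrightarrow> 0 \<le> V' \<omega>"
    and w: "integrable M (\<lambda>\<omega>. w (\<xi> j \<omega>))" "(\<integral>\<omega>. w (\<xi> j \<omega>) \<partial>M) \<le> C"
    and g: "\<And>\<omega>. \<omega> \<in> space M \<Longrightarrow> norm (g \<omega>) \<le> c * V \<omega>"
    and step: "\<And>\<omega>. \<omega> \<in> space M \<Longrightarrow> V' \<omega> \<le> V \<omega> + inner (g \<omega>) (\<xi> j \<omega>) + V \<omega> * w (\<xi> j \<omega>)"
  shows "integrable M V'" "(\<integral>\<omega>. V' \<omega> \<partial>M) \<le> (1 + C) * (\<integral>\<omega>. V \<omega> \<partial>M)"
proof -
  let ?R = "\<lambda>\<omega>. V \<omega> + inner (g \<omega>) (\<xi> j \<omega>) + V \<omega> * w (\<xi> j \<omega>)"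
  note gi = expectation_inner_noise[of g j "\<lambda>\<omega>. c * V \<omega>"]
  note wi = expectation_times_noise[of V j w]
  have g1: "integrable M (\<lambda>\<omega>. inner (g \<omega>) (\<xi> j \<omega>))" "(\<integral>\<omega>. inner (g \<omega>) (\<xi> j \<omega>) \<partial>M) = 0"
    using gi V g by auto
  have w1: "integrable M (\<lambda>\<omega>. V \<omega> * w (\<xi> j \<omega>))"
      "(\<integral>\<omega>. V \<omega> * w (\<xi> j \<omega>) \<partial>M) = (\<integral>\<omega>. V \<omega> \<partial>M) * (\<integral>\<omega>. w (\<xi> j \<omega>) \<partial>M)"
    using wi V(1) w(1) by auto
  have R: "integrable M ?R"
    using V(1) g1(1) w1(1) by auto
  show i: "integrable M V'"
    by (rule Bochner_Integration.integrable_bound[OF R]) (use V' step in \<open>auto intro!: AE_I2, force\<close>)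
  have "(\<integral>\<omega>. V' \<omega> \<partial>M) \<le> (\<integral>\<omega>. ?R \<omega> \<partial>M)"
    by (rule integral_mono[OF i R]) (use step in auto)
  also have "\<dots> = (\<integral>\<omega>. V \<omega> \<partial>M) + (\<integral>\<omega>. V \<omega> \<partial>M) * (\<integral>\<omega>. w (\<xi> j \<omega>) \<partial>M)"
    using V(1) g1 w1 by simp
  also have "\<dots> \<le> (\<integral>\<omega>. V \<omega> \<partial>M) + (\<integral>\<omega>. V \<omega> \<partial>M) * C"
    using V w(2) by (intro add_left_mono mult_left_mono Bochner_Integration.integral_nonneg) auto
  finally show "(\<integral>\<omega>. V' \<omega> \<partial>M) \<le> (1 + C) * (\<integral>\<omega>. V \<omega> \<partial>M)"
    by (simp add: algebra_simps)
qed

text \<open>The process is frozen as soon as it leaves the sets \<open>G j\<close> or reaches the level \<open>lev\<close>; the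
  frozen process still grows by at most the factor \<open>1 + C\<close> per step in expectation, and its final value
  remembers whether the level was ever reached.\<close>
lemma maximal_inequality:
  fixes V :: "nat \<Rightarrow> 'a \<Rightarrow> real" and g :: "nat \<Rightarrow> 'a \<Rightarrow> real^'d"
  assumes V_meas: "\<And>j. j \<le> n \<Longrightarrow> V j \<in> borel_measurable (F j)"
    and g_meas: "\<And>j. j < n \<Longrightarrow> g j \<in> borel_measurable (F j)"
    and G: "\<And>j. j < n \<Longrightarrow> G j \<in> sets (F j)"
    and w: "w \<in> borel_measurable borel" "\<And>z. 0 \<le> w z" "\<And>j. j < n \<Longrightarrow> integrable M (\<lambda>\<omega>. w (\<xi> j \<omega>))"
      "\<And>j. j < n \<Longrightarrow> (\<integral>\<omega>. w (\<xi> j \<omega>) \<partial>M) \<le> C"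
    and V_nonneg: "\<And>j \<omega>. j \<le> n \<Longrightarrow> \<omega> \<in> space M \<Longrightarrow> 0 \<le> V j \<omega>"
    and V0: "\<And>\<omega>. \<omega> \<in> space M \<Longrightarrow> V 0 \<omega> = v0"
    and c: "0 \<le> c" and C: "0 \<le> C" and lev: "0 < lev"
    and g: "\<And>j \<omega>. j < n \<Longrightarrow> \<omega> \<in> space M \<Longrightarrow> \<omega> \<in> G j \<Longrightarrow> norm (g j \<omega>) \<le> c * V j \<omega>"
    and step: "\<And>j \<omega>. j < n \<Longrightarrow> \<omega> \<in> space M \<Longrightarrow> \<omega> \<in> G j \<Longrightarrow>
                 V (Suc j) \<omega> \<le> V j \<omega> + inner (g j \<omega>) (\<xi> j \<omega>) + V j \<omega> * w (\<xi> j \<omega>)"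
  shows "measure M {\<omega>\<in>space M. (\<forall>j<n. \<omega> \<in> G j) \<and> (\<exists>j\<le>n. lev \<le> V j \<omega>)} \<le> (1 + C) ^ n * v0 / lev"
proof -
  define act where "act j \<omega> \<longleftrightarrow> (\<forall>i\<le>j. \<omega> \<in> G i \<and> V i \<omega> < lev)" for j \<omega>
  define V' where "V' = rec_nat (V 0) (\<lambda>j v \<omega>. if act j \<omega> then V (Suc j) \<omega> else v \<omega>)"
  have V'0: "V' 0 = V 0" and V'S: "V' (Suc j) = (\<lambda>\<omega>. if act j \<omega> then V (Suc j) \<omega> else V' j \<omega>)" for j
    unfolding V'_def by simp_all
  have act_V': "V' j \<omega> = V j \<omega>" if "act j \<omega>" for j \<omega>
    using that by (cases j) (auto simp: V'0 V'S act_def)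
  have act_meas: "{\<omega>\<in>space M. act j \<omega>} \<in> sets (F j)" if "j < n" for j
  proof -
    have 1: "{\<omega>\<in>space (F j). \<omega> \<in> G i \<and> V i \<omega> < lev} \<in> sets (F j)" if "i \<le> j" for i
    proof -
      have [measurable]: "V i \<in> borel_measurable (F j)"
        using measurable_filt_mono[OF V_meas, of i j] that \<open>j < n\<close> by auto
      have [measurable]: "G i \<in> sets (F j)"
        using G[of i] filt_mono[of i j] that \<open>j < n\<close> by auto
      show ?thesis by measurable
    qed
    have "{\<omega>\<in>space (F j). act j \<omega>} = (\<Inter>i\<in>{..j}. {\<omega>\<in>space (F j). \<omega> \<in> G i \<and> V i \<omega> < lev})"
      by (auto simp: act_def)
    also have "\<dots> \<in> sets (F j)"
      by (rule sets.finite_INT) (use 1 in auto)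
    finally show ?thesis by simp
  qed
  have V'_meas: "V' j \<in> borel_measurable (F j)" if "j \<le> n" for j
    using that
  proof (induction j)
    case 0
    then show ?case using V_meas[of 0] by (simp add: V'0)
  next
    case (Suc j)
    have [measurable]: "V' j \<in> borel_measurable (F (Suc j))" "V (Suc j) \<in> borel_measurable (F (Suc j))"
      using measurable_filt_mono[of "V' j" j borel "Suc j"] Suc V_meas by auto
    have "{\<omega>\<in>space M. act j \<omega>} \<in> sets (F (Suc j))"
      using act_meas[of j] filt_mono[of j "Suc j"] Suc by auto
    then have [measurable]: "Measurable.pred (F (Suc j)) (act j)"
      by (simp add: pred_def)
    show ?case unfolding V'S by measurable
  qed
  have V'_nonneg: "0 \<le> V' j \<omega>" if "\<omega> \<in> space M" "j \<le> n" for j \<omega>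
    using that by (induction j) (auto simp: V'0 V'S V_nonneg)
  have ind: "integrable M (V' j) \<and> (\<integral>\<omega>. V' j \<omega> \<partial>M) \<le> (1 + C) ^ j * v0" if "j \<le> n" for j
    using that
  proof (induction j)
    case 0
    have "integrable M (V' 0) \<longleftrightarrow> integrable M (\<lambda>_. v0)"
      by (intro Bochner_Integration.integrable_cong) (auto simp: V'0 V0)
    moreover have "(\<integral>\<omega>. V' 0 \<omega> \<partial>M) = (\<integral>\<omega>. v0 \<partial>M)"
      by (intro Bochner_Integration.integral_cong) (auto simp: V'0 V0)
    ultimately show ?case by (simp add: prob_space)
  next
    case (Suc j)
    then have j: "j < n" by simp
    \<comment> \<open>After freezing, \<open>V'\<close> no longer moves: the gradient is replaced by
      0, and the step inequality holds because \<open>V' * w\<close> is nonnegative.\<close>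
    let ?g = "\<lambda>\<omega>. if act j \<omega> then g j \<omega> else 0"
    have [measurable]: "Measurable.pred (F j) (act j)"
      using act_meas[OF j] by (simp add: pred_def)
    note [measurable] = g_meas[OF j]
    have "integrable M (V' (Suc j))" "(\<integral>\<omega>. V' (Suc j) \<omega> \<partial>M) \<le> (1 + C) * (\<integral>\<omega>. V' j \<omega> \<partial>M)"
    proof (rule_tac [!] expectation_step[where j=j and g="?g" and w=w and V="V' j" and c=c and C=C])
      show "V' (Suc j) \<in> borel_measurable M" "V' (Suc j) \<in> borel_measurable M"
        using measurable_filt V'_meas Suc by blast+
      fix \<omega> assume \<omega>: "\<omega> \<in> space M"
      show "norm (?g \<omega>) \<le> c * V' j \<omega>"
        using g[OF j \<omega>] act_V'[of j \<omega>] c V'_nonneg[OF \<omega>, of j] j by (auto simp: act_def)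
      then show "norm (?g \<omega>) \<le> c * V' j \<omega>" .
      show "V' (Suc j) \<omega> \<le> V' j \<omega> + inner (?g \<omega>) (\<xi> j \<omega>) + V' j \<omega> * w (\<xi> j \<omega>)"
        using step[OF j \<omega>] act_V'[of j \<omega>] V'_nonneg[OF \<omega>, of j] j w(2)[of "\<xi> j \<omega>"]
        by (auto simp: V'S act_def)
      then show "V' (Suc j) \<omega> \<le> V' j \<omega> + inner (?g \<omega>) (\<xi> j \<omega>) + V' j \<omega> * w (\<xi> j \<omega>)" .
    qed (use Suc j w V'_meas V'_nonneg in auto)
    moreover have "(1 + C) * (\<integral>\<omega>. V' j \<omega> \<partial>M) \<le> (1 + C) * ((1 + C) ^ j * v0)"
      using Suc C by (intro mult_left_mono) auto
    ultimately show ?case by (simp add: ac_simps)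
  qed
  have reach: "lev \<le> V' n \<omega>" if "\<omega> \<in> space M" "\<forall>j<n. \<omega> \<in> G j" "\<exists>j\<le>n. lev \<le> V j \<omega>" for \<omega>
  proof -
    \<comment> \<open>Before the first index \<open>j\<close> that reaches \<open>lev\<close> the
      process is active, so \<open>V' j = V j\<close>; from \<open>j\<close> on it is inactive and
      the value is kept until \<open>n\<close>. Markov's inequality for the single variable
      \<open>V' n\<close> then controls the whole maximum.\<close>
    define j where "j = (LEAST j. lev \<le> V j \<omega>)"
    have Vj: "lev \<le> V j \<omega>" and jn: "j \<le> n"
      using that(3) unfolding j_def by (auto intro: LeastI Least_le order_trans)
    have less: "V i \<omega> < lev" if "i < j" for i
      using not_less_Least[of i "\<lambda>j. lev \<le> V j \<omega>"] that by (auto simp: j_def not_le)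
    have "V' k \<omega> = V j \<omega>" if "j \<le> k" "k \<le> n" for k
      using that
    proof (induction k rule: dec_induct)
      case base
      show ?case
      proof (cases j)
        case 0 then show ?thesis by (simp add: V'0)
      next
        case (Suc i)
        then have "act i \<omega>"
          using less \<open>\<forall>j<n. \<omega> \<in> G j\<close> jn by (auto simp: act_def)
        then show ?thesis by (simp add: V'S Suc)
      qed
    next
      case (step k)
      have "\<not> act k \<omega>" using Vj step by (auto simp: act_def not_less intro!: exI[of _ j])
      then show ?case using step by (simp add: V'S)
    qed
    with Vj jn show ?thesis by simp
  qed
  have [measurable]: "V' n \<in> borel_measurable M"
    using measurable_filt V'_meas by blast
  have "measure M {\<omega>\<in>space M. (\<forall>j<n. \<omega> \<in> G j) \<and> (\<exists>j\<le>n. lev \<le> V j \<omega>)} \<le> measure M {\<omega>\<in>space M. lev \<le> V' n \<omega>}"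
    by (rule finite_measure_mono) (use reach in auto)
  also have "\<dots> \<le> (\<integral>\<omega>. V' n \<omega> \<partial>M) / lev"
    using ind[of n] V'_nonneg lev by (intro integral_Markov_inequality_measure[where A="{}"]) auto
  also have "\<dots> \<le> (1 + C) ^ n * v0 / lev"
    using ind[of n] lev by (simp add: divide_right_mono)
  finally show ?thesis .
qed

end

section \<open>Independence and moments of Wiener increments\<close>

text \<open>\<open>adapted_aug\<close> makes \<open>X t\<close> only almost surely equal to a
  variable measurable for \<open>nat_filt\<close>. Adding all events of \<open>M\<close> that agree
  almost surely with an event of \<open>N\<close> makes \<open>X t\<close> itself measurable, so
  that the solution is adapted in the literal sense. The collection inside \<open>sigma\<close> is
  already a sigma-algebra.\<close>

definition augment :: "'a measure \<Rightarrow> 'a measure \<Rightarrow> 'a measure" where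
  "augment M N = sigma (space M) {A \<in> sets M. \<exists>B\<in>sets N. AE \<omega> in M. \<omega> \<in> A \<longleftrightarrow> \<omega> \<in> B}"

lemma space_augment [simp]: "space (augment M N) = space M"
  by (simp add: augment_def space_measure_of_conv)

lemma sets_augment:
  assumes N: "subalgebra M N"
  shows "sets (augment M N) = {A \<in> sets M. \<exists>B\<in>sets N. AE \<omega> in M. \<omega> \<in> A \<longleftrightarrow> \<omega> \<in> B}" (is "_ = ?S")
proof -
  have "sigma_algebra (space M) ?S"
    unfolding sigma_algebra_iff2
  proof (intro conjI ballI allI impI)
    show "?S \<subseteq> Pow (space M)" using sets.sets_into_space by auto
    show "{} \<in> ?S" by (auto intro!: bexI[of _ "{}"])
  next
    fix s assume "s \<in> ?S"
    then obtain B where B: "s \<in> sets M" "B \<in> sets N" "AE \<omega> in M. \<omega> \<in> s \<longleftrightarrow> \<omega> \<in> B" by auto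
    have "AE \<omega> in M. \<omega> \<in> space M - s \<longleftrightarrow> \<omega> \<in> space N - B"
      using B(3) N by (auto simp: subalgebra_def)
    moreover have "space N - B \<in> sets N" using B(2) by auto
    ultimately show "space M - s \<in> ?S" using B(1) by blast
  next
    fix A :: "nat \<Rightarrow> _" assume A: "range A \<subseteq> ?S"
    have "\<forall>i. \<exists>B. B \<in> sets N \<and> (AE \<omega> in M. \<omega> \<in> A i \<longleftrightarrow> \<omega> \<in> B)" using A by blast
    then obtain B where B: "\<And>i. B i \<in> sets N" "\<And>i. AE \<omega> in M. \<omega> \<in> A i \<longleftrightarrow> \<omega> \<in> B i" by metis
    have "AE \<omega> in M. \<forall>i. \<omega> \<in> A i \<longleftrightarrow> \<omega> \<in> B i" using B(2) by (simp add: AE_all_countable)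
    then have "AE \<omega> in M. \<omega> \<in> (\<Union>i. A i) \<longleftrightarrow> \<omega> \<in> (\<Union>i. B i)" by auto
    moreover have "(\<Union>i. B i) \<in> sets N" "(\<Union>i. A i) \<in> sets M" using A B(1) by auto
    ultimately show "(\<Union>i. A i) \<in> ?S" by blast
  qed
  then show ?thesis
    unfolding augment_def by (rule sigma_algebra.sets_measure_of_eq)
qed

lemma subalgebra_augment: "subalgebra M N \<Longrightarrow> subalgebra M (augment M N)"
  by (auto simp: subalgebra_def sets_augment)

lemma sets_augment_mono:
  "subalgebra M N \<Longrightarrow> subalgebra M N' \<Longrightarrow> sets N \<subseteq> sets N' \<Longrightarrow> sets (augment M N) \<subseteq> sets (augment M N')"
  by (auto simp: sets_augment)

lemma measurable_augment:
  assumes N: "subalgebra M N" and f: "f \<in> measurable M K" and g: "g \<in> measurable N K"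
    and fg: "AE \<omega> in M. f \<omega> = g \<omega>"
  shows "f \<in> measurable (augment M N) K"
proof (rule measurableI)
  show "f \<omega> \<in> space K" if "\<omega> \<in> space (augment M N)" for \<omega>
    using that measurable_space[OF f] by simp
  fix A assume A: "A \<in> sets K"
  have "AE \<omega> in M. \<omega> \<in> f -` A \<inter> space M \<longleftrightarrow> \<omega> \<in> g -` A \<inter> space N"
    using fg N by (auto simp: subalgebra_def)
  then show "f -` A \<inter> space (augment M N) \<in> sets (augment M N)"
    using measurable_sets[OF f A] measurable_sets[OF g A] unfolding sets_augment[OF N] space_augment by blast
qed

section \<open>Independence of increments from the past of the canonical process\<close>

lemma wiener_prob_space: "wiener_measure M \<Longrightarrow> prob_space M"
  and wiener_space: "wiener_measure M \<Longrightarrow> space M = C0_paths"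
  and wiener_sets: "wiener_measure M \<Longrightarrow> sets M = sigma_sets C0_paths (path_gen C0_paths {0..})"
  by (auto simp: wiener_measure_def)

lemma path_gen_Pow: "path_gen S T \<subseteq> Pow S"
  by (auto simp: path_gen_def)

lemma path_gen_mono: "T \<subseteq> T' \<Longrightarrow> path_gen S T \<subseteq> path_gen S T'"
  unfolding path_gen_def by blast

lemma sets_nat_filt: "sets (nat_filt M t) = sigma_sets (space M) (path_gen (space M) {0..t})"
  by (simp add: nat_filt_def path_gen_Pow)

lemma space_nat_filt [simp]: "space (nat_filt M t) = space M"
  by (simp add: nat_filt_def path_gen_Pow)

lemma subalgebra_nat_filt:
  assumes "wiener_measure M" shows "subalgebra M (nat_filt M t)"
  using sigma_sets_mono'[OF path_gen_mono[of "{0..t}" "{0..}" C0_paths], of C0_paths]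
  by (simp add: subalgebra_def sets_nat_filt wiener_sets[OF assms] wiener_space[OF assms])

lemma nat_filt_mono: "s \<le> t \<Longrightarrow> sets (nat_filt M s) \<subseteq> sets (nat_filt M t)"
  unfolding sets_nat_filt by (intro sigma_sets_mono' path_gen_mono) auto

lemma nat_filt_eval:
  fixes M :: "(real \<Rightarrow> real^'d) measure"
  shows "0 \<le> s \<Longrightarrow> s \<le> t \<Longrightarrow> (\<lambda>\<omega>. \<omega> s) \<in> borel_measurable (nat_filt M t)"
proof (rule measurableI)
  fix A :: "(real^'d) set" assume "0 \<le> s" "s \<le> t" "A \<in> sets borel"
  then have "{\<omega>\<in>space M. \<omega> s \<in> A} \<in> path_gen (space M) {0..t}"
    unfolding path_gen_def by force
  then show "(\<lambda>\<omega>. \<omega> s) -` A \<inter> space (nat_filt M t) \<in> sets (nat_filt M t)"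
    unfolding sets_nat_filt by (auto simp: vimage_def Int_def conj_commute intro!: sigma_sets.Basic)
qed simp

lemma wiener_eval: "wiener_measure M \<Longrightarrow> 0 \<le> s \<Longrightarrow> (\<lambda>\<omega>. \<omega> s) \<in> borel_measurable M"
  using nat_filt_eval[of s s M] subalgebra_nat_filt measurable_from_subalg by blast

text \<open>A generator of \<open>nat_filt M t\<close> that is closed under intersection, as lifting
  independence to the generated sigma-algebra requires. The family \<open>A\<close> is total in
  \<open>s\<close>, which lets two cylinders be merged by padding with \<open>UNIV\<close>.\<close>

definition cylinders :: "(real \<Rightarrow> real^'d) measure \<Rightarrow> real \<Rightarrow> (real \<Rightarrow> real^'d) set set" where
  "cylinders M t = {{\<omega>\<in>space M. \<forall>s\<in>T. \<omega> s \<in> A s} | T A. finite T \<and> T \<subseteq> {0..t} \<and> (\<forall>s. A s \<in> sets borel)}"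

lemma sets_nat_filt_cylinders:
  fixes M :: "(real \<Rightarrow> real^'d) measure"
  shows "sets (nat_filt M t) = sigma_sets (space M) (cylinders M t)"
  unfolding sets_nat_filt
proof (rule antisym)
  have "path_gen (space M) {0..t} \<subseteq> cylinders M t"
    unfolding path_gen_def cylinders_def
  proof safe
    fix s :: real and A :: "(real^'d) set" assume "s \<in> {0..t}" "A \<in> sets borel"
    then show "\<exists>T A'. {\<omega> \<in> space M. \<omega> s \<in> A} = {\<omega> \<in> space M. \<forall>s\<in>T. \<omega> s \<in> A' s} \<and>
       finite T \<and> T \<subseteq> {0..t} \<and> (\<forall>s. A' s \<in> sets borel)"
      by (intro exI[of _ "{s}"] exI[of _ "\<lambda>_. A"]) auto
  qed
  then show "sigma_sets (space M) (path_gen (space M) {0..t}) \<subseteq> sigma_sets (space M) (cylinders M t)"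
    by (rule sigma_sets_mono')
  have "C \<in> sets (nat_filt M t)" if C: "C \<in> cylinders M t" for C
  proof -
    obtain T A where T: "C = {\<omega>\<in>space M. \<forall>s\<in>T. \<omega> s \<in> A s}" "finite T" "T \<subseteq> {0..t}" "\<And>s. A s \<in> sets borel"
      using C by (auto simp: cylinders_def)
    have "{\<omega>\<in>space (nat_filt M t). \<forall>s\<in>T. \<omega> s \<in> A s} \<in> sets (nat_filt M t)"
    proof (rule sets.sets_Collect_finite_All)
      show "finite T" by fact
      fix s assume "s \<in> T"
      then have "(\<lambda>\<omega>. \<omega> s) \<in> borel_measurable (nat_filt M t)"
        using T(3) by (intro nat_filt_eval) auto
      from measurable_sets[OF this T(4)[of s]]
      show "{\<omega> \<in> space (nat_filt M t). \<omega> s \<in> A s} \<in> sets (nat_filt M t)"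
        by (simp add: vimage_def Int_def conj_commute)
    qed
    then show ?thesis by (simp add: T(1))
  qed
  then have "cylinders M t \<subseteq> sigma_sets (space M) (path_gen (space M) {0..t})"
    by (auto simp: sets_nat_filt)
  then show "sigma_sets (space M) (cylinders M t) \<subseteq> sigma_sets (space M) (path_gen (space M) {0..t})"
    by (rule sigma_sets_mono)
qed

lemma Int_stable_cylinders: "Int_stable (cylinders M t)"
proof (rule Int_stableI)
  fix a b assume "a \<in> cylinders M t" "b \<in> cylinders M t"
  then obtain T A T' A' where *: "a = {\<omega>\<in>space M. \<forall>s\<in>T. \<omega> s \<in> A s}" "finite T" "T \<subseteq> {0..t}" "\<forall>s. A s \<in> sets borel"
    "b = {\<omega>\<in>space M. \<forall>s\<in>T'. \<omega> s \<in> A' s}" "finite T'" "T' \<subseteq> {0..t}" "\<forall>s. A' s \<in> sets borel"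
    by (auto simp: cylinders_def)
  let ?A = "\<lambda>s. (if s \<in> T then A s else UNIV) \<inter> (if s \<in> T' then A' s else UNIV)"
  have "a \<inter> b = {\<omega>\<in>space M. \<forall>s\<in>T \<union> T'. \<omega> s \<in> ?A s}"
    by (auto simp: *)
  moreover have "\<forall>s. ?A s \<in> sets borel" using *(4,8) by auto
  ultimately show "a \<inter> b \<in> cylinders M t"
    unfolding cylinders_def using *(2,3,6,7) by (intro CollectI exI[of _ "T \<union> T'"] exI[of _ ?A]) auto
qed

text \<open>Both events are read off from independent scalar increments along one finite grid: the
  cylinder from those up to \<open>t\<close>, the other event from the final increment between
  \<open>t\<close> and \<open>u\<close>. The index blocks \<open>J1\<close> and \<open>J2\<close>
  are disjoint, so independence of grouped variables applies.\<close>

lemma wiener_cylinder_indep: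
  fixes M :: "(real \<Rightarrow> real^'d) measure"
  assumes W: "wiener_measure M" and t: "0 \<le> t" "t < u"
    and C: "C \<in> cylinders M t" and B: "B \<in> sets borel"
  shows "measure M (C \<inter> {\<omega>\<in>space M. \<omega> u - \<omega> t \<in> B}) = measure M C * measure M {\<omega>\<in>space M. \<omega> u - \<omega> t \<in> B}"
proof -
  interpret prob_space M using W by (rule wiener_prob_space)
  obtain T A where T: "C = {\<omega>\<in>space M. \<forall>s\<in>T. \<omega> s \<in> A s}" "finite T" "T \<subseteq> {0..t}" and A: "\<And>s. A s \<in> sets borel"
    using C by (auto simp: cylinders_def)
  \<comment> \<open>Time 0 is inserted because paths start at 0, so that values are sums of
    increments; \<open>t\<close> is inserted so that the last increment of the grid is
    \<open>\<omega> u - \<omega> t\<close>.\<close>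
  define S where "S = insert 0 (insert t T)"
  define ts' where "ts' = sorted_list_of_set S"
  define ts where "ts = ts' @ [u]"
  have S: "finite S" "S \<subseteq> {0..t}" using T t by (auto simp: S_def)
  have ts'_set: "set ts' = S" using S by (simp add: ts'_def)
  have ts'_sorted: "sorted_wrt (<) ts'" by (simp add: ts'_def)
  have sorted: "sorted_wrt (<) ts"
    using S t ts'_set ts'_sorted by (force simp: ts_def sorted_wrt_append)
  have nonneg: "\<forall>s\<in>set ts. 0 \<le> s" using S t ts'_set by (auto simp: ts_def)
  have ne: "ts' \<noteq> []" using ts'_set by (auto simp: S_def)
  define m where "m = length ts' - 1"
  have len': "length ts' = Suc m" using ne by (cases ts') (auto simp: m_def)
  have len: "length ts - 1 = Suc m" by (simp add: ts_def len')
  have tsm: "ts ! Suc m = u" by (simp add: ts_def nth_append len')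
  have ts_nth: "ts ! i = ts' ! i" if "i \<le> m" for i using that by (simp add: ts_def nth_append len')
  have mono: "ts' ! i \<le> ts' ! j" if "i \<le> j" "j \<le> m" for i j
    using ts'_sorted that len' by (metis le_imp_less_Suc less_eq_real_def order_le_less sorted_wrt_iff_nth_less)
  have ts0: "ts ! 0 = 0"
  proof -
    obtain i where i: "i \<le> m" "ts' ! i = 0" using ts'_set len' by (metis S_def in_set_conv_nth insertI1 less_Suc_eq_le)
    then have "ts' ! 0 \<le> 0" using mono[of 0 i] by simp
    moreover have "ts' ! 0 \<in> S" using ts'_set len' by (metis nth_mem zero_less_Suc)
    ultimately show ?thesis using S by (auto simp: ts_nth)
  qed
  have tsmt: "ts ! m = t"
  proof -
    obtain i where i: "i \<le> m" "ts' ! i = t"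
      using ts'_set len' by (metis S_def in_set_conv_nth insertI1 insertI2 less_Suc_eq_le)
    then have "t \<le> ts' ! m" using mono[of i m] by simp
    moreover have "ts' ! m \<in> S" using ts'_set len' by (metis nth_mem lessI)
    ultimately show ?thesis using S by (auto simp: ts_nth)
  qed
  define Z where "Z = (\<lambda>(i, j) \<omega>::real \<Rightarrow> real^'d. (\<omega> (ts ! Suc i) - \<omega> (ts ! i)) $ j)"
  have ind: "indep_vars (\<lambda>_. borel) Z ({..<Suc m} \<times> UNIV)"
    using W sorted nonneg unfolding wiener_measure_def Z_def len[symmetric] by blast
  define J1 J2 where "J1 = {..<m} \<times> (UNIV :: 'd set)" and "J2 = {m} \<times> (UNIV :: 'd set)"
  define P1 P2 where "P1 = PiM J1 (\<lambda>_. borel :: real measure)" and "P2 = PiM J2 (\<lambda>_. borel :: real measure)"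
  let ?R1 = "\<lambda>\<omega>. restrict (\<lambda>i. Z i \<omega>) J1" and ?R2 = "\<lambda>\<omega>. restrict (\<lambda>i. Z i \<omega>) J2"
  have iv: "indep_var P1 ?R1 P2 ?R2"
    unfolding P1_def P2_def by (rule indep_var_restrict[OF ind]) (auto simp: J1_def J2_def)
  \<comment> \<open>\<open>\<phi> i\<close> rebuilds the path at the grid point
    \<open>ts ! i\<close> from the increments before it, by telescoping.\<close>
  define \<phi> where "\<phi> i x = (\<chi> j. \<Sum>l<i. x (l, j))" for i and x :: "nat \<times> 'd \<Rightarrow> real"
  have \<phi>_meas: "\<phi> i \<in> borel_measurable P1" if "i \<le> m" for i
  proof -
    have "(\<lambda>x. \<Sum>l<i. x (l, j)) \<in> borel_measurable P1" for j
      unfolding P1_def using that by (intro borel_measurable_sum measurable_component_singleton) (auto simp: J1_def)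
    then show ?thesis
      by (subst borel_measurable_euclidean_space) (auto simp: \<phi>_def Basis_vec_def inner_axis)
  qed
  have \<phi>_Z: "\<phi> i (restrict (\<lambda>i. Z i \<omega>) J1) = \<omega> (ts ! i)" if "i \<le> m" "\<omega> \<in> space M" for i \<omega>
  proof -
    have "\<omega> 0 = 0" using that wiener_space[OF W] by (auto simp: C0_paths_def)
    have "(\<Sum>l<i. restrict (\<lambda>i. Z i \<omega>) J1 (l, j)) = (\<Sum>l<i. \<omega> (ts ! Suc l) $ j - \<omega> (ts ! l) $ j)" for j
      using that by (intro sum.cong) (auto simp: J1_def Z_def)
    also have "(\<Sum>l<i. \<omega> (ts ! Suc l) $ j - \<omega> (ts ! l) $ j) = \<omega> (ts ! i) $ j" for j
      using sum_lessThan_telescope[of "\<lambda>l. \<omega> (ts ! l) $ j" i] by (simp add: \<open>\<omega> 0 = 0\<close> ts0)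
    finally show ?thesis by (simp add: \<phi>_def vec_eq_iff)
  qed
  have "\<forall>s\<in>T. \<exists>i\<le>m. ts ! i = s"
    using ts'_set len' ts_nth by (metis S_def in_set_conv_nth insertI2 less_Suc_eq_le)
  then obtain ix where ix: "\<And>s. s \<in> T \<Longrightarrow> ix s \<le> m" "\<And>s. s \<in> T \<Longrightarrow> ts ! ix s = s" by metis
  define E1 where "E1 = {x\<in>space P1. \<forall>s\<in>T. \<phi> (ix s) x \<in> A s}"
  have E1: "E1 \<in> sets P1"
    unfolding E1_def
  proof (rule sets.sets_Collect_finite_All)
    show "finite T" by fact
    fix s assume "s \<in> T"
    from measurable_sets[OF \<phi>_meas[OF ix(1)[OF this]] A[of s]]
    show "{x \<in> space P1. \<phi> (ix s) x \<in> A s} \<in> sets P1"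
      by (simp add: vimage_def Int_def conj_commute)
  qed
  define \<psi> where "\<psi> x = (\<chi> j. x (m, j))" for x :: "nat \<times> 'd \<Rightarrow> real"
  have \<psi>_meas: "\<psi> \<in> borel_measurable P2"
  proof -
    have "(\<lambda>x. x (m, j)) \<in> borel_measurable P2" for j
      unfolding P2_def by (intro measurable_component_singleton) (auto simp: J2_def)
    then show ?thesis
      by (subst borel_measurable_euclidean_space) (auto simp: \<psi>_def Basis_vec_def inner_axis)
  qed
  define E2 where "E2 = \<psi> -` B \<inter> space P2"
  have E2: "E2 \<in> sets P2" unfolding E2_def by (rule measurable_sets[OF \<psi>_meas B])
  have rv1: "?R1 \<in> measurable M P1" and rv2: "?R2 \<in> measurable M P2"
    using indep_var_rv1[OF iv] indep_var_rv2[OF iv] by auto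
  have C_eq: "?R1 -` E1 \<inter> space M = C"
    using measurable_space[OF rv1] ix by (auto simp: E1_def T(1) \<phi>_Z)
  have B_eq: "?R2 -` E2 \<inter> space M = {\<omega>\<in>space M. \<omega> u - \<omega> t \<in> B}"
    using measurable_space[OF rv2] by (auto simp: E2_def \<psi>_def Z_def J2_def tsm tsmt vec_lambda_eta
        simp del: vector_minus_component)
  have "indep_set (sigma_sets (space M) {?R1 -` A \<inter> space M |A. A \<in> sets P1})
      (sigma_sets (space M) {?R2 -` A \<inter> space M |A. A \<in> sets P2})"
    using iv unfolding indep_var_eq by blast
  from indep_setD[OF this, of C "{\<omega>\<in>space M. \<omega> u - \<omega> t \<in> B}"]
  show ?thesis
    using E1 E2 C_eq B_eq by (blast intro: sigma_sets.Basic)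
qed

lemma wiener_increment_measurable:
  assumes "wiener_measure M" "0 \<le> s" "0 \<le> t"
  shows "(\<lambda>\<omega>. \<omega> t - \<omega> s) \<in> borel_measurable M"
  using wiener_eval[OF assms(1,2)] wiener_eval[OF assms(1,3)] by simp

lemma wiener_nat_filt_indep:
  assumes W: "wiener_measure M" and t: "0 \<le> t" "t < u"
    and A: "A \<in> sets (nat_filt M t)" and B: "B \<in> sets borel"
  shows "measure M (A \<inter> {\<omega>\<in>space M. \<omega> u - \<omega> t \<in> B}) = measure M A * measure M {\<omega>\<in>space M. \<omega> u - \<omega> t \<in> B}"
proof -
  interpret prob_space M using W by (rule wiener_prob_space)
  let ?B = "{{\<omega>\<in>space M. \<omega> u - \<omega> t \<in> B} |B. B \<in> sets borel}"
  have sub: "cylinders M t \<subseteq> sets M"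
    using subalgebra_nat_filt[OF W, of t] sigma_sets_superset_generator[of "cylinders M t" "space M"]
    unfolding subalgebra_def sets_nat_filt_cylinders by blast
  have ev: "{\<omega>\<in>space M. \<omega> u - \<omega> t \<in> B} \<in> sets M" if "B \<in> sets borel" for B
    using measurable_sets[OF wiener_increment_measurable[OF W, of t u] that] t
    by (simp add: vimage_def Int_def conj_commute)
  have "indep_set (sigma_sets (space M) (cylinders M t)) (sigma_sets (space M) ?B)"
  proof (rule indep_set_sigma_sets)
    show "indep_set (cylinders M t) ?B"
      using sub ev wiener_cylinder_indep[OF W t] by (auto simp: indep_sets2_eq)
    show "Int_stable ?B"
    proof (rule Int_stableI)
      fix a b assume "a \<in> ?B" "b \<in> ?B"
      then obtain A' B' where *: "a = {\<omega>\<in>space M. \<omega> u - \<omega> t \<in> A'}" "b = {\<omega>\<in>space M. \<omega> u - \<omega> t \<in> B'}"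
        "A' \<in> sets borel" "B' \<in> sets borel" by auto
      then have "a \<inter> b = {\<omega>\<in>space M. \<omega> u - \<omega> t \<in> A' \<inter> B'}" "A' \<inter> B' \<in> sets borel" by auto
      then show "a \<inter> b \<in> ?B" by blast
    qed
  qed (rule Int_stable_cylinders)
  then show ?thesis
    using A B unfolding sets_nat_filt_cylinders by (intro indep_setD) (auto intro!: sigma_sets.Basic)
qed

text \<open>An event of the augmentation may be exchanged for an almost surely equal one in
  \<open>nat_filt M t\<close> without changing any probability, which reduces the claim to
  independence from the natural filtration.\<close>

lemma wiener_augment_indep:
  fixes f :: "(real \<Rightarrow> real^'d) \<Rightarrow> real" and w :: "real^'d \<Rightarrow> real"
  assumes W: "wiener_measure M" and t: "0 \<le> t" "t < u"
    and f: "f \<in> borel_measurable (augment M (nat_filt M t))" and w: "w \<in> borel_measurable borel"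
  shows "prob_space.indep_var M borel f borel (\<lambda>\<omega>. w (\<omega> u - \<omega> t))"
proof -
  interpret prob_space M using W by (rule wiener_prob_space)
  let ?w = "\<lambda>\<omega>. w (\<omega> u - \<omega> t)"
  let ?P = "\<lambda>g :: (real \<Rightarrow> real^'d) \<Rightarrow> real. {g -` A \<inter> space M |A. A \<in> sets borel}"
  note sub = subalgebra_nat_filt[OF W, of t]
  have fM: "f \<in> borel_measurable M"
    using measurable_from_subalg[OF subalgebra_augment[OF sub] f] .
  have wM: "?w \<in> borel_measurable M"
    using measurable_compose[OF wiener_increment_measurable[OF W, of t u] w] t by simp
  have prod: "prob (a \<inter> b) = prob a * prob b"
    if a: "a \<in> ?P f" and b: "b \<in> ?P ?w" for a b
  proof -
    obtain A where A: "a = f -` A \<inter> space M" "A \<in> sets borel" using a by auto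
    obtain B where B: "b = ?w -` B \<inter> space M" "B \<in> sets borel" using b by auto
    have b_eq: "b = {\<omega>\<in>space M. \<omega> u - \<omega> t \<in> w -` B}" using B by auto
    have wB: "w -` B \<in> sets borel" using measurable_sets[OF w B(2)] by simp
    have "a \<in> sets (augment M (nat_filt M t))"
      using measurable_sets[OF f A(2)] by (simp add: A(1))
    then obtain a' where a': "a \<in> sets M" "a' \<in> sets (nat_filt M t)" "AE \<omega> in M. \<omega> \<in> a \<longleftrightarrow> \<omega> \<in> a'"
      by (auto simp: sets_augment[OF sub])
    have a'M: "a' \<in> sets M" using a'(2) sub by (auto simp: subalgebra_def)
    have bM: "b \<in> sets M" using measurable_sets[OF wM B(2)] by (simp add: B(1))
    have "prob (a \<inter> b) = prob (a' \<inter> b)"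
      using a' a'M bM by (intro finite_measure_eq_AE) auto
    also have "\<dots> = prob a' * prob b"
      unfolding b_eq by (rule wiener_nat_filt_indep[OF W t a'(2) wB])
    also have "prob a' = prob a"
      using a' a'M by (intro finite_measure_eq_AE) auto
    finally show ?thesis .
  qed
  have IS: "Int_stable (?P g)" for g :: "(real \<Rightarrow> real^'d) \<Rightarrow> real"
  proof (rule Int_stableI)
    fix a b assume "a \<in> ?P g" "b \<in> ?P g"
    then obtain A B where "a = g -` A \<inter> space M" "b = g -` B \<inter> space M" "A \<in> sets borel" "B \<in> sets borel" by auto
    then have "a \<inter> b = g -` (A \<inter> B) \<inter> space M" "A \<inter> B \<in> sets borel" by auto
    then show "a \<inter> b \<in> ?P g" by blast
  qed
  have "indep_set (?P f) (?P ?w)"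
    unfolding indep_sets2_eq using prod measurable_sets[OF fM] measurable_sets[OF wM] by blast
  then show ?thesis
    unfolding indep_var_eq using fM wM by (auto intro!: indep_set_sigma_sets IS)
qed

section \<open>Gaussian moments of the increments\<close>

lemma wiener_increment_normal:
  assumes W: "wiener_measure M" and st: "0 \<le> s" "s < t"
  shows "distributed M lborel (\<lambda>\<omega>. (\<omega> t - \<omega> s) $ j) (\<lambda>x. ennreal (normal_density 0 (sqrt (t - s)) x))"
  using W st unfolding wiener_measure_def
  by (elim conjE allE[of _ "[s, t]"]) auto

lemma wiener_increment_mean:
  assumes W: "wiener_measure M" and st: "0 \<le> s" "s < t"
  shows "integrable M (\<lambda>\<omega>. (\<omega> t - \<omega> s) $ j)" "(\<integral>\<omega>. (\<omega> t - \<omega> s) $ j \<partial>M) = 0"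
proof -
  note d = wiener_increment_normal[OF W st, of j]
  have s: "0 < sqrt (t - s)" using st by simp
  have h: "has_bochner_integral lborel (\<lambda>x. normal_density 0 (sqrt (t - s)) x * x) 0"
    using normal_moment_odd[OF s, of 0 0] by simp
  show "integrable M (\<lambda>\<omega>. (\<omega> t - \<omega> s) $ j)"
    using distributed_integrable[OF d, of "\<lambda>x. x"] integrable.intros[OF h] by simp
  show "(\<integral>\<omega>. (\<omega> t - \<omega> s) $ j \<partial>M) = 0"
    using distributed_integral[OF d, of "\<lambda>x. x"] has_bochner_integral_integral_eq[OF h] by simp
qed

lemma wiener_increment_even_moment:
  assumes W: "wiener_measure M" and st: "0 \<le> s" "s < t"
  shows "integrable M (\<lambda>\<omega>. ((\<omega> t - \<omega> s) $ j) ^ (2 * k))"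
    "(\<integral>\<omega>. ((\<omega> t - \<omega> s) $ j) ^ (2 * k) \<partial>M) = fact (2 * k) / (2 ^ k * fact k) * (t - s) ^ k"
proof -
  note d = wiener_increment_normal[OF W st, of j]
  have s: "0 < sqrt (t - s)" using st by simp
  note h = normal_moment_even[OF s, of 0 k, simplified]
  show "integrable M (\<lambda>\<omega>. ((\<omega> t - \<omega> s) $ j) ^ (2 * k))"
    using distributed_integrable[OF d, of "\<lambda>x. x ^ (2 * k)"] integrable.intros[OF h] by simp
  have "(\<integral>\<omega>. ((\<omega> t - \<omega> s) $ j) ^ (2 * k) \<partial>M) = fact (2 * k) / ((2 / (t - s)) ^ k * fact k)"
    using distributed_integral[OF d, of "\<lambda>x. x ^ (2 * k)"] has_bochner_integral_integral_eq[OF h] st by simp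
  then show "(\<integral>\<omega>. ((\<omega> t - \<omega> s) $ j) ^ (2 * k) \<partial>M) = fact (2 * k) / (2 ^ k * fact k) * (t - s) ^ k"
    using st by (simp add: field_simps power_divide)
qed

text \<open>If \<open>i\<close> is a coordinate of largest modulus, \<open>|z|^2\<close> is at most
  the dimension times \<open>(z $ i)^2\<close>. This reduces moments of the norm to one-dimensional
  Gaussian moments.\<close>

lemma norm_even_power_le:
  fixes z :: "real^'d"
  shows "norm z ^ (2 * k) \<le> real CARD('d) ^ k * (\<Sum>j\<in>UNIV. (z $ j) ^ (2 * k))"
proof -
  obtain i where i: "\<And>j. \<bar>z $ j\<bar> \<le> \<bar>z $ i\<bar>"
  proof -
    have "Max (range (\<lambda>j. \<bar>z $ j\<bar>)) \<in> range (\<lambda>j. \<bar>z $ j\<bar>)" by (rule Max_in) auto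
    then obtain i where "Max (range (\<lambda>j. \<bar>z $ j\<bar>)) = \<bar>z $ i\<bar>" by (rule imageE)
    then have "\<bar>z $ j\<bar> \<le> \<bar>z $ i\<bar>" for j by (metis Max_ge finite finite_imageI rangeI)
    then show ?thesis using that by blast
  qed
  have "norm z ^ 2 = (\<Sum>j\<in>UNIV. (z $ j) ^ 2)"
    by (simp add: norm_vec_def L2_set_def sum_nonneg)
  also have "\<dots> \<le> (\<Sum>j\<in>(UNIV::'d set). (z $ i) ^ 2)"
    using i by (intro sum_mono) (simp add: abs_le_square_iff)
  finally have "norm z ^ 2 \<le> real CARD('d) * (z $ i) ^ 2" by simp
  then have "(norm z ^ 2) ^ k \<le> (real CARD('d) * (z $ i) ^ 2) ^ k"
    by (intro power_mono) auto
  also have "\<dots> = real CARD('d) ^ k * (z $ i) ^ (2 * k)"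
    by (simp add: power_mult_distrib power_mult)
  also have "\<dots> \<le> real CARD('d) ^ k * (\<Sum>j\<in>UNIV. (z $ j) ^ (2 * k))"
    by (intro mult_left_mono member_le_sum) auto
  finally show ?thesis by (simp add: power_mult)
qed

text \<open>The quotient of factorials is the moment of order \<open>2 * k\<close> of a standard
  normal variable; \<open>d ^ k\<close> comes from comparing the norm with its coordinates, and one
  more \<open>d\<close> from summing over them.\<close>

definition gauss_const :: "nat \<Rightarrow> nat \<Rightarrow> real" where
  "gauss_const d k = real d ^ (k + 1) * (fact (2 * k) / (2 ^ k * fact k))"

lemma gauss_const_nonneg: "0 \<le> gauss_const d k"
  by (simp add: gauss_const_def)

lemma wiener_increment_norm_moment:
  fixes M :: "(real \<Rightarrow> real^'d) measure"
  assumes W: "wiener_measure M" and st: "0 \<le> s" "s < t"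
  shows "integrable M (\<lambda>\<omega>. norm (\<omega> t - \<omega> s) ^ (2 * k))"
    "(\<integral>\<omega>. norm (\<omega> t - \<omega> s) ^ (2 * k) \<partial>M) \<le> gauss_const CARD('d) k * (t - s) ^ k"
proof -
  note m = wiener_increment_even_moment[OF W st, of _ k]
  let ?R = "\<lambda>\<omega>. real CARD('d) ^ k * (\<Sum>j\<in>UNIV. ((\<omega> t - \<omega> s) $ j) ^ (2 * k))"
  have i: "integrable M ?R"
    using m(1) by (intro integrable_mult_right Bochner_Integration.integrable_sum)
  have le: "norm (\<omega> t - \<omega> s) ^ (2 * k) \<le> ?R \<omega>" for \<omega> :: "real \<Rightarrow> real^'d"
    by (rule norm_even_power_le)
  have [measurable]: "(\<lambda>\<omega>. \<omega> t - \<omega> s) \<in> borel_measurable M"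
    using wiener_increment_measurable[OF W, of s t] st by simp
  show i': "integrable M (\<lambda>\<omega>. norm (\<omega> t - \<omega> s) ^ (2 * k))"
    by (rule Bochner_Integration.integrable_bound[OF i]) (use le in \<open>auto intro!: AE_I2 order_trans[OF le] abs_ge_self\<close>)
  have "(\<integral>\<omega>. norm (\<omega> t - \<omega> s) ^ (2 * k) \<partial>M) \<le> (\<integral>\<omega>. ?R \<omega> \<partial>M)"
    by (rule integral_mono[OF i' i]) (rule le)
  also have "\<dots> = gauss_const CARD('d) k * (t - s) ^ k"
    using m by (simp add: gauss_const_def)
  finally show "(\<integral>\<omega>. norm (\<omega> t - \<omega> s) ^ (2 * k) \<partial>M) \<le> gauss_const CARD('d) k * (t - s) ^ k" .
qed

lemma wiener_noise_filtration:
  assumes W: "wiener_measure M" and h: "0 < h"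
  shows "noise_filtration M (\<lambda>j. augment M (nat_filt M (real j * h))) (\<lambda>j \<omega>. \<omega> (real (Suc j) * h) - \<omega> (real j * h))"
proof -
  interpret prob_space M using W by (rule wiener_prob_space)
  note sub = subalgebra_nat_filt[OF W]
  have lt: "real j * h < real (Suc j) * h" "0 \<le> real j * h" for j using h by (auto simp: algebra_simps)
  show ?thesis
  proof unfold_locales
    fix i j :: nat and l
    show "subalgebra M (augment M (nat_filt M (real j * h)))" by (intro subalgebra_augment sub)
    show "sets (augment M (nat_filt M (real i * h))) \<subseteq> sets (augment M (nat_filt M (real j * h)))" if "i \<le> j"
      using that h by (intro sets_augment_mono sub nat_filt_mono mult_right_mono) auto
    have "(\<lambda>\<omega>. \<omega> (real (Suc j) * h) - \<omega> (real j * h)) \<in> borel_measurable (nat_filt M (real (Suc j) * h))"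
      using lt[of j] by (intro borel_measurable_diff nat_filt_eval) auto
    then show "(\<lambda>\<omega>. \<omega> (real (Suc j) * h) - \<omega> (real j * h)) \<in> borel_measurable (augment M (nat_filt M (real (Suc j) * h)))"
      using lt[of j] by (intro measurable_augment[OF sub] wiener_increment_measurable[OF W]) (auto intro: less_imp_le)
    show "integrable M (\<lambda>\<omega>. (\<omega> (real (Suc j) * h) - \<omega> (real j * h)) $ l)"
      "(\<integral>\<omega>. (\<omega> (real (Suc j) * h) - \<omega> (real j * h)) $ l \<partial>M) = 0"
      using wiener_increment_mean[OF W lt(2,1)] by auto
    show "indep_var borel f borel (\<lambda>\<omega>. w (\<omega> (real (Suc j) * h) - \<omega> (real j * h)))"
      if "f \<in> borel_measurable (augment M (nat_filt M (real j * h)))" "w \<in> borel_measurable borel"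
      for f :: "_ \<Rightarrow> real" and w :: "_ \<Rightarrow> real"
      using wiener_augment_indep[OF W lt(2)[of j] lt(1)[of j] that] .
  qed
qed

section \<open>Moments of the scheme\<close>

lemma power_between_le:
  fixes x :: real
  assumes "0 \<le> x" "i \<le> j" "j \<le> k"
  shows "x ^ j \<le> x ^ i + x ^ k"
proof (cases "x \<le> 1")
  case True
  have "x ^ j \<le> x ^ i" using assms True by (intro power_decreasing) auto
  then show ?thesis using assms by (simp add: add_increasing2)
next
  case False
  have "x ^ j \<le> x ^ k" using assms False by (intro power_increasing) auto
  then show ?thesis using assms by (simp add: add_increasing)
qed

lemma power_add_le_two_power:
  fixes x y :: real
  assumes "0 \<le> x" "0 \<le> y"
  shows "(x + y) ^ n \<le> 2 ^ n * (x ^ n + y ^ n)"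
proof -
  have "(x + y) ^ n \<le> (2 * max x y) ^ n" using assms by (intro power_mono) auto
  also have "\<dots> = 2 ^ n * (max x y) ^ n" by (rule power_mult_distrib)
  also have "\<dots> \<le> 2 ^ n * (x ^ n + y ^ n)"
    using assms by (intro mult_left_mono) (auto simp: max_def)
  finally show ?thesis .
qed

text \<open>Binomial expansion with the linear term kept exact, because it contains the centred
  noise and has to average out. The other powers lie between the second and the \<open>r\<close>-th,
  and their coefficients sum to at most \<open>2 ^ r\<close>.\<close>

lemma one_plus_power_le:
  fixes u :: real
  assumes "2 \<le> r"
  shows "(1 + u) ^ r \<le> 1 + real r * u + 2 ^ r * (u\<^sup>2 + \<bar>u\<bar> ^ r)"
proof -
  have eq: "{..r} = {0, 1} \<union> {2..r}" using assms by auto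
  have "(1 + u) ^ r = (\<Sum>i\<le>r. real (r choose i) * u ^ i)"
    using binomial_ring[of u 1 r] by (simp add: add.commute)
  also have "\<dots> = 1 + real r * u + (\<Sum>i\<in>{2..r}. real (r choose i) * u ^ i)"
    unfolding eq by (subst sum.union_disjoint) auto
  also have "(\<Sum>i\<in>{2..r}. real (r choose i) * u ^ i) \<le> (\<Sum>i\<in>{2..r}. real (r choose i) * (u\<^sup>2 + \<bar>u\<bar> ^ r))"
  proof (intro sum_mono mult_left_mono)
    fix i assume "i \<in> {2..r}"
    then have "\<bar>u\<bar> ^ i \<le> \<bar>u\<bar>\<^sup>2 + \<bar>u\<bar> ^ r" by (intro power_between_le) auto
    then show "u ^ i \<le> u\<^sup>2 + \<bar>u\<bar> ^ r" by (metis abs_ge_self order_trans power2_abs power_abs)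
  qed simp
  also have "\<dots> = (\<Sum>i\<in>{2..r}. real (r choose i)) * (u\<^sup>2 + \<bar>u\<bar> ^ r)"
    by (simp add: sum_distrib_right)
  also have "\<dots> \<le> 2 ^ r * (u\<^sup>2 + \<bar>u\<bar> ^ r)"
  proof (intro mult_right_mono)
    have "(\<Sum>i\<in>{2..r}. real (r choose i)) \<le> (\<Sum>i\<le>r. real (r choose i))"
      by (intro sum_mono2) auto
    also have "\<dots> = 2 ^ r" using choose_row_sum[of r] by (metis of_nat_numeral of_nat_power of_nat_sum)
    finally show "(\<Sum>i\<in>{2..r}. real (r choose i)) \<le> 2 ^ r" .
  qed simp
  finally show ?thesis by simp
qed

text \<open>A factor \<open>1 + C * h\<close> per step over a bounded time span gives a constant
  free of \<open>h\<close>; every use of the maximal inequality ends with this bound.\<close>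

lemma one_plus_power_le_exp:
  fixes C h :: real
  assumes "0 \<le> C" "0 \<le> h" "real n * h \<le> T"
  shows "(1 + C * h) ^ n \<le> exp (C * T)"
proof -
  have "(1 + C * h) ^ n \<le> exp (C * h) ^ n"
    using assms by (intro power_mono) (auto simp: exp_ge_add_one_self)
  also have "\<dots> = exp (C * (real n * h))" by (simp add: exp_of_nat_mult[symmetric] ac_simps)
  also have "\<dots> \<le> exp (C * T)" using assms by (auto intro!: mult_left_mono)
  finally show ?thesis .
qed

section \<open>The scheme as an adapted process\<close>

locale repeated_interaction =
  fixes M :: "(real \<Rightarrow> real^'d) measure"
    and b :: "real^'m \<Rightarrow> real^'m" and \<sigma> :: "real^'m \<Rightarrow> real^'d^'m"
    and \<eta> :: "real \<Rightarrow> real^'m \<Rightarrow> real^'d \<Rightarrow> real^'m"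
    and \<alpha> :: ereal and K1 K2 :: real and x0 :: "real^'m"
  assumes W: "wiener_measure M"
    and loc_lip: "\<forall>N>0. \<exists>K. \<forall>x y. norm x \<le> N \<longrightarrow> norm y \<le> N \<longrightarrow>
                   norm (b x - b y) \<le> K * norm (x - y) \<and> norm (\<sigma> x - \<sigma> y) \<le> K * norm (x - y)"
    and lin_growth: "\<forall>x. norm (b x) \<le> K1 * (1 + norm x) \<and> norm (\<sigma> x) \<le> K1 * (1 + norm x)"
    and eta_meas: "\<forall>h>0. (\<lambda>(x, y). \<eta> h x y) \<in> borel_measurable borel"
    and alpha: "0 < \<alpha>"
    and eta_bound: "\<forall>h>0. \<forall>x y. norm (\<eta> h x y) \<le> K2 * (h_pow \<alpha> h * norm x + norm y)"
begin

sublocale prob_space M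
  using W by (rule wiener_prob_space)

definition filt :: "real \<Rightarrow> nat \<Rightarrow> (real \<Rightarrow> real^'d) measure" where
  "filt h j = augment M (nat_filt M (real j * h))"

definition dW :: "real \<Rightarrow> nat \<Rightarrow> (real \<Rightarrow> real^'d) \<Rightarrow> real^'d" where
  "dW h j \<omega> = \<omega> (real (Suc j) * h) - \<omega> (real j * h)"

definition Y :: "real \<Rightarrow> nat \<Rightarrow> (real \<Rightarrow> real^'d) \<Rightarrow> real^'m" where
  "Y h k \<omega> = scheme (U_map b \<sigma> \<eta>) h x0 \<omega> k"

lemma Y_0: "Y h 0 \<omega> = x0"
  and Y_Suc: "Y h (Suc k) \<omega> = Y h k \<omega> + \<sigma> (Y h k \<omega>) *v dW h k \<omega> + h *\<^sub>R b (Y h k \<omega>) + h *\<^sub>R \<eta> h (Y h k \<omega>) (dW h k \<omega>)"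
  by (simp_all add: Y_def dW_def U_map_def)

lemma noise: "0 < h \<Longrightarrow> noise_filtration M (filt h) (dW h)"
  using wiener_noise_filtration[OF W] unfolding filt_def dW_def by blast

lemma dW_moment:
  assumes "0 < h"
  shows "integrable M (\<lambda>\<omega>. norm (dW h j \<omega>) ^ (2 * k))"
    "(\<integral>\<omega>. norm (dW h j \<omega>) ^ (2 * k) \<partial>M) \<le> gauss_const CARD('d) k * h ^ k"
  using wiener_increment_norm_moment[OF W, of "real j * h" "real (Suc j) * h" k] assms
  by (auto simp: dW_def algebra_simps)

lemma dW_measurable [measurable]: "0 < h \<Longrightarrow> dW h j \<in> borel_measurable M"
  unfolding dW_def by (intro wiener_increment_measurable[OF W]) auto

lemma K1_nonneg: "0 \<le> K1"
  using lin_growth norm_ge_zero[of "b 0"] by (metis add.right_neutral mult.right_neutral norm_zero order_trans)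

lemma lipschitz_on_ball:
  obtains L where "0 < L" "\<And>x y. norm x \<le> N \<Longrightarrow> norm y \<le> N \<Longrightarrow> norm (b x - b y) \<le> L * norm (x - y)"
    "\<And>x y. norm x \<le> N \<Longrightarrow> norm y \<le> N \<Longrightarrow> norm (\<sigma> x - \<sigma> y) \<le> L * norm (x - y)"
proof -
  \<comment> \<open>\<open>max N 1\<close> secures the positive radius demanded by
    \<open>loc_lip\<close>, and \<open>max K 1\<close> below secures a positive Lipschitz
    constant.\<close>
  obtain K where K: "\<And>x y. norm x \<le> max N 1 \<Longrightarrow> norm y \<le> max N 1 \<Longrightarrow>
      norm (b x - b y) \<le> K * norm (x - y) \<and> norm (\<sigma> x - \<sigma> y) \<le> K * norm (x - y)"
    using loc_lip[THEN spec, of "max N 1"] by (auto simp del: max.bounded_iff)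
  have le: "K * norm (x - y) \<le> max K 1 * norm (x - y)" for x y :: "real^'m"
    by (intro mult_right_mono) auto
  show ?thesis
    by (rule that[of "max K 1"]) (use K in \<open>auto intro!: order_trans[OF _ le]\<close>)
qed

lemma continuous_b: "continuous_on UNIV b" and continuous_\<sigma>: "continuous_on UNIV \<sigma>"
proof -
  have "isCont b x \<and> isCont \<sigma> x" for x
  proof -
    obtain L where L: "0 < L" "\<And>x' y. norm x' \<le> norm x + 1 \<Longrightarrow> norm y \<le> norm x + 1 \<Longrightarrow> norm (b x' - b y) \<le> L * norm (x' - y)"
      "\<And>x' y. norm x' \<le> norm x + 1 \<Longrightarrow> norm y \<le> norm x + 1 \<Longrightarrow> norm (\<sigma> x' - \<sigma> y) \<le> L * norm (x' - y)"
      using lipschitz_on_ball[of "norm x + 1"] by metis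
    have ev: "\<forall>\<^sub>F y in at x. norm y \<le> norm x + 1"
      unfolding eventually_at by (intro exI[of _ 1]) (auto simp: dist_norm, norm)
    have lim: "((\<lambda>y. L * norm (y - x)) \<longlongrightarrow> 0) (at x)"
      by (auto intro!: tendsto_eq_intros)
    have "((\<lambda>y. b y - b x) \<longlongrightarrow> 0) (at x)" "((\<lambda>y. \<sigma> y - \<sigma> x) \<longlongrightarrow> 0) (at x)"
      using ev L(2,3) by (auto intro!: Lim_null_comparison[OF _ lim] elim!: eventually_mono)
    then show ?thesis
      unfolding isCont_def by (simp add: LIM_zero_iff)
  qed
  then show "continuous_on UNIV b" "continuous_on UNIV \<sigma>"
    by (auto intro: continuous_at_imp_continuous_on)
qed

lemma measurable_b [measurable]: "b \<in> borel_measurable borel" and measurable_\<sigma> [measurable]: "\<sigma> \<in> borel_measurable borel"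
  using continuous_b continuous_\<sigma> by (auto intro: borel_measurable_continuous_onI)

lemma measurable_\<eta> [measurable (raw)]:
  assumes "0 < h" "f \<in> borel_measurable N" "g \<in> borel_measurable N"
  shows "(\<lambda>\<omega>. \<eta> h (f \<omega>) (g \<omega>)) \<in> borel_measurable N"
  using measurable_compose[OF borel_measurable_Pair[OF assms(2,3)] eta_meas[rule_format, OF assms(1)]] by simp

lemma Y_measurable: "0 < h \<Longrightarrow> Y h k \<in> borel_measurable (filt h k)"
proof (induction k)
  case 0
  have "Y h 0 = (\<lambda>_. x0)" by (simp add: fun_eq_iff Y_0)
  then show ?case by simp
next
  case (Suc k)
  interpret noise_filtration M "filt h" "dW h" using noise Suc by blast
  have [measurable]: "Y h k \<in> borel_measurable (filt h (Suc k))" "dW h k \<in> borel_measurable (filt h (Suc k))"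
    using measurable_filt_mono[of "Y h k" k borel "Suc k"] Suc noise_meas by auto
  have "Y h (Suc k) = (\<lambda>\<omega>. Y h k \<omega> + \<sigma> (Y h k \<omega>) *v dW h k \<omega> + h *\<^sub>R b (Y h k \<omega>) + h *\<^sub>R \<eta> h (Y h k \<omega>) (dW h k \<omega>))"
    by (simp add: fun_eq_iff Y_Suc)
  then show ?case using Suc.prems by simp
qed

lemma Y_measurable_M [measurable]: "0 < h \<Longrightarrow> Y h k \<in> borel_measurable M"
  using Y_measurable noise_filtration.measurable_filt[OF noise] by blast

lemma h_pow_nonneg: "0 \<le> h_pow \<alpha> h"
  by (simp add: h_pow_def)

lemma h_pow_le_1: "0 < h \<Longrightarrow> h \<le> 1 \<Longrightarrow> h_pow \<alpha> h \<le> 1"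
  using alpha by (auto simp: h_pow_def real_of_ereal_pos powr_le1)

lemma h_pow_tendsto_0: "(h_pow \<alpha> \<longlongrightarrow> 0) (at_right 0)"
proof (cases "\<alpha> = \<infinity>")
  case True
  then have "h_pow \<alpha> = (\<lambda>_. 0)" by (auto simp: h_pow_def)
  then show ?thesis by simp
next
  case False
  then have pos: "0 < real_of_ereal \<alpha>"
    using alpha by (cases \<alpha>) auto
  have "((\<lambda>h. h powr real_of_ereal \<alpha>) \<longlongrightarrow> 0) (at_right 0)"
    using pos by (intro tendsto_zero_powrI[OF tendsto_ident_at tendsto_const]) (auto simp: eventually_at_filter)
  moreover have "h_pow \<alpha> = (\<lambda>h. h powr real_of_ereal \<alpha>)" using False by (auto simp: h_pow_def)
  ultimately show ?thesis by simp
qed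

text \<open>The sign of \<open>K2\<close> is not given, hence \<open>|K2|\<close>. The sharp form
  keeps the factor \<open>h_pow \<alpha> h\<close>, which makes the interaction vanish in the limit;
  the crude form, with that factor bounded by 1, is enough for moments.\<close>

lemma eta_bound':
  assumes "0 < h" "h \<le> 1"
  shows "norm (\<eta> h x y) \<le> \<bar>K2\<bar> * (h_pow \<alpha> h * norm x + norm y)" "norm (\<eta> h x y) \<le> \<bar>K2\<bar> * (norm x + norm y)"
proof -
  have "norm (\<eta> h x y) \<le> K2 * (h_pow \<alpha> h * norm x + norm y)" using eta_bound assms by blast
  also have "\<dots> \<le> \<bar>K2\<bar> * (h_pow \<alpha> h * norm x + norm y)"
    using h_pow_nonneg by (intro mult_right_mono) auto
  finally show 1: "norm (\<eta> h x y) \<le> \<bar>K2\<bar> * (h_pow \<alpha> h * norm x + norm y)" .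
  also have "\<dots> \<le> \<bar>K2\<bar> * (norm x + norm y)"
    using h_pow_le_1[OF assms] by (intro mult_left_mono add_right_mono mult_left_le_one_le h_pow_nonneg) auto
  finally show "norm (\<eta> h x y) \<le> \<bar>K2\<bar> * (norm x + norm y)" .
qed

text \<open>Linear growth in the state, times a factor that is small together with the noise and the
  step. This serves the Lyapunov estimate and, later, the last cell of the interpolation.\<close>

lemma scheme_increment_bound:
  assumes h: "0 < h" "h \<le> 1"
  shows "norm (\<sigma> y *v z + h *\<^sub>R b y + h *\<^sub>R \<eta> h y z) \<le> (K1 + \<bar>K2\<bar>) * (1 + norm y) * (norm z + h)"
proof -
  have s: "norm (\<sigma> y *v z) \<le> K1 * (1 + norm y) * norm z"
    using lin_growth by (meson mult_right_mono norm_ge_zero norm_matrix_vector_mult_le order_trans)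
  have b: "norm (h *\<^sub>R b y) \<le> h * (K1 * (1 + norm y))"
    using lin_growth h by auto
  have "norm (h *\<^sub>R \<eta> h y z) \<le> h * (\<bar>K2\<bar> * (norm y + norm z))"
    using eta_bound'[OF h] h by auto
  also have "\<dots> = \<bar>K2\<bar> * (h * norm y + h * norm z)" by (simp add: algebra_simps)
  also have "\<dots> \<le> \<bar>K2\<bar> * ((1 + norm y) * (norm z + h))"
  proof (intro mult_left_mono)
    have "h * norm z \<le> norm z" using h by (intro mult_left_le_one_le) auto
    moreover have "0 \<le> norm y * norm z" by simp
    moreover have "(1 + norm y) * (norm z + h) = norm z + h + norm y * norm z + h * norm y" by (simp add: algebra_simps)
    ultimately show "h * norm y + h * norm z \<le> (1 + norm y) * (norm z + h)"
      using h by linarith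
  qed simp
  finally have "norm (h *\<^sub>R \<eta> h y z) \<le> \<bar>K2\<bar> * ((1 + norm y) * (norm z + h))" .
  then have "norm (\<sigma> y *v z) + norm (h *\<^sub>R b y) + norm (h *\<^sub>R \<eta> h y z) \<le> (K1 + \<bar>K2\<bar>) * (1 + norm y) * (norm z + h)"
    using s b by (simp add: algebra_simps)
  then show ?thesis
    by (meson add_right_mono norm_triangle_ineq order_trans)
qed

section \<open>Lyapunov function and tail bounds for the scheme\<close>

definition lyap :: "nat \<Rightarrow> real^'m \<Rightarrow> real" where
  "lyap r y = (1 + (norm y)\<^sup>2) ^ r"

lemma lyap_nonneg: "0 \<le> lyap r y"
  by (simp add: lyap_def)

text \<open>The coefficient of the noise in the first-order expansion: the transpose of
  \<open>\<sigma> y\<close> applied to the gradient of \<open>lyap r\<close> at \<open>y\<close>.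
  Writing it as a multiple of \<open>lyap r y\<close> avoids the exponent
  \<open>r - 1\<close>.\<close>

definition lyap_grad :: "nat \<Rightarrow> real^'m \<Rightarrow> real^'d" where
  "lyap_grad r y = (lyap r y * (2 * real r / (1 + (norm y)\<^sup>2))) *\<^sub>R (y v* \<sigma> y)"

lemma one_plus_norm_squared_le: "(1 + norm y)\<^sup>2 \<le> 2 * (1 + (norm y)\<^sup>2)"
  using sum_squares_bound[of 1 "norm y"] by (simp add: power2_eq_square algebra_simps)

lemma norm_lyap_grad_le: "norm (lyap_grad r y) \<le> 4 * real r * K1 * lyap r y"
proof -
  let ?S = "1 + (norm y)\<^sup>2"
  have S: "0 < ?S" by (simp add: add_pos_nonneg)
  have "norm (y v* \<sigma> y) \<le> norm y * (K1 * (1 + norm y))"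
    by (rule order_trans[OF norm_vector_matrix_mult_le]) (use lin_growth in \<open>auto intro: mult_left_mono\<close>)
  also have "\<dots> \<le> K1 * (1 + norm y)\<^sup>2"
    using K1_nonneg by (simp add: power2_eq_square algebra_simps mult_left_mono)
  also have "\<dots> \<le> K1 * (2 * ?S)"
    using one_plus_norm_squared_le K1_nonneg by (intro mult_left_mono)
  finally have n: "norm (y v* \<sigma> y) \<le> K1 * (2 * ?S)" .
  have "norm (lyap_grad r y) = lyap r y * (2 * real r / ?S) * norm (y v* \<sigma> y)"
    using lyap_nonneg S by (simp add: lyap_grad_def)
  also have "\<dots> \<le> lyap r y * (2 * real r / ?S) * (K1 * (2 * ?S))"
    using n S lyap_nonneg by (intro mult_left_mono) auto
  also have "\<dots> = 4 * real r * K1 * lyap r y"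
    using S by (simp add: field_simps)
  finally show ?thesis .
qed

text \<open>The expansion is made relative: with \<open>S = 1 + |y|^2\<close>, the new value of
  \<open>1 + |y|^2\<close> is \<open>S * (1 + u)\<close>, so the new value of \<open>lyap\<close> is
  \<open>lyap r y * (1 + u) ^ r\<close>. Only the part \<open>m\<close> of \<open>u\<close> linear
  in the noise is kept exactly; all else is bounded by \<open>h + |z|^2 + |z| ^ (2 * r)\<close>,
  whose mean is of order \<open>h\<close>.\<close>

lemma lyap_step:
  assumes r: "2 \<le> r"
  obtains C where "0 \<le> C" "\<And>h y z. 0 < h \<Longrightarrow> h \<le> 1 \<Longrightarrow>
    lyap r (y + \<sigma> y *v z + h *\<^sub>R b y + h *\<^sub>R \<eta> h y z)
      \<le> lyap r y + inner (lyap_grad r y) z + lyap r y * (C * (h + (norm z)\<^sup>2 + norm z ^ (2 * r)))"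
proof -
  define K where "K = K1 + \<bar>K2\<bar>"
  \<comment> \<open>\<open>a\<close> collects the bound \<open>4 * K * v\<close> for the inner
    product and \<open>2 * K^2 * v^2\<close> for the square, both relative to \<open>S\<close>. Then
    \<open>c\<close> bounds \<open>u^2 + |u| ^ r\<close> by \<open>v^2 + v ^ (2 * r)\<close>, and
    \<open>C\<close> adds the first-order remainder to the binomial one.\<close>
  define a where "a = 4 * K + 2 * K\<^sup>2"
  have K: "0 \<le> K" and a: "0 \<le> a" using K1_nonneg by (auto simp: K_def a_def)
  define c where "c = 4 * a\<^sup>2 + (2 * a) ^ r * 2"
  have c: "0 \<le> c" using a by (simp add: c_def)
  define C where "C = real r * a * 4 + 2 ^ r * c * (2 + 2 ^ (2 * r))"
  have C: "0 \<le> C" using a c by (simp add: C_def)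
  show thesis
  proof (rule that[OF C])
    fix h :: real and y :: "real^'m" and z :: "real^'d"
    assume h: "0 < h" "h \<le> 1"
    let ?q = "h *\<^sub>R b y + h *\<^sub>R \<eta> h y z"
    define S where "S = 1 + (norm y)\<^sup>2"
    define v where "v = norm z + h"
    define \<Delta> where "\<Delta> = \<sigma> y *v z + h *\<^sub>R b y + h *\<^sub>R \<eta> h y z"
    define u where "u = (2 * inner y \<Delta> + (norm \<Delta>)\<^sup>2) / S"
    define m where "m = 2 * inner y (\<sigma> y *v z) / S"
    define H where "H = h + (norm z)\<^sup>2 + norm z ^ (2 * r)"
    have S: "0 < S" by (simp add: S_def add_pos_nonneg)
    have v: "0 \<le> v" using h by (simp add: v_def)
    have yS: "(1 + norm y)\<^sup>2 \<le> 2 * S" unfolding S_def by (rule one_plus_norm_squared_le)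
    have \<Delta>: "norm \<Delta> \<le> K * (1 + norm y) * v"
      unfolding \<Delta>_def K_def v_def by (rule scheme_increment_bound[OF h])
    have "(norm \<Delta>)\<^sup>2 \<le> (K * (1 + norm y) * v)\<^sup>2" by (intro power_mono \<Delta>) simp
    also have "\<dots> = (K\<^sup>2 * v\<^sup>2) * (1 + norm y)\<^sup>2" by (simp add: power_mult_distrib)
    also have "\<dots> \<le> (K\<^sup>2 * v\<^sup>2) * (2 * S)" using yS by (intro mult_left_mono) auto
    finally have \<Delta>2: "(norm \<Delta>)\<^sup>2 \<le> 2 * K\<^sup>2 * v\<^sup>2 * S" by simp
    have y1: "norm y * (K * (1 + norm y) * x) \<le> 2 * K * x * S" if "0 \<le> x" for x
    proof -
      have "norm y * (K * (1 + norm y) * x) \<le> (1 + norm y) * (K * (1 + norm y) * x)"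
        using K that by (intro mult_right_mono) auto
      also have "\<dots> = (K * x) * (1 + norm y)\<^sup>2" by (simp add: power2_eq_square)
      also have "\<dots> \<le> (K * x) * (2 * S)" using yS K that by (intro mult_left_mono) auto
      finally show ?thesis by simp
    qed
    have "\<bar>inner y \<Delta>\<bar> \<le> norm y * norm \<Delta>" by (rule Cauchy_Schwarz_ineq2)
    also have "\<dots> \<le> norm y * (K * (1 + norm y) * v)" using \<Delta> by (intro mult_left_mono) auto
    also have "\<dots> \<le> 2 * K * v * S" by (rule y1[OF v])
    finally have yD: "\<bar>inner y \<Delta>\<bar> \<le> 2 * K * v * S" .
    have "\<bar>2 * inner y \<Delta> + (norm \<Delta>)\<^sup>2\<bar> \<le> (4 * K * v + 2 * K\<^sup>2 * v\<^sup>2) * S"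
    proof -
      have "\<bar>2 * inner y \<Delta> + (norm \<Delta>)\<^sup>2\<bar> \<le> 2 * \<bar>inner y \<Delta>\<bar> + (norm \<Delta>)\<^sup>2"
        by (rule order_trans[OF abs_triangle_ineq]) simp
      then show ?thesis using yD \<Delta>2 by (simp add: algebra_simps)
    qed
    then have "\<bar>u\<bar> \<le> 4 * K * v + 2 * K\<^sup>2 * v\<^sup>2"
      using S by (simp add: u_def abs_divide divide_le_eq)
    also have "\<dots> \<le> a * (v + v\<^sup>2)"
      using K v by (simp add: a_def algebra_simps)
    finally have u: "\<bar>u\<bar> \<le> a * (v + v\<^sup>2)" .
    \<comment> \<open>Treating the drift apart from the noise yields a factor \<open>h\<close>. A
      bound through \<open>|\<Delta>|\<close> alone would leave a first-order term of the size of
      \<open>|z|\<close>, too large to be summed over all steps.\<close>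
    have "norm ?q \<le> h * (K1 * (1 + norm y)) + h * (\<bar>K2\<bar> * (norm y + norm z))"
      by (rule order_trans[OF norm_triangle_ineq]) (use lin_growth eta_bound'[OF h] h in \<open>auto intro!: add_mono\<close>)
    also have "\<dots> \<le> h * (K * (1 + norm y) * (1 + norm z))"
    proof -
      have "K1 * (1 + norm y) \<le> K1 * ((1 + norm y) * (1 + norm z))"
        using K1_nonneg by (intro mult_left_mono) (auto simp: algebra_simps)
      moreover have "\<bar>K2\<bar> * (norm y + norm z) \<le> \<bar>K2\<bar> * ((1 + norm y) * (1 + norm z))"
        by (intro mult_left_mono) (auto simp: algebra_simps)
      moreover have "K * (1 + norm y) * (1 + norm z) = K1 * ((1 + norm y) * (1 + norm z)) + \<bar>K2\<bar> * ((1 + norm y) * (1 + norm z))"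
        by (simp add: K_def algebra_simps)
      ultimately have "K1 * (1 + norm y) + \<bar>K2\<bar> * (norm y + norm z) \<le> K * (1 + norm y) * (1 + norm z)"
        by linarith
      then show ?thesis using h by (simp add: distrib_left[symmetric])
    qed
    finally have rem: "norm ?q \<le> K * (1 + norm y) * (h * (1 + norm z))" by (simp add: ac_simps)
    have "inner y ?q \<le> norm y * (K * (1 + norm y) * (h * (1 + norm z)))"
      by (rule order_trans[OF norm_cauchy_schwarz]) (intro mult_left_mono rem norm_ge_zero)
    also have "\<dots> \<le> 2 * K * (h * (1 + norm z)) * S" using h by (intro y1) auto
    finally have "2 * inner y ?q + (norm \<Delta>)\<^sup>2 \<le> (4 * K * (h * (1 + norm z)) + 2 * K\<^sup>2 * v\<^sup>2) * S"
      using \<Delta>2 by (simp add: algebra_simps)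
    then have "(2 * inner y ?q + (norm \<Delta>)\<^sup>2) / S \<le> 4 * K * (h * (1 + norm z)) + 2 * K\<^sup>2 * v\<^sup>2"
      using S by (simp add: divide_le_eq)
    moreover have "u = m + (2 * inner y ?q + (norm \<Delta>)\<^sup>2) / S"
      by (simp add: u_def m_def \<Delta>_def inner_add_right add_divide_distrib[symmetric])
    moreover have "4 * K * (h * (1 + norm z)) + 2 * K\<^sup>2 * v\<^sup>2 \<le> a * (h + h * norm z + v\<^sup>2)"
      using K v h by (simp add: a_def algebra_simps)
    ultimately have um: "u \<le> m + a * (h + h * norm z + v\<^sup>2)" by linarith
    have hz: "h * norm z \<le> h + (norm z)\<^sup>2"
    proof -
      have "0 \<le> h * norm z" using h by simp
      then have "h * norm z \<le> h\<^sup>2 + (norm z)\<^sup>2" using sum_squares_bound[of h "norm z"] by linarith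
      moreover have "h\<^sup>2 \<le> h" using h by (simp add: power2_eq_square mult_left_le_one_le)
      ultimately show ?thesis by linarith
    qed
    have v2: "v\<^sup>2 \<le> 2 * h + 2 * (norm z)\<^sup>2"
    proof -
      have "v\<^sup>2 \<le> 2 * h\<^sup>2 + 2 * (norm z)\<^sup>2"
        using sum_squares_bound[of h "norm z"] by (simp add: v_def power2_eq_square algebra_simps)
      moreover have "h\<^sup>2 \<le> h" using h by (simp add: power2_eq_square mult_left_le_one_le)
      ultimately show ?thesis by linarith
    qed
    have Hz: "h + (norm z)\<^sup>2 \<le> H" "0 \<le> (norm z)\<^sup>2" by (simp_all add: H_def)
    have "h + h * norm z + v\<^sup>2 \<le> 4 * H" using hz v2 Hz by linarith
    then have "a * (h + h * norm z + v\<^sup>2) \<le> a * (4 * H)"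
      by (intro mult_left_mono a)
    with um have um': "u \<le> m + a * 4 * H" by simp
    have v2r: "v ^ (2 * r) \<le> 2 ^ (2 * r) * (norm z ^ (2 * r) + h)"
    proof -
      have "v ^ (2 * r) \<le> 2 ^ (2 * r) * (norm z ^ (2 * r) + h ^ (2 * r))"
        unfolding v_def using h by (intro power_add_le_two_power) auto
      also have "h ^ (2 * r) \<le> h ^ 1" using h r by (intro power_decreasing) auto
      finally show ?thesis by simp
    qed
    have vsum: "v\<^sup>2 + v ^ (2 * r) \<le> (2 + 2 ^ (2 * r)) * H"
    proof -
      have "v\<^sup>2 \<le> 2 * H" using v2 Hz by linarith
      moreover have "v ^ (2 * r) \<le> 2 ^ (2 * r) * H"
        by (rule order_trans[OF v2r]) (auto simp: H_def intro!: mult_left_mono)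
      ultimately show ?thesis by (simp add: distrib_right)
    qed
    have "u\<^sup>2 + \<bar>u\<bar> ^ r \<le> c * (v\<^sup>2 + v ^ (2 * r))"
    proof -
      have "u\<^sup>2 \<le> (a * (v + v\<^sup>2))\<^sup>2" using u by (metis abs_ge_zero power2_abs power_mono)
      also have "\<dots> = a\<^sup>2 * (v + v\<^sup>2)\<^sup>2" by (rule power_mult_distrib)
      also have "\<dots> \<le> a\<^sup>2 * (4 * (v\<^sup>2 + v ^ (2 * r)))"
      proof (intro mult_left_mono)
        have "(v + v\<^sup>2)\<^sup>2 \<le> 2 * v\<^sup>2 + 2 * v ^ 4"
          using sum_squares_bound[of v "v\<^sup>2"] by (simp add: power2_eq_square power4_eq_xxxx algebra_simps)
        also have "v ^ 4 \<le> v\<^sup>2 + v ^ (2 * r)" using v r by (intro power_between_le) auto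
        finally have "(v + v\<^sup>2)\<^sup>2 \<le> 2 * v\<^sup>2 + 2 * (v\<^sup>2 + v ^ (2 * r))" by simp
        moreover have "0 \<le> v ^ (2 * r)" using v by simp
        ultimately show "(v + v\<^sup>2)\<^sup>2 \<le> 4 * (v\<^sup>2 + v ^ (2 * r))" by (simp only: distrib_left)
      qed simp
      finally have 1: "u\<^sup>2 \<le> 4 * a\<^sup>2 * (v\<^sup>2 + v ^ (2 * r))" by (simp only: ac_simps)
      have "\<bar>u\<bar> ^ r \<le> (a * (v + v\<^sup>2)) ^ r" using u by (intro power_mono) auto
      also have "\<dots> = a ^ r * (v + v\<^sup>2) ^ r" by (rule power_mult_distrib)
      also have "\<dots> \<le> a ^ r * (2 ^ r * (2 * (v\<^sup>2 + v ^ (2 * r))))"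
      proof (intro mult_left_mono)
        have "(v + v\<^sup>2) ^ r \<le> 2 ^ r * (v ^ r + (v\<^sup>2) ^ r)" using v by (intro power_add_le_two_power) auto
        also have "v ^ r + (v\<^sup>2) ^ r \<le> 2 * (v\<^sup>2 + v ^ (2 * r))"
        proof -
          have "v ^ r \<le> v\<^sup>2 + v ^ (2 * r)" using v r by (intro power_between_le) auto
          moreover have "p \<le> q + s \<Longrightarrow> 0 \<le> q \<Longrightarrow> p + s \<le> 2 * (q + s)" for p q s :: real by simp
          ultimately show ?thesis
            unfolding power_mult[of v 2 r, symmetric] using zero_le_power2[of v] by blast
        qed
        finally show "(v + v\<^sup>2) ^ r \<le> 2 ^ r * (2 * (v\<^sup>2 + v ^ (2 * r)))" by simp
      qed (use a in simp)
      also have "\<dots> = (2 * a) ^ r * 2 * (v\<^sup>2 + v ^ (2 * r))" by (simp only: power_mult_distrib ac_simps)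
      finally show ?thesis using 1 unfolding c_def distrib_right[of _ _ "v\<^sup>2 + v ^ (2 * r)"] by linarith
    qed
    also have "\<dots> \<le> c * ((2 + 2 ^ (2 * r)) * H)" using vsum c by (intro mult_left_mono)
    finally have uu: "u\<^sup>2 + \<bar>u\<bar> ^ r \<le> c * (2 + 2 ^ (2 * r)) * H" by (simp only: mult.assoc)
    have "(1 + u) ^ r \<le> 1 + real r * u + 2 ^ r * (u\<^sup>2 + \<bar>u\<bar> ^ r)" using r by (rule one_plus_power_le)
    also have "\<dots> \<le> 1 + real r * (m + a * 4 * H) + 2 ^ r * (c * (2 + 2 ^ (2 * r)) * H)"
      using um' uu by (intro add_mono mult_left_mono) auto
    also have "\<dots> = 1 + real r * m + C * H" by (simp add: C_def algebra_simps)
    finally have "S ^ r * (1 + u) ^ r \<le> S ^ r * (1 + real r * m + C * H)"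
      using S by (intro mult_left_mono) auto
    moreover have "S ^ r * (1 + u) ^ r = lyap r (y + \<Delta>)"
    proof -
      have "S * (1 + u) = S + 2 * inner y \<Delta> + (norm \<Delta>)\<^sup>2" using S by (simp add: u_def field_simps)
      also have "\<dots> = 1 + (norm (y + \<Delta>))\<^sup>2"
        by (simp add: S_def power2_norm_eq_inner inner_add_left inner_add_right inner_commute)
      finally show ?thesis by (simp add: lyap_def power_mult_distrib[symmetric])
    qed
    moreover have "S ^ r * (1 + real r * m + C * H) = lyap r y + inner (lyap_grad r y) z + lyap r y * (C * H)"
    proof -
      have "inner (lyap_grad r y) z = lyap r y * (real r * m)"
        by (simp add: lyap_grad_def m_def dot_lmul_matrix S_def)
      then show ?thesis by (simp add: lyap_def S_def algebra_simps)
    qed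
    ultimately show "lyap r (y + \<sigma> y *v z + h *\<^sub>R b y + h *\<^sub>R \<eta> h y z)
      \<le> lyap r y + inner (lyap_grad r y) z + lyap r y * (C * (h + (norm z)\<^sup>2 + norm z ^ (2 * r)))"
      by (simp add: \<Delta>_def H_def add.assoc)
  qed
qed

text \<open>The maximal inequality with the whole space as \<open>G j\<close>: linear growth makes
  the constants of \<open>lyap_step\<close> global, so no path has to be stopped for leaving a
  ball.\<close>

lemma scheme_maximal_bound:
  assumes r: "2 \<le> r" and T: "0 \<le> T"
  obtains C where "0 \<le> C" "\<And>h n lev. 0 < h \<Longrightarrow> h \<le> 1 \<Longrightarrow> real n * h \<le> T \<Longrightarrow> 0 < lev \<Longrightarrow>
    measure M {\<omega>\<in>space M. \<exists>k\<le>n. lev \<le> lyap r (Y h k \<omega>)} \<le> C / lev"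
proof -
  obtain C where C: "0 \<le> C" and step: "\<And>h y z. 0 < h \<Longrightarrow> h \<le> 1 \<Longrightarrow>
    lyap r (y + \<sigma> y *v z + h *\<^sub>R b y + h *\<^sub>R \<eta> h y z)
      \<le> lyap r y + inner (lyap_grad r y) z + lyap r y * (C * (h + (norm z)\<^sup>2 + norm z ^ (2 * r)))"
    using lyap_step[OF r] by metis
  define C' where "C' = C * (1 + gauss_const CARD('d) 1 + gauss_const CARD('d) r)"
  have C': "0 \<le> C'" using C gauss_const_nonneg by (simp add: C'_def)
  show thesis
  proof (rule that[of "exp (C' * T) * lyap r x0"])
    show "0 \<le> exp (C' * T) * lyap r x0" using lyap_nonneg by simp
    fix h :: real and n :: nat and lev :: real
    assume h: "0 < h" "h \<le> 1" and n: "real n * h \<le> T" and lev: "0 < lev"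
    interpret noise_filtration M "filt h" "dW h" using noise h by blast
    define w where "w z = C * (h + (norm z)\<^sup>2 + norm z ^ (2 * r))" for z :: "real^'d"
    note m2 = dW_moment[OF h(1), of _ 1, simplified] and m2r = dW_moment[OF h(1), of _ r]
    \<comment> \<open>The moment of order \<open>2 * r\<close> is of order \<open>h ^ r\<close>;
      with \<open>h \<le> 1\<close> and \<open>r \<ge> 1\<close> it is also of order
      \<open>h\<close>, as the mean of \<open>w\<close> has to be.\<close>
    have hr: "h ^ r \<le> h" using power_decreasing[of 1 r h] r h by simp
    have "measure M {\<omega>\<in>space M. (\<forall>j<n. \<omega> \<in> space M) \<and> (\<exists>k\<le>n. lev \<le> lyap r (Y h k \<omega>))} \<le> (1 + C' * h) ^ n * lyap r x0 / lev"
    proof (rule maximal_inequality[where g="\<lambda>j \<omega>. lyap_grad r (Y h j \<omega>)" and w=w and c="4 * real r * K1"])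
      fix j
      have [measurable]: "Y h j \<in> borel_measurable (filt h j)" using h Y_measurable by blast
      show "(\<lambda>\<omega>. lyap r (Y h j \<omega>)) \<in> borel_measurable (filt h j)" unfolding lyap_def by measurable
      show "(\<lambda>\<omega>. lyap_grad r (Y h j \<omega>)) \<in> borel_measurable (filt h j)" unfolding lyap_grad_def lyap_def by measurable
      show "space M \<in> sets (filt h j)" using sets.top[of "filt h j"] by simp
      show "w \<in> borel_measurable borel" unfolding w_def by measurable
      show "0 \<le> w z" for z using C h by (simp add: w_def)
      show "integrable M (\<lambda>\<omega>. w (dW h j \<omega>))" unfolding w_def using m2(1) m2r(1) by auto
      have "(\<integral>\<omega>. w (dW h j \<omega>) \<partial>M) = C * (h + (\<integral>\<omega>. (norm (dW h j \<omega>))\<^sup>2 \<partial>M) + (\<integral>\<omega>. norm (dW h j \<omega>) ^ (2 * r) \<partial>M))"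
        unfolding w_def using m2(1) m2r(1) by (simp add: prob_space)
      also have "\<dots> \<le> C * (h + gauss_const CARD('d) 1 * h + gauss_const CARD('d) r * h)"
        using m2(2) order_trans[OF m2r(2) mult_left_mono[OF hr gauss_const_nonneg]]
        by (intro mult_left_mono[OF _ C] add_mono order_refl) auto
      also have "\<dots> = C' * h" by (simp add: C'_def algebra_simps)
      finally show "(\<integral>\<omega>. w (dW h j \<omega>) \<partial>M) \<le> C' * h" .
    next
      fix j \<omega>
      show "lyap r (Y h (Suc j) \<omega>) \<le> lyap r (Y h j \<omega>) + inner (lyap_grad r (Y h j \<omega>)) (dW h j \<omega>) + lyap r (Y h j \<omega>) * w (dW h j \<omega>)"
        unfolding Y_Suc w_def by (rule step[OF h])
    qed (use lev C' h K1_nonneg in \<open>auto simp: lyap_nonneg Y_0 norm_lyap_grad_le\<close>)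
    also have "\<dots> \<le> exp (C' * T) * lyap r x0 / lev"
      using lev one_plus_power_le_exp[OF C' _ n] h lyap_nonneg
      by (intro divide_right_mono mult_right_mono) auto
    finally show "measure M {\<omega>\<in>space M. \<exists>k\<le>n. lev \<le> lyap r (Y h k \<omega>)} \<le> exp (C' * T) * lyap r x0 / lev"
      by (simp cong: conj_cong)
  qed
qed

end

section \<open>One-step consistency of the solution\<close>

lemma (in prob_space) exhausting_event:
  assumes "\<And>n::nat. E n \<in> events" "incseq E" "(\<Union>n. E n) = space M" "0 < \<epsilon>"
  obtains n where "prob (space M - E n) < \<epsilon>"
proof -
  have "(\<lambda>n. prob (E n)) \<longlonglongrightarrow> prob (\<Union>n. E n)"
    using assms(1,2) by (intro finite_Lim_measure_incseq) auto
  then have "(\<lambda>n. prob (E n)) \<longlonglongrightarrow> 1" using assms(3) by (simp add: prob_space)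
  then have "\<forall>\<^sub>F n in sequentially. 1 - \<epsilon> < prob (E n)"
    using assms(4) by (intro order_tendstoD) auto
  then obtain n where "1 - \<epsilon> < prob (E n)" by (auto simp: eventually_sequentially)
  then have "prob (space M - E n) < \<epsilon>" using prob_compl[OF assms(1)[of n]] by simp
  then show thesis by (rule that)
qed

lemma conv_in_probE:
  assumes "conv_in_prob M S L" "0 < \<rho>"
  obtains A where "\<And>n. A n \<in> sets M" "\<And>n. {\<omega>\<in>space M. \<rho> < norm (S n \<omega> - L \<omega>)} \<subseteq> A n"
    "(\<lambda>n. measure M (A n)) \<longlonglongrightarrow> 0"
proof -
  from assms have "\<exists>A. (\<forall>n. A n \<in> sets M \<and> {\<omega>\<in>space M. \<rho> < norm (S n \<omega> - L \<omega>)} \<subseteq> A n) \<and> (\<lambda>n. measure M (A n)) \<longlonglongrightarrow> 0"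
    unfolding conv_in_prob_def by simp
  then obtain A where A: "\<forall>n. A n \<in> sets M \<and> {\<omega>\<in>space M. \<rho> < norm (S n \<omega> - L \<omega>)} \<subseteq> A n" "(\<lambda>n. measure M (A n)) \<longlonglongrightarrow> 0"
    by (elim exE conjE)
  show thesis
    by (rule that[of A]) (simp_all add: A)
qed

lemma norm_add_squared:
  fixes x y :: "'a::real_inner"
  shows "(norm (x + y))\<^sup>2 = (norm x)\<^sup>2 + 2 * inner x y + (norm y)\<^sup>2"
  by (simp add: power2_norm_eq_inner inner_add_left inner_add_right inner_commute)

lemma closure_rationals_greaterThanLessThan:
  fixes a :: real assumes "a < b"
  shows "closure ({a<..<b} \<inter> \<rat>) = {a..b}"
proof (rule antisym)
  show "closure ({a<..<b} \<inter> \<rat>) \<subseteq> {a..b}"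
    by (rule closure_minimal) auto
  have "{a<..<b} \<inter> closure \<rat> \<subseteq> closure ({a<..<b} \<inter> \<rat>)"
    by (rule open_Int_closure_subset) simp
  then have "closure {a<..<b} \<subseteq> closure (closure ({a<..<b} \<inter> \<rat>))"
    by (intro closure_mono) (simp add: Rats_closure_real)
  then show "{a..b} \<subseteq> closure ({a<..<b} \<inter> \<rat>)" using assms by simp
qed

locale repeated_interaction_sde = repeated_interaction +
  fixes \<tau> :: real and X :: "real \<Rightarrow> (real \<Rightarrow> real^'a) \<Rightarrow> real^'b"
  assumes tau: "0 < \<tau>" and sol: "sde_solution M b \<sigma> x0 \<tau> X"
begin

section \<open>Measurable events that control the paths of the solution\<close>

lemma X_measurable: "0 \<le> t \<Longrightarrow> t \<le> \<tau> \<Longrightarrow> X t \<in> borel_measurable M"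
  using sol by (auto simp: sde_solution_def)

lemma X_continuous: "\<omega> \<in> space M \<Longrightarrow> continuous_on {0..\<tau>} (\<lambda>t. X t \<omega>)"
  using sol by (auto simp: sde_solution_def)

lemma X_filt:
  assumes "0 < h" "real j * h \<le> \<tau>"
  shows "X (real j * h) \<in> borel_measurable (filt h j)"
proof -
  have "real j * h \<in> {0..\<tau>}" using assms by simp
  then obtain Z where "Z \<in> borel_measurable (nat_filt M (real j * h))" "AE \<omega> in M. X (real j * h) \<omega> = Z \<omega>"
    using sol unfolding sde_solution_def adapted_aug_def by blast
  then show ?thesis
    unfolding filt_def using assms by (intro measurable_augment[OF subalgebra_nat_filt[OF W]] X_measurable) auto
qed

text \<open>Countable, so that conditions on all its points are measurable, and dense in
  \<open>{0..\<tau>}\<close>, so that closed conditions extend to the whole interval by continuity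
  of the paths.\<close>

definition times :: "real set" where
  "times = {0<..<\<tau>} \<inter> \<rat>"

lemma countable_times: "countable times"
  unfolding times_def using countable_rat by blast

lemma closure_times: "closure times = {0..\<tau>}"
  unfolding times_def using tau by (rule closure_rationals_greaterThanLessThan)

lemma times_subset: "times \<subseteq> {0..\<tau>}"
  by (auto simp: times_def)

lemma times_X: "t \<in> times \<Longrightarrow> X t \<in> borel_measurable M"
  using X_measurable[of t] by (simp add: times_def)

text \<open>Each path is bounded by compactness, so the events with bound \<open>n\<close> exhaust
  the space and one of them has probability close to 1. This replaces a moment bound for the
  solution, which is not yet available.\<close>

lemma X_bounded_event:
  assumes "0 < \<epsilon>"
  obtains N G where "0 < N" "G \<in> sets M" "measure M (space M - G) < \<epsilon>" "G \<subseteq> space M"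
    "\<And>\<omega> t. \<omega> \<in> G \<Longrightarrow> t \<in> {0..\<tau>} \<Longrightarrow> norm (X t \<omega>) \<le> N"
proof -
  define E where "E n = {\<omega>\<in>space M. \<forall>t\<in>times. norm (X t \<omega>) \<le> real n}" for n
  have E_sets: "E n \<in> sets M" for n
    unfolding E_def
  proof (rule sets.sets_Collect_countable_All'[OF _ countable_times])
    fix t assume "t \<in> times"
    then have [measurable]: "X t \<in> borel_measurable M" using times_X by blast
    show "{\<omega> \<in> space M. norm (X t \<omega>) \<le> real n} \<in> sets M" by measurable
  qed
  have E_all: "norm (X t \<omega>) \<le> real n" if "\<omega> \<in> E n" "t \<in> {0..\<tau>}" for \<omega> t n
    using continuous_on_closure_norm_le[of times "\<lambda>t. X t \<omega>" "real n" t] X_continuous that closure_times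
    by (auto simp: E_def)
  have "incseq E" by (fastforce simp: incseq_def E_def)
  moreover have "(\<Union>n. E n) = space M"
  proof (intro antisym subsetI)
    fix \<omega> assume \<omega>: "\<omega> \<in> space M"
    have "bounded ((\<lambda>t. X t \<omega>) ` {0..\<tau>})"
      using X_continuous[OF \<omega>] by (intro compact_imp_bounded compact_continuous_image) auto
    then obtain B where B: "\<forall>t\<in>{0..\<tau>}. norm (X t \<omega>) \<le> B" by (auto simp: bounded_iff)
    obtain n where "B \<le> real n" using real_arch_simple by blast
    then have "\<omega> \<in> E n" using B \<omega> times_subset by (force simp: E_def)
    then show "\<omega> \<in> (\<Union>n. E n)" by auto
  qed (auto simp: E_def)
  ultimately obtain n where n: "prob (space M - E n) < \<epsilon>"
    using exhausting_event[of E \<epsilon>] E_sets assms by blast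
  show thesis
  proof (rule that[of "real n + 1" "E n"])
    fix \<omega> t assume "\<omega> \<in> E n" "t \<in> {0..\<tau>}"
    from E_all[OF this] show "norm (X t \<omega>) \<le> real n + 1" by simp
  qed (use n E_sets in \<open>auto simp: E_def\<close>)
qed

text \<open>The same exhaustion, with uniform continuity of each path in place of
  boundedness.\<close>

lemma X_modulus_event:
  assumes "0 < \<epsilon>" "0 < \<delta>"
  obtains h0 G where "0 < h0" "G \<in> sets M" "measure M (space M - G) < \<epsilon>" "G \<subseteq> space M"
    "\<And>\<omega> s t. \<omega> \<in> G \<Longrightarrow> s \<in> {0..\<tau>} \<Longrightarrow> t \<in> {0..\<tau>} \<Longrightarrow> \<bar>s - t\<bar> \<le> h0 \<Longrightarrow> norm (X s \<omega> - X t \<omega>) \<le> \<delta>"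
proof -
  define e where "e n = 1 / real (Suc n)" for n
  define E where "E n = {\<omega>\<in>space M. \<forall>s\<in>times. \<forall>t\<in>times. \<bar>s - t\<bar> < e n \<longrightarrow> norm (X s \<omega> - X t \<omega>) \<le> \<delta>}" for n
  have E_sets: "E n \<in> sets M" for n
    unfolding E_def
  proof (intro sets.sets_Collect_countable_All'[OF _ countable_times])
    fix s t assume "s \<in> times" "t \<in> times"
    then have [measurable]: "X t \<in> borel_measurable M" "X s \<in> borel_measurable M" using times_X by blast+
    show "{\<omega> \<in> space M. \<bar>s - t\<bar> < e n \<longrightarrow> norm (X s \<omega> - X t \<omega>) \<le> \<delta>} \<in> sets M" by measurable
  qed
  have E_all: "norm (X s \<omega> - X t \<omega>) \<le> \<delta>" if "\<omega> \<in> E n" "s \<in> {0..\<tau>}" "t \<in> {0..\<tau>}" "\<bar>s - t\<bar> < e n" for \<omega> s t n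
  proof -
    \<comment> \<open>The strip is open, so pairs of rational times inside it are dense in it. The
      non-strict distance condition of the conclusion is met by passing to
      \<open>e n / 2\<close>.\<close>
    define D where "D = {p :: real \<times> real. \<bar>fst p - snd p\<bar> < e n}"
    have "open D" unfolding D_def by (intro open_Collect_less continuous_intros)
    then have "D \<inter> closure (times \<times> times) \<subseteq> closure (D \<inter> times \<times> times)" by (rule open_Int_closure_subset)
    then have st: "(s, t) \<in> closure (D \<inter> times \<times> times)"
      using that closure_times by (auto simp: closure_Times D_def)
    have sub: "closure (D \<inter> times \<times> times) \<subseteq> {0..\<tau>} \<times> {0..\<tau>}"
      using times_subset by (intro closure_minimal closed_Times) auto
    have c: "continuous_on {0..\<tau>} (\<lambda>t. X t \<omega>)" using that X_continuous by (auto simp: E_def)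
    have "continuous_on ({0..\<tau>} \<times> {0..\<tau>}) (\<lambda>p. X (fst p) \<omega> - X (snd p) \<omega>)"
      by (intro continuous_on_diff continuous_on_compose2[OF c]) (auto intro: continuous_intros)
    then have "continuous_on (closure (D \<inter> times \<times> times)) (\<lambda>p. X (fst p) \<omega> - X (snd p) \<omega>)"
      using sub continuous_on_subset by blast
    moreover have "\<forall>p\<in>D \<inter> times \<times> times. norm (X (fst p) \<omega> - X (snd p) \<omega>) \<le> \<delta>"
      using that(1) by (auto simp: D_def E_def)
    ultimately show ?thesis using continuous_on_closure_norm_le[OF _ _ st] by fastforce
  qed
  have "incseq E"
  proof (rule incseq_SucI, rule subsetI)
    fix n \<omega> assume "\<omega> \<in> E n"
    moreover have "e (Suc n) \<le> e n" by (simp add: e_def field_simps)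
    ultimately show "\<omega> \<in> E (Suc n)" unfolding E_def by (smt (verit, best) mem_Collect_eq)
  qed
  moreover have "(\<Union>n. E n) = space M"
  proof (intro antisym subsetI)
    fix \<omega> assume \<omega>: "\<omega> \<in> space M"
    have "uniformly_continuous_on {0..\<tau>} (\<lambda>t. X t \<omega>)"
      using X_continuous[OF \<omega>] by (intro compact_uniformly_continuous) auto
    then obtain d where d: "0 < d" "\<And>s t. s \<in> {0..\<tau>} \<Longrightarrow> t \<in> {0..\<tau>} \<Longrightarrow> dist t s < d \<Longrightarrow> dist (X t \<omega>) (X s \<omega>) < \<delta>"
      using assms(2) unfolding uniformly_continuous_on_def by blast
    obtain n where "e n < d" using nat_approx_posE[OF d(1)] unfolding e_def by metis
    have "\<omega> \<in> E n"
      unfolding E_def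
    proof (intro CollectI conjI ballI impI \<omega>)
      fix s t assume "s \<in> times" "t \<in> times" "\<bar>s - t\<bar> < e n"
      then have "dist (X s \<omega>) (X t \<omega>) < \<delta>"
        using d(2)[of t s] subsetD[OF times_subset, of s] subsetD[OF times_subset, of t] \<open>e n < d\<close>
        by (simp add: dist_real_def)
      then show "norm (X s \<omega> - X t \<omega>) \<le> \<delta>" by (simp add: dist_norm)
    qed
    then show "\<omega> \<in> (\<Union>n. E n)" by auto
  qed (auto simp: E_def)
  ultimately obtain n where n: "prob (space M - E n) < \<epsilon>"
    using exhausting_event[of E \<epsilon>] E_sets assms by blast
  have en: "0 < e n" by (simp add: e_def)
  show thesis
  proof (rule that[of "e n / 2" "E n"])
    fix \<omega> s t assume "\<omega> \<in> E n" "s \<in> {0..\<tau>}" "t \<in> {0..\<tau>}" "\<bar>s - t\<bar> \<le> e n / 2"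
    then show "norm (X s \<omega> - X t \<omega>) \<le> \<delta>" using E_all[of \<omega> n s t] en by force
  qed (use n E_sets en in \<open>auto simp: E_def\<close>)
qed

section \<open>Left-point sums, their refinement, and the residual\<close>

definition ito_sum :: "real \<Rightarrow> nat \<Rightarrow> (real \<Rightarrow> real^'a) \<Rightarrow> real^'b" where
  "ito_sum h k \<omega> = (\<Sum>j<k. \<sigma> (X (real j * h) \<omega>) *v dW h j \<omega>)"

definition residual :: "real \<Rightarrow> nat \<Rightarrow> (real \<Rightarrow> real^'a) \<Rightarrow> real^'b" where
  "residual h k \<omega> = X (real k * h) \<omega> - x0 - (\<Sum>j<k. h *\<^sub>R b (X (real j * h) \<omega>)) - ito_sum h k \<omega>"

lemma residual_filt:
  assumes "0 < h" "real k * h \<le> \<tau>"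
  shows "residual h k \<in> borel_measurable (filt h k)"
proof -
  interpret noise_filtration M "filt h" "dW h" using noise assms by blast
  have X: "X (real j * h) \<in> borel_measurable (filt h k)" if "j \<le> k" for j
  proof (rule measurable_filt_mono[OF X_filt that])
    show "real j * h \<le> \<tau>" using that assms by (meson less_imp_le mult_right_mono of_nat_mono order_trans)
  qed (use assms in auto)
  have dWk: "dW h j \<in> borel_measurable (filt h k)" if "j < k" for j
    using measurable_filt_mono[OF noise_meas[of j], of k] that by auto
  have "(\<lambda>\<omega>. X (real k * h) \<omega> - x0 - (\<Sum>j<k. h *\<^sub>R b (X (real j * h) \<omega>)) - (\<Sum>j<k. \<sigma> (X (real j * h) \<omega>) *v dW h j \<omega>))
      \<in> borel_measurable (filt h k)"
    using X dWk
    by (intro borel_measurable_diff borel_measurable_sum borel_measurable_scaleR borel_measurable_const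
        borel_measurable_matrix_vector_mult measurable_compose[OF _ measurable_b] measurable_compose[OF _ measurable_\<sigma>]) auto
  then show ?thesis by (simp add: residual_def ito_sum_def fun_eq_iff cong: measurable_cong)
qed

text \<open>The fine increments of one block telescope to a coarse increment, which turns a coarse
  sum into a sum over the fine noise.\<close>

lemma refined_noise_sum:
  assumes "0 < n"
  shows "(\<Sum>i<k * n. A (i div n) *v dW (h / real n) i \<omega>) = (\<Sum>j<k. A j *v dW h j \<omega>)"
proof -
  have n: "real n \<noteq> 0" using assms by simp
  have "(\<Sum>i<k * n. A (i div n) *v dW (h / real n) i \<omega>) = (\<Sum>j<k. \<Sum>i\<in>{j * n..<j * n + n}. A (i div n) *v dW (h / real n) i \<omega>)"
    by (rule sum.nat_group[symmetric])
  also have "\<dots> = (\<Sum>j<k. A j *v dW h j \<omega>)"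
  proof (rule sum.cong[OF refl])
    fix j
    have "i div n = j" if "i \<in> {j * n..<j * n + n}" for i
      using that by (intro div_nat_eqI) (auto simp: ac_simps)
    then have "(\<Sum>i\<in>{j * n..<j * n + n}. A (i div n) *v dW (h / real n) i \<omega>) = (\<Sum>i\<in>{j * n..<j * n + n}. A j *v dW (h / real n) i \<omega>)"
      by (intro sum.cong) auto
    also have "\<dots> = A j *v (\<Sum>i\<in>{j * n..<j * n + n}. dW (h / real n) i \<omega>)"
      by (rule linear_sum[OF matrix_vector_mul_linear, symmetric])
    also have "(\<Sum>i\<in>{j * n..<j * n + n}. dW (h / real n) i \<omega>) = \<omega> (real (j * n + n) * (h / real n)) - \<omega> (real (j * n) * (h / real n))"
      unfolding dW_def using sum_Suc_diff'[of "j * n" "j * n + n" "\<lambda>i. \<omega> (real i * (h / real n))"] by simp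
    also have "\<dots> = dW h j \<omega>"
    proof -
      have "real (j * n + n) * (h / real n) = real (Suc j) * h" "real (j * n) * (h / real n) = real j * h"
        using n by (simp_all add: field_simps)
      then show ?thesis by (simp add: dW_def)
    qed
    finally show "(\<Sum>i\<in>{j * n..<j * n + n}. A (i div n) *v dW (h / real n) i \<omega>) = A j *v dW h j \<omega>" .
  qed
  finally show ?thesis .
qed

text \<open>The coarse and the refined sum are both driven by the refined noise, the coarse integrand being
  frozen on blocks of length \<open>n\<close>.\<close>
lemma ito_sum_refinement:
  assumes h: "0 < h" "real K * h \<le> \<tau>" and n: "0 < n" and L: "0 < L" and \<delta>: "0 < \<delta>" and \<rho>: "0 < \<rho>"
    and lip: "\<And>x y. norm x \<le> N \<Longrightarrow> norm y \<le> N \<Longrightarrow> norm (\<sigma> x - \<sigma> y) \<le> L * norm (x - y)"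
    and G: "G \<subseteq> space M" "\<And>\<omega> t. \<omega> \<in> G \<Longrightarrow> t \<in> {0..\<tau>} \<Longrightarrow> norm (X t \<omega>) \<le> N"
      "\<And>\<omega> s t. \<omega> \<in> G \<Longrightarrow> s \<in> {0..\<tau>} \<Longrightarrow> t \<in> {0..\<tau>} \<Longrightarrow> \<bar>s - t\<bar> \<le> h \<Longrightarrow> norm (X s \<omega> - X t \<omega>) \<le> \<delta>"
  obtains B where "B \<in> sets M" "measure M B \<le> exp (L\<^sup>2 * gauss_const CARD('a) 1 * \<tau>) * \<delta>\<^sup>2 / \<rho>\<^sup>2"
    "\<And>\<omega> k. \<omega> \<in> G \<Longrightarrow> \<omega> \<notin> B \<Longrightarrow> k \<le> K \<Longrightarrow> norm (ito_sum h k \<omega> - ito_sum (h / real n) (k * n) \<omega>) < \<rho>"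
proof -
  define s where "s = h / real n"
  have s: "0 < s" using h n by (simp add: s_def)
  interpret noise_filtration M "filt s" "dW s" using noise s by blast
  define A where "A i \<omega> = \<sigma> (X (real (i div n) * h) \<omega>) - \<sigma> (X (real i * s) \<omega>)" for i \<omega>
  define D where "D j \<omega> = (\<Sum>i<j. A i \<omega> *v dW s i \<omega>)" for j \<omega>
  \<comment> \<open>Since \<open>|A| \<le> L * \<delta>\<close> on \<open>Gs\<close>, the offset
    bounds both \<open>2 * |D| * |A|\<close> and \<open>|A|^2\<close> by multiples of
    \<open>V\<close>, the form that the maximal inequality demands.\<close>
  define V where "V j \<omega> = (norm (D j \<omega>))\<^sup>2 + \<delta>\<^sup>2" for j \<omega>
  define J where "J = K * n"
  define c where "c = gauss_const CARD('a) 1"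
  define w where "w z = L\<^sup>2 * (norm z)\<^sup>2" for z :: "real^'a"
  \<comment> \<open>Membership in \<open>G\<close> depends on the whole path and cannot enter a
    stopping rule. \<open>Gs i\<close> is the consequence of it that is already decided at time
    \<open>i\<close>.\<close>
  define Gs where "Gs i = {\<omega>\<in>space M. norm (A i \<omega>) \<le> L * \<delta>}" for i
  have c: "0 \<le> c" by (simp add: c_def gauss_const_nonneg)
  have hs: "h = real n * s" using n by (simp add: s_def)
  have Js: "real J * s \<le> \<tau>" using h(2) hs by (simp add: J_def ac_simps)
  have grid: "real i * s \<le> \<tau>" if "i \<le> J" for i
    using that s by (intro order_trans[OF _ Js] mult_right_mono) auto
  have coarse: "real (i div n) * h = real (i div n * n) * s" for i
    by (simp add: hs)
  have le_i: "i div n * n \<le> i" for i by simp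
  have X1: "X (real i * s) \<in> borel_measurable (filt s j)" if "i \<le> j" "i \<le> J" for i j
    using that s grid by (intro measurable_filt_mono[OF X_filt]) auto
  have A_meas: "A i \<in> borel_measurable (filt s j)" if "i \<le> j" "i \<le> J" for i j
  proof -
    have "X (real (i div n) * h) \<in> borel_measurable (filt s j)"
      unfolding coarse using that by (intro X1 order_trans[OF le_i])
    with X1[OF that] show ?thesis
      unfolding A_def by (intro borel_measurable_diff measurable_compose[OF _ measurable_\<sigma>])
  qed
  have D_meas: "D j \<in> borel_measurable (filt s j)" if "j \<le> J" for j
    unfolding D_def
  proof (intro borel_measurable_sum borel_measurable_matrix_vector_mult)
    fix i assume i: "i \<in> {..<j}"
    then show "A i \<in> borel_measurable (filt s j)" using that by (intro A_meas) auto
    show "dW s i \<in> borel_measurable (filt s j)"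
      using i measurable_filt_mono[OF noise_meas[of i], of j] by auto
  qed
  define B where "B = {\<omega>\<in>space M. (\<forall>j<J. \<omega> \<in> Gs j) \<and> (\<exists>j\<le>J. \<rho>\<^sup>2 \<le> V j \<omega>)}"
  have Gs_sets: "Gs j \<in> sets (filt s j)" if "j < J" for j
  proof -
    have [measurable]: "A j \<in> borel_measurable (filt s j)" using that by (intro A_meas) auto
    have "{\<omega>\<in>space (filt s j). norm (A j \<omega>) \<le> L * \<delta>} \<in> sets (filt s j)" by measurable
    then show ?thesis by (simp add: Gs_def)
  qed
  have V_meas: "V j \<in> borel_measurable (filt s j)" if "j \<le> J" for j
  proof -
    note [measurable] = D_meas[OF that]
    show ?thesis unfolding V_def by measurable
  qed
  have B_sets: "B \<in> sets M"
    unfolding B_def using V_meas Gs_sets by (rule maximal_event)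
  have "measure M B \<le> (1 + L\<^sup>2 * c * s) ^ J * \<delta>\<^sup>2 / \<rho>\<^sup>2"
    unfolding B_def
  proof (rule maximal_inequality[where g="\<lambda>j \<omega>. 2 *\<^sub>R (D j \<omega> v* A j \<omega>)" and w=w and c=L])
    fix j assume j: "j < J"
    have [measurable]: "A j \<in> borel_measurable (filt s j)" "D j \<in> borel_measurable (filt s j)"
      using j by (auto intro!: A_meas D_meas)
    show "(\<lambda>\<omega>. 2 *\<^sub>R (D j \<omega> v* A j \<omega>)) \<in> borel_measurable (filt s j)" by measurable
    show "integrable M (\<lambda>\<omega>. w (dW s j \<omega>))"
      using dW_moment(1)[OF s, of j 1] by (simp add: w_def)
    show "(\<integral>\<omega>. w (dW s j \<omega>) \<partial>M) \<le> L\<^sup>2 * c * s"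
      using dW_moment(2)[OF s, of j 1] by (simp add: w_def c_def mult.assoc mult_left_mono)
    fix \<omega> assume \<omega>: "\<omega> \<in> Gs j"
    then have A: "norm (A j \<omega>) \<le> L * \<delta>" by (simp add: Gs_def)
    have "norm (2 *\<^sub>R (D j \<omega> v* A j \<omega>)) \<le> 2 * (norm (D j \<omega>) * (L * \<delta>))"
      using order_trans[OF norm_vector_matrix_mult_le mult_left_mono[OF A norm_ge_zero[of "D j \<omega>"]]] by simp
    also have "\<dots> = L * (2 * norm (D j \<omega>) * \<delta>)" by simp
    also have "\<dots> \<le> L * V j \<omega>"
      using L sum_squares_bound[of "norm (D j \<omega>)" \<delta>] by (simp add: V_def)
    finally show "norm (2 *\<^sub>R (D j \<omega> v* A j \<omega>)) \<le> L * V j \<omega>" .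
    have "norm (A j \<omega> *v dW s j \<omega>) \<le> (L * \<delta>) * norm (dW s j \<omega>)"
      using order_trans[OF norm_matrix_vector_mult_le mult_right_mono[OF A norm_ge_zero]] .
    then have "(norm (A j \<omega> *v dW s j \<omega>))\<^sup>2 \<le> ((L * \<delta>) * norm (dW s j \<omega>))\<^sup>2" by (intro power_mono) auto
    also have "\<dots> = \<delta>\<^sup>2 * w (dW s j \<omega>)" by (simp add: w_def power_mult_distrib)
    also have "\<dots> \<le> V j \<omega> * w (dW s j \<omega>)" by (intro mult_right_mono) (auto simp: V_def w_def)
    finally have sq: "(norm (A j \<omega> *v dW s j \<omega>))\<^sup>2 \<le> V j \<omega> * w (dW s j \<omega>)" .
    have "V (Suc j) \<omega> = V j \<omega> + inner (2 *\<^sub>R (D j \<omega> v* A j \<omega>)) (dW s j \<omega>) + (norm (A j \<omega> *v dW s j \<omega>))\<^sup>2"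
      by (simp add: V_def D_def norm_add_squared dot_lmul_matrix)
    with sq show "V (Suc j) \<omega> \<le> V j \<omega> + inner (2 *\<^sub>R (D j \<omega> v* A j \<omega>)) (dW s j \<omega>) + V j \<omega> * w (dW s j \<omega>)"
      by simp
  next
    show "w \<in> borel_measurable borel" unfolding w_def by measurable
    show "V 0 \<omega> = \<delta>\<^sup>2" for \<omega> by (simp add: V_def D_def)
    show "0 \<le> V j \<omega>" for j \<omega> by (simp add: V_def)
  qed (use V_meas Gs_sets L \<rho> c s in \<open>auto simp: w_def\<close>)
  also have "\<dots> \<le> exp (L\<^sup>2 * c * \<tau>) * \<delta>\<^sup>2 / \<rho>\<^sup>2"
    using one_plus_power_le_exp[of "L\<^sup>2 * c" s J \<tau>] c s Js
    by (intro divide_right_mono mult_right_mono) auto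
  finally have B_meas: "measure M B \<le> exp (L\<^sup>2 * c * \<tau>) * \<delta>\<^sup>2 / \<rho>\<^sup>2" .
  show thesis
  proof (rule that[OF B_sets B_meas[unfolded c_def]])
    fix \<omega> k assume \<omega>: "\<omega> \<in> G" "\<omega> \<notin> B" and k: "k \<le> K"
    have "\<omega> \<in> Gs j" if "j < J" for j
    proof -
      have mem: "real (j div n) * h \<in> {0..\<tau>}" "real j * s \<in> {0..\<tau>}"
        using grid[of j] grid[of "j div n * n"] le_i[of j] that s unfolding coarse by auto
      have "\<bar>real (j div n) * h - real j * s\<bar> \<le> h"
      proof -
        have "j = j div n * n + j mod n" by simp
        then have "real j = real (j div n * n) + real (j mod n)" by (metis of_nat_add)
        then have "real (j div n) * h - real j * s = - (real (j mod n) * s)"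
          unfolding coarse by (simp add: algebra_simps)
        moreover have "real (j mod n) * s \<le> real n * s"
          using s n by (intro mult_right_mono) (auto intro: less_imp_le)
        ultimately show ?thesis using s by (simp add: hs)
      qed
      then have "norm (X (real (j div n) * h) \<omega> - X (real j * s) \<omega>) \<le> \<delta>"
        using G(3)[OF \<omega>(1) mem] by simp
      then have "norm (A j \<omega>) \<le> L * \<delta>"
        unfolding A_def using L by (intro order_trans[OF lip[OF G(2)[OF \<omega>(1) mem(1)] G(2)[OF \<omega>(1) mem(2)]]] mult_left_mono) auto
      then show ?thesis using \<omega>(1) G(1) by (auto simp: Gs_def)
    qed
    moreover have "k * n \<le> J" using k by (simp add: J_def)
    moreover have "\<omega> \<in> space M" using \<omega> G(1) by blast
    ultimately have "\<not> \<rho>\<^sup>2 \<le> V (k * n) \<omega>" using \<omega>(2) unfolding B_def by blast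
    then have "(norm (D (k * n) \<omega>))\<^sup>2 < \<rho>\<^sup>2" using zero_le_power2[of \<delta>] unfolding V_def by linarith
    then have "norm (D (k * n) \<omega>) < \<rho>" using \<rho> by (simp add: power_less_imp_less_base)
    moreover have "D (k * n) \<omega> = ito_sum h k \<omega> - ito_sum (h / real n) (k * n) \<omega>"
      using refined_noise_sum[OF n, where A="\<lambda>j. \<sigma> (X (real j * h) \<omega>)" and k=k and h=h and \<omega>=\<omega>]
      by (simp add: D_def A_def ito_sum_def s_def matrix_vector_mult_diff_rdistrib sum_subtractf)
    ultimately show "norm (ito_sum h k \<omega> - ito_sum (h / real n) (k * n) \<omega>) < \<rho>" by simp
  qed
qed

text \<open>Dividing \<open>[0, k * h]\<close> into \<open>k * n\<close> equal parts gives mesh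
  \<open>h / n\<close>, so along multiples of \<open>k\<close> the sums in the definition of a
  solution are exactly the refined sums of the grid.\<close>

lemma ito_sum_limit:
  assumes h: "0 < h" "real k * h \<le> \<tau>" and \<rho>: "0 < \<rho>"
  obtains A where "\<And>n. A n \<in> sets M" "(\<lambda>n. measure M (A n)) \<longlonglongrightarrow> 0"
    "\<And>n \<omega>. 0 < n \<Longrightarrow> \<omega> \<in> space M \<Longrightarrow> \<omega> \<notin> A n \<Longrightarrow>
      norm (ito_sum (h / real n) (k * n) \<omega> - (X (real k * h) \<omega> - x0 - integral {0..real k * h} (\<lambda>s. b (X s \<omega>)))) \<le> \<rho>"
proof -
  let ?t = "real k * h"
  define L where "L = (\<lambda>\<omega>. X ?t \<omega> - x0 - integral {0..?t} (\<lambda>s. b (X s \<omega>)))"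
  define S where "S = (\<lambda>n \<omega>. \<Sum>i<n. \<sigma> (X (?t * real i / real n) \<omega>) *v (\<omega> (?t * real (Suc i) / real n) - \<omega> (?t * real i / real n)))"
  have "conv_in_prob M S L"
    using sol h unfolding sde_solution_def S_def L_def by auto
  from this \<rho> obtain A where A: "\<And>n. A n \<in> sets M" "\<And>n. {\<omega>\<in>space M. \<rho> < norm (S n \<omega> - L \<omega>)} \<subseteq> A n"
    "(\<lambda>n. measure M (A n)) \<longlonglongrightarrow> 0"
    using conv_in_probE by blast
  \<comment> \<open>For \<open>k = 0\<close> the index \<open>k * n\<close> would not tend to
    infinity. In that case both sums vanish, and \<open>n\<close> itself serves.\<close>
  define r where "r n = (if k = 0 then n else k * n)" for n
  have r: "filterlim r at_top sequentially"
    by (rule filterlim_subseq) (auto intro!: strict_monoI simp: r_def)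
  show thesis
  proof (rule that[of "\<lambda>n. A (r n)"])
    show "(\<lambda>n. measure M (A (r n))) \<longlonglongrightarrow> 0" by (rule filterlim_compose[OF A(3) r])
    fix n \<omega> assume n: "0 < n" and \<omega>: "\<omega> \<in> space M" "\<omega> \<notin> A (r n)"
    have "S (r n) \<omega> = ito_sum (h / real n) (k * n) \<omega>"
    proof (cases "k = 0")
      case True then show ?thesis by (simp add: S_def r_def ito_sum_def)
    next
      case False
      have "?t * real i / real (k * n) = real i * (h / real n)" for i
        using False n by (simp add: field_simps)
      then show ?thesis using False unfolding S_def r_def ito_sum_def dW_def by (simp del: of_nat_mult of_nat_Suc)
    qed
    moreover have "norm (S (r n) \<omega> - L \<omega>) \<le> \<rho>" using A(2)[of "r n"] \<omega> by (auto simp: not_less)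
    ultimately show "norm (ito_sum (h / real n) (k * n) \<omega> - (X (real k * h) \<omega> - x0 - integral {0..real k * h} (\<lambda>s. b (X s \<omega>)))) \<le> \<rho>" by (simp add: L_def)
  qed (use A in auto)
qed

lemma drift_sum_error:
  assumes h: "0 < h" "real k * h \<le> \<tau>" and L: "0 < L" and \<delta>: "0 < \<delta>" and \<omega>: "\<omega> \<in> space M"
    and lip: "\<And>x y. norm x \<le> N \<Longrightarrow> norm y \<le> N \<Longrightarrow> norm (b x - b y) \<le> L * norm (x - y)"
    and G: "\<And>t. t \<in> {0..\<tau>} \<Longrightarrow> norm (X t \<omega>) \<le> N"
      "\<And>s t. s \<in> {0..\<tau>} \<Longrightarrow> t \<in> {0..\<tau>} \<Longrightarrow> \<bar>s - t\<bar> \<le> h \<Longrightarrow> norm (X s \<omega> - X t \<omega>) \<le> \<delta>"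
  shows "norm (integral {0..real k * h} (\<lambda>s. b (X s \<omega>)) - (\<Sum>j<k. h *\<^sub>R b (X (real j * h) \<omega>))) \<le> real k * h * (L * \<delta>)"
  using h(2)
proof (induction k)
  case (Suc k)
  let ?f = "\<lambda>s. b (X s \<omega>)" and ?a = "real k * h" and ?b = "real (Suc k) * h"
  have ab: "0 \<le> ?a" "?a \<le> ?b" "?b \<le> \<tau>" "?b - ?a = h" using h(1) Suc.prems by (auto simp: algebra_simps)
  have cf: "continuous_on {0..\<tau>} ?f"
    using continuous_on_compose2[OF continuous_b X_continuous[OF \<omega>]] by simp
  have e1: "integral {0..?b} ?f = integral {0..?a} ?f + integral {?a..?b} ?f"
    using ab by (intro Henstock_Kurzweil_Integration.integral_combine[symmetric] integrable_continuous_interval continuous_on_subset[OF cf]) auto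
  have e2: "integral {?a..?b} ?f - h *\<^sub>R ?f ?a = integral {?a..?b} (\<lambda>s. ?f s - ?f ?a)"
  proof -
    have "integral {?a..?b} (\<lambda>s. ?f s - ?f ?a) = integral {?a..?b} ?f - integral {?a..?b} (\<lambda>s. ?f ?a)"
      using ab by (intro Henstock_Kurzweil_Integration.integral_diff integrable_continuous_interval continuous_on_subset[OF cf]) auto
    then show ?thesis using ab by (simp del: of_nat_Suc)
  qed
  have e3: "norm (integral {?a..?b} (\<lambda>s. ?f s - ?f ?a)) \<le> (L * \<delta>) * (?b - ?a)"
  proof (rule integral_bound)
    show "continuous_on {?a..?b} (\<lambda>s. ?f s - ?f ?a)"
      using ab by (intro continuous_on_diff continuous_on_const continuous_on_subset[OF cf]) auto
    fix s assume "s \<in> {?a..?b}"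
    then have s: "s \<in> {0..\<tau>}" "?a \<in> {0..\<tau>}" "\<bar>s - ?a\<bar> \<le> h" using ab unfolding atLeastAtMost_iff by linarith+
    show "norm (?f s - ?f ?a) \<le> L * \<delta>"
      using L G(2)[OF s] by (intro order_trans[OF lip[OF G(1)[OF s(1)] G(1)[OF s(2)]]] mult_left_mono) auto
  qed (use ab in auto)
  have "?a \<le> \<tau>" using ab by linarith
  have "integral {0..?b} ?f - (\<Sum>j<Suc k. h *\<^sub>R b (X (real j * h) \<omega>))
      = (integral {0..?a} ?f - (\<Sum>j<k. h *\<^sub>R b (X (real j * h) \<omega>))) + integral {?a..?b} (\<lambda>s. ?f s - ?f ?a)"
    unfolding e1 e2[symmetric] sum.lessThan_Suc by simp
  then have "norm (integral {0..?b} ?f - (\<Sum>j<Suc k. h *\<^sub>R b (X (real j * h) \<omega>)))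
      \<le> ?a * (L * \<delta>) + (L * \<delta>) * (?b - ?a)"
    using norm_triangle_mono[OF Suc.IH[OF \<open>?a \<le> \<tau>\<close>] e3] by presburger
  also have "\<dots> = ?b * (L * \<delta>)" by (simp add: algebra_simps)
  finally show ?case .
qed simp

text \<open>The residual splits into the drift error, the deviation of the refined sum from its
  limit, and the change of the sum under refinement; each is at most \<open>\<rho> / 3\<close> off a
  small event. Only the second requires large \<open>n\<close>, and for fixed \<open>h\<close> it
  concerns finitely many \<open>k\<close>.\<close>

lemma residual_small:
  assumes \<epsilon>: "0 < \<epsilon>" and \<rho>: "0 < \<rho>"
  obtains h0 where "0 < h0" "\<And>h K. 0 < h \<Longrightarrow> h < h0 \<Longrightarrow> real K * h \<le> \<tau> \<Longrightarrow>
    measure M {\<omega>\<in>space M. \<exists>k\<le>K. \<rho> \<le> norm (residual h k \<omega>)} \<le> \<epsilon>"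
proof -
  obtain N G1 where N: "0 < N" "G1 \<in> sets M" "measure M (space M - G1) < \<epsilon> / 3" "G1 \<subseteq> space M"
    "\<And>\<omega> t. \<omega> \<in> G1 \<Longrightarrow> t \<in> {0..\<tau>} \<Longrightarrow> norm (X t \<omega>) \<le> N"
    using X_bounded_event[of "\<epsilon> / 3"] \<epsilon> by (metis divide_pos_pos zero_less_numeral)
  obtain L where L: "0 < L" "\<And>x y. norm x \<le> N \<Longrightarrow> norm y \<le> N \<Longrightarrow> norm (b x - b y) \<le> L * norm (x - y)"
    "\<And>x y. norm x \<le> N \<Longrightarrow> norm y \<le> N \<Longrightarrow> norm (\<sigma> x - \<sigma> y) \<le> L * norm (x - y)"
    using lipschitz_on_ball[of N] by metis
  define E where "E = exp (L\<^sup>2 * gauss_const CARD('a) 1 * \<tau>)"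
  have E: "0 < E" by (simp add: E_def)
  \<comment> \<open>The first bound keeps the drift error below \<open>\<rho> / 3\<close> up to time
    \<open>\<tau>\<close>; the second keeps the probability of the refinement event below
    \<open>\<epsilon> / 3\<close>.\<close>
  define \<delta> where "\<delta> = min (\<rho> / (3 * \<tau> * L)) (sqrt (\<epsilon> / 3 * (\<rho> / 3)\<^sup>2 / E))"
  have \<delta>: "0 < \<delta>" using \<rho> \<epsilon> L(1) tau E by (simp add: \<delta>_def)
  have \<delta>1: "\<tau> * (L * \<delta>) \<le> \<rho> / 3"
  proof -
    have "\<delta> \<le> \<rho> / (3 * \<tau> * L)" by (simp add: \<delta>_def)
    then have "\<delta> * (3 * \<tau> * L) \<le> \<rho>" using tau L(1) by (simp add: pos_le_divide_eq)
    then show ?thesis by (simp add: algebra_simps)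
  qed
  have \<delta>2: "E * \<delta>\<^sup>2 / (\<rho> / 3)\<^sup>2 \<le> \<epsilon> / 3"
  proof -
    have "\<delta>\<^sup>2 \<le> (sqrt (\<epsilon> / 3 * (\<rho> / 3)\<^sup>2 / E))\<^sup>2" using \<delta> by (intro power_mono) (auto simp: \<delta>_def)
    also have "\<dots> = \<epsilon> / 3 * (\<rho> / 3)\<^sup>2 / E" using \<epsilon> E by simp
    finally have "\<delta>\<^sup>2 * E \<le> \<epsilon> / 3 * (\<rho> / 3)\<^sup>2" using E by (simp add: pos_le_divide_eq)
    then show ?thesis using \<rho> by (simp add: pos_divide_le_eq mult.commute)
  qed
  obtain h0 G2 where h0: "0 < h0" "G2 \<in> sets M" "measure M (space M - G2) < \<epsilon> / 3" "G2 \<subseteq> space M"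
    "\<And>\<omega> s t. \<omega> \<in> G2 \<Longrightarrow> s \<in> {0..\<tau>} \<Longrightarrow> t \<in> {0..\<tau>} \<Longrightarrow> \<bar>s - t\<bar> \<le> h0 \<Longrightarrow> norm (X s \<omega> - X t \<omega>) \<le> \<delta>"
    using X_modulus_event[of "\<epsilon> / 3" \<delta>] \<epsilon> \<delta> by (metis divide_pos_pos zero_less_numeral)
  show thesis
  proof (rule that[OF h0(1)])
    fix h K assume h: "0 < h" "h < h0" "real K * h \<le> \<tau>"
    let ?R = "{\<omega>\<in>space M. \<exists>k\<le>K. \<rho> \<le> norm (residual h k \<omega>)}"
    let ?G = "G1 \<inter> G2"
    have hk: "real k * h \<le> \<tau>" if "k \<le> K" for k
      using that h by (intro order_trans[OF _ h(3)] mult_right_mono) auto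
    have "\<exists>A. (\<forall>n. A n \<in> sets M) \<and> (\<lambda>n. measure M (A n)) \<longlonglongrightarrow> 0 \<and> (\<forall>n \<omega>. 0 < n \<longrightarrow> \<omega> \<in> space M \<longrightarrow> \<omega> \<notin> A n \<longrightarrow>
      norm (ito_sum (h / real n) (k * n) \<omega> - (X (real k * h) \<omega> - x0 - integral {0..real k * h} (\<lambda>s. b (X s \<omega>)))) \<le> \<rho> / 3)"
      if "k \<le> K" for k
      by (rule ito_sum_limit[OF h(1) hk[OF that], of "\<rho> / 3"]) (use \<rho> in auto)
    then obtain A where A: "\<And>k n. k \<le> K \<Longrightarrow> A k n \<in> sets M" "\<And>k. k \<le> K \<Longrightarrow> (\<lambda>n. measure M (A k n)) \<longlonglongrightarrow> 0"
      "\<And>k n \<omega>. k \<le> K \<Longrightarrow> 0 < n \<Longrightarrow> \<omega> \<in> space M \<Longrightarrow> \<omega> \<notin> A k n \<Longrightarrow>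
      norm (ito_sum (h / real n) (k * n) \<omega> - (X (real k * h) \<omega> - x0 - integral {0..real k * h} (\<lambda>s. b (X s \<omega>)))) \<le> \<rho> / 3"
      by metis
    have bound: "measure M ?R \<le> (\<epsilon> / 3 + \<epsilon> / 3) + (\<Sum>k\<le>K. measure M (A k n)) + \<epsilon> / 3" if n: "0 < n" for n
    proof -
      obtain B where B: "B \<in> sets M" "measure M B \<le> E * \<delta>\<^sup>2 / (\<rho> / 3)\<^sup>2"
        "\<And>\<omega> k. \<omega> \<in> ?G \<Longrightarrow> \<omega> \<notin> B \<Longrightarrow> k \<le> K \<Longrightarrow> norm (ito_sum h k \<omega> - ito_sum (h / real n) (k * n) \<omega>) < \<rho> / 3"
        unfolding E_def
        by (rule ito_sum_refinement[OF h(1,3) n L(1) \<delta> _ L(3), where \<rho>="\<rho> / 3" and G="?G"]) (use N h0 h(2) \<rho> in auto)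
      have "?R \<subseteq> ((space M - G1) \<union> (space M - G2)) \<union> (\<Union>k\<in>{..K}. A k n) \<union> B"
      proof (rule subsetI, rule ccontr)
        fix \<omega> assume "\<omega> \<in> ?R" and no: "\<omega> \<notin> ((space M - G1) \<union> (space M - G2)) \<union> (\<Union>k\<in>{..K}. A k n) \<union> B"
        then obtain k where k: "\<omega> \<in> space M" "k \<le> K" "\<rho> \<le> norm (residual h k \<omega>)" by auto
        have g: "\<omega> \<in> G1" "\<omega> \<in> G2" "\<omega> \<notin> A k n" "\<omega> \<notin> B" using no k by auto
        let ?I = "integral {0..real k * h} (\<lambda>s. b (X s \<omega>))"
        let ?F = "ito_sum (h / real n) (k * n) \<omega>"
        have 1: "norm (?F - (X (real k * h) \<omega> - x0 - ?I)) \<le> \<rho> / 3" using A(3) k n g by blast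
        have 2: "norm (ito_sum h k \<omega> - ?F) < \<rho> / 3" using B(3) g k by blast
        have 3: "norm (?I - (\<Sum>j<k. h *\<^sub>R b (X (real j * h) \<omega>))) \<le> \<rho> / 3"
        proof -
          have "norm (?I - (\<Sum>j<k. h *\<^sub>R b (X (real j * h) \<omega>))) \<le> real k * h * (L * \<delta>)"
            by (rule drift_sum_error[OF h(1) hk[OF k(2)] L(1) \<delta> k(1) L(2)]) (use N(5) h0(5) g h(2) in auto)
          also have "\<dots> \<le> \<tau> * (L * \<delta>)" using hk[OF k(2)] L(1) \<delta> by (intro mult_right_mono) auto
          finally show ?thesis using \<delta>1 by linarith
        qed
        have eq: "residual h k \<omega> = (?I - (\<Sum>j<k. h *\<^sub>R b (X (real j * h) \<omega>))) - (?F - (X (real k * h) \<omega> - x0 - ?I)) - (ito_sum h k \<omega> - ?F)"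
          by (simp add: residual_def)
        have "norm (u - v - z) \<le> norm u + norm v + norm z" for u v z :: "real^'b" by norm
        from order.strict_trans1[OF this add_le_less_mono[OF add_mono[OF 3 1] 2]] have "norm (residual h k \<omega>) < \<rho>"
          unfolding eq by simp
        with k show False by simp
      qed
      then have "measure M ?R \<le> measure M (((space M - G1) \<union> (space M - G2)) \<union> (\<Union>k\<in>{..K}. A k n) \<union> B)"
        using N h0 A(1) B(1) by (intro finite_measure_mono) auto
      also have "\<dots> \<le> measure M (space M - G1) + measure M (space M - G2) + measure M (\<Union>k\<in>{..K}. A k n) + measure M B"
        using N h0 A(1) B(1)
        by (intro order_trans[OF measure_Un_le] add_mono order_refl) (auto intro!: sets.Un sets.finite_UN)
      also have "\<dots> \<le> \<epsilon> / 3 + \<epsilon> / 3 + (\<Sum>k\<le>K. measure M (A k n)) + \<epsilon> / 3"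
        using N(3) h0(3) order_trans[OF B(2) \<delta>2] A(1) by (intro add_mono measure_UNION_le) (auto intro: less_imp_le)
      finally show ?thesis .
    qed
    \<comment> \<open>The left side of \<open>bound\<close> is free of \<open>n\<close>, so letting
      \<open>n\<close> tend to infinity removes the finite sum and leaves three thirds of
      \<open>\<epsilon>\<close>.\<close>
    have "(\<lambda>n. (\<epsilon> / 3 + \<epsilon> / 3) + (\<Sum>k\<le>K. measure M (A k n)) + \<epsilon> / 3) \<longlonglongrightarrow> (\<epsilon> / 3 + \<epsilon> / 3) + (\<Sum>k\<le>K. 0) + \<epsilon> / 3"
      using A(2) by (intro tendsto_intros) auto
    then have "measure M ?R \<le> (\<epsilon> / 3 + \<epsilon> / 3) + (\<Sum>k\<le>K. 0) + \<epsilon> / 3"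
      by (rule LIMSEQ_le_const) (use bound in \<open>auto intro!: exI[of _ 1]\<close>)
    then show "measure M ?R \<le> \<epsilon>" by simp
  qed
qed

subsection \<open>Uniform convergence in probability\<close>

lemma scheme_bounded:
  assumes \<epsilon>: "0 < \<epsilon>"
  obtains N where "0 < N" "\<And>h n. 0 < h \<Longrightarrow> h \<le> 1 \<Longrightarrow> real n * h \<le> \<tau> \<Longrightarrow>
    measure M {\<omega>\<in>space M. \<exists>k\<le>n. N \<le> norm (Y h k \<omega>)} \<le> \<epsilon>"
proof (rule scheme_maximal_bound[of 2 \<tau>])
  fix C assume C: "0 \<le> C" "\<And>h n lev. 0 < h \<Longrightarrow> h \<le> 1 \<Longrightarrow> real n * h \<le> \<tau> \<Longrightarrow> 0 < lev \<Longrightarrow>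
    measure M {\<omega>\<in>space M. \<exists>k\<le>n. lev \<le> lyap 2 (Y h k \<omega>)} \<le> C / lev"
  \<comment> \<open>The summand 1 makes \<open>N \<ge> 1\<close>, so that \<open>N \<le> |y|\<close>
    implies \<open>N \<le> lyap 2 y\<close>; the quotient makes
    \<open>C / N \<le> \<epsilon>\<close>.\<close>
  define N where "N = C / \<epsilon> + 1"
  have N: "1 \<le> N" using C \<epsilon> by (simp add: N_def)
  show thesis
  proof (rule that[of N])
    fix h n assume h: "0 < h" "h \<le> 1" "real n * h \<le> \<tau>"
    have "N \<le> lyap 2 y" if "N \<le> norm y" for y :: "real^'b"
    proof -
      have "N \<le> 1 + (norm y)\<^sup>2" using that N self_le_power[of "norm y" 2] by simp
      also have "\<dots> \<le> (1 + (norm y)\<^sup>2)\<^sup>2" by (intro self_le_power) auto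
      finally show ?thesis by (simp add: lyap_def)
    qed
    then have sub: "{\<omega>\<in>space M. \<exists>k\<le>n. N \<le> norm (Y h k \<omega>)} \<subseteq> {\<omega>\<in>space M. \<exists>k\<le>n. N \<le> lyap 2 (Y h k \<omega>)}" by blast
    have eq: "{\<omega>\<in>space M. \<exists>k\<le>n. N \<le> lyap 2 (Y h k \<omega>)} = {\<omega>\<in>space M. \<exists>k\<in>{..n}. N \<le> lyap 2 (Y h k \<omega>)}" by blast
    have "{\<omega>\<in>space M. \<exists>k\<le>n. N \<le> lyap 2 (Y h k \<omega>)} \<in> sets M"
      unfolding eq using h by (intro sets.sets_Collect_finite_Ex) (auto simp: lyap_def)
    then have "measure M {\<omega>\<in>space M. \<exists>k\<le>n. N \<le> norm (Y h k \<omega>)} \<le> measure M {\<omega>\<in>space M. \<exists>k\<le>n. N \<le> lyap 2 (Y h k \<omega>)}"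
      by (rule finite_measure_mono[OF sub])
    also have "\<dots> \<le> C / N" by (rule C(2)) (use h N in auto)
    also have "\<dots> \<le> \<epsilon>"
    proof -
      have "C = (C / \<epsilon>) * \<epsilon>" using \<epsilon> by simp
      also have "\<dots> \<le> N * \<epsilon>" using \<epsilon> by (intro mult_right_mono) (auto simp: N_def)
      finally show ?thesis using N by (simp add: pos_divide_le_eq mult.commute)
    qed
    finally show "measure M {\<omega>\<in>space M. \<exists>k\<le>n. N \<le> norm (Y h k \<omega>)} \<le> \<epsilon>" .
  qed (use N in simp)
qed (use tau in auto)

section \<open>The accumulated interaction and the error on the grid\<close>

definition eta_sum :: "real \<Rightarrow> nat \<Rightarrow> (real \<Rightarrow> real^'a) \<Rightarrow> real^'b" where
  "eta_sum h k \<omega> = (\<Sum>j<k. h *\<^sub>R \<eta> h (Y h j \<omega>) (dW h j \<omega>))"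

lemma eta_sum_filt:
  assumes "0 < h"
  shows "eta_sum h k \<in> borel_measurable (filt h k)"
proof -
  interpret noise_filtration M "filt h" "dW h" using noise assms by blast
  have "(\<lambda>\<omega>. \<Sum>j<k. h *\<^sub>R \<eta> h (Y h j \<omega>) (dW h j \<omega>)) \<in> borel_measurable (filt h k)"
  proof (intro borel_measurable_sum borel_measurable_scaleR borel_measurable_const measurable_\<eta> assms)
    fix j assume j: "j \<in> {..<k}"
    show "Y h j \<in> borel_measurable (filt h k)"
      using j by (intro measurable_filt_mono[OF Y_measurable[OF assms]]) auto
    show "dW h j \<in> borel_measurable (filt h k)"
      using j by (intro measurable_filt_mono[OF noise_meas]) auto
  qed
  then show ?thesis by (simp add: eta_sum_def[abs_def])
qed

text \<open>The squares sum to order \<open>\<tau>\<close> in mean, and the additional factor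
  \<open>h\<close> makes the product small; Markov's inequality concludes.\<close>

lemma noise_square_sum_small:
  assumes h: "0 < h" "real K * h \<le> \<tau>" and x: "0 < x"
  shows "measure M {\<omega>\<in>space M. x \<le> h * (\<Sum>j<K. (norm (dW h j \<omega>))\<^sup>2)} \<le> h * (gauss_const CARD('a) 1 * \<tau> / x)"
proof -
  let ?c = "gauss_const CARD('a) 1"
  note m = dW_moment[OF h(1), of _ 1, simplified]
  have i: "integrable M (\<lambda>\<omega>. h * (\<Sum>j<K. (norm (dW h j \<omega>))\<^sup>2))" using m(1) by auto
  have "measure M {\<omega>\<in>space M. x \<le> h * (\<Sum>j<K. (norm (dW h j \<omega>))\<^sup>2)} \<le> (\<integral>\<omega>. h * (\<Sum>j<K. (norm (dW h j \<omega>))\<^sup>2) \<partial>M) / x"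
    using i h x by (intro integral_Markov_inequality_measure[where A="{}"]) (auto intro!: AE_I2 mult_nonneg_nonneg sum_nonneg)
  also have "(\<integral>\<omega>. h * (\<Sum>j<K. (norm (dW h j \<omega>))\<^sup>2) \<partial>M) = h * (\<Sum>j<K. (\<integral>\<omega>. (norm (dW h j \<omega>))\<^sup>2 \<partial>M))"
    using m(1) by simp
  also have "\<dots> \<le> h * (\<Sum>j<K. ?c * h)"
    using m(2) h by (intro mult_left_mono sum_mono) auto
  also have "\<dots> = h * (?c * (real K * h))" by simp
  also have "\<dots> \<le> h * (?c * \<tau>)" using h gauss_const_nonneg by (intro mult_left_mono) auto
  finally show ?thesis using x by (simp add: divide_right_mono)
qed

text \<open>The noise enters the bound on \<open>\<eta>\<close> linearly, while the sum of its
  squares is what is controlled. The inequality \<open>a \<le> \<theta> + a^2 / \<theta>\<close>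
  trades one for the other at the cost of \<open>\<theta>\<close> per unit of time.\<close>

lemma eta_sum_bound:
  assumes h: "0 < h" "h \<le> 1" "real k * h \<le> \<tau>" and N0: "0 \<le> N" and \<theta>: "0 < \<theta>" and k: "k \<le> K"
    and N: "\<And>j. j < k \<Longrightarrow> norm (Y h j \<omega>) \<le> N"
  shows "norm (eta_sum h k \<omega>) \<le> \<bar>K2\<bar> * (\<tau> * (h_pow \<alpha> h * N + \<theta>) + h * (\<Sum>j<K. (norm (dW h j \<omega>))\<^sup>2) / \<theta>)"
proof -
  have young: "a \<le> \<theta> + a\<^sup>2 / \<theta>" if "0 \<le> a" for a
  proof (cases "a \<le> \<theta>")
    case True then show ?thesis using \<theta> by (simp add: add_increasing2)
  next
    case False
    then have "a * \<theta> \<le> a * a" using that by (intro mult_left_mono) auto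
    then have "a \<le> a\<^sup>2 / \<theta>" using \<theta> by (simp add: pos_le_divide_eq power2_eq_square)
    then show ?thesis using \<theta> by simp
  qed
  have "norm (eta_sum h k \<omega>) \<le> (\<Sum>j<k. h * (\<bar>K2\<bar> * (h_pow \<alpha> h * N + \<theta> + (norm (dW h j \<omega>))\<^sup>2 / \<theta>)))"
    unfolding eta_sum_def
  proof (rule order_trans[OF norm_sum sum_mono])
    fix j assume j: "j \<in> {..<k}"
    have "norm (\<eta> h (Y h j \<omega>) (dW h j \<omega>)) \<le> \<bar>K2\<bar> * (h_pow \<alpha> h * norm (Y h j \<omega>) + norm (dW h j \<omega>))"
      by (rule eta_bound'(1)[OF h(1,2)])
    also have "\<dots> \<le> \<bar>K2\<bar> * (h_pow \<alpha> h * N + (\<theta> + (norm (dW h j \<omega>))\<^sup>2 / \<theta>))"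
      using N j h_pow_nonneg young by (intro mult_left_mono add_mono) auto
    finally show "norm (h *\<^sub>R \<eta> h (Y h j \<omega>) (dW h j \<omega>)) \<le> h * (\<bar>K2\<bar> * (h_pow \<alpha> h * N + \<theta> + (norm (dW h j \<omega>))\<^sup>2 / \<theta>))"
      using h by (simp add: add.assoc)
  qed
  also have "\<dots> = \<bar>K2\<bar> * ((real k * h) * (h_pow \<alpha> h * N + \<theta>) + h * (\<Sum>j<k. (norm (dW h j \<omega>))\<^sup>2) / \<theta>)"
    by (simp add: sum.distrib sum_distrib_left[symmetric] sum_divide_distrib[symmetric] distrib_left ac_simps)
  also have "\<dots> \<le> \<bar>K2\<bar> * (\<tau> * (h_pow \<alpha> h * N + \<theta>) + h * (\<Sum>j<K. (norm (dW h j \<omega>))\<^sup>2) / \<theta>)"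
    using h \<theta> k N0 h_pow_nonneg
    by (intro mult_left_mono add_mono mult_right_mono divide_right_mono sum_mono2) auto
  finally show ?thesis .
qed

text \<open>The corrections remove the terms of the recursion that are not of the form required by the
  maximal inequality.\<close>
definition scheme_error :: "real \<Rightarrow> nat \<Rightarrow> (real \<Rightarrow> real^'a) \<Rightarrow> real^'b" where
  "scheme_error h k \<omega> = Y h k \<omega> - X (real k * h) \<omega> + residual h k \<omega> - eta_sum h k \<omega>"

lemma scheme_error_0: "scheme_error h 0 \<omega> = 0"
  by (simp add: scheme_error_def Y_0 residual_def ito_sum_def eta_sum_def)

text \<open>In \<open>scheme_error\<close> the term \<open>X\<close> cancels against the one inside
  \<open>residual\<close>, leaving \<open>Y\<close> minus \<open>x0\<close>, the Euler sums of the
  solution and \<open>eta_sum\<close>. Its increment therefore contains only differences of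
  coefficients at \<open>Y\<close> and at \<open>X\<close>.\<close>

lemma scheme_error_Suc:
  "scheme_error h (Suc k) \<omega> = (scheme_error h k \<omega> + h *\<^sub>R (b (Y h k \<omega>) - b (X (real k * h) \<omega>)))
     + (\<sigma> (Y h k \<omega>) - \<sigma> (X (real k * h) \<omega>)) *v dW h k \<omega>"
  by (simp add: scheme_error_def Y_Suc residual_def ito_sum_def eta_sum_def matrix_vector_mult_diff_rdistrib algebra_simps)

text \<open>\<open>D\<close> is the corrected error, \<open>B\<close> its drift increment,
  \<open>A\<close> the difference of the diffusion coefficients, and \<open>q\<close> the distance
  of scheme and solution, which exceeds \<open>|D|\<close> by at most the two corrections. The
  linear term is taken at \<open>D + B\<close>, known before the noise acts, so no mixed term of
  \<open>B\<close> and \<open>A *v z\<close> is left over. From \<open>q^2 \<le> 8 * V\<close> come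
  \<open>9 * L\<close>, for \<open>2 * inner D B\<close>, and \<open>8 * L^2\<close>, for
  \<open>|B|^2\<close>; the latter also covers \<open>|A|^2\<close>.\<close>

lemma error_step:
  fixes D B :: "real^'b" and A :: "real^'a^'b" and z :: "real^'a"
  assumes h: "0 < h" "h \<le> 1" and L: "0 < L" and q: "0 \<le> q" "q \<le> norm D + 2 * \<delta>"
    and \<delta>: "0 < \<delta>" and A: "norm A \<le> L * q" and B: "norm B \<le> h * (L * q)"
  defines "V \<equiv> (norm D)\<^sup>2 + \<delta>\<^sup>2" and "C \<equiv> 9 * L + 8 * L\<^sup>2"
  shows "norm (2 *\<^sub>R ((D + B) v* A)) \<le> (1 + 2 * C) * V"
    and "(norm ((D + B) + A *v z))\<^sup>2 + \<delta>\<^sup>2 \<le> V + inner (2 *\<^sub>R ((D + B) v* A)) z + V * (C * (h + (norm z)\<^sup>2))"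
proof -
  have "q\<^sup>2 \<le> (norm D + 2 * \<delta>)\<^sup>2" using q by (intro power_mono) auto
  also have "\<dots> \<le> 2 * (norm D)\<^sup>2 + 8 * \<delta>\<^sup>2"
    using sum_squares_bound[of "norm D" "2 * \<delta>"] by (simp add: power2_eq_square algebra_simps)
  also have "\<dots> \<le> 8 * V" by (simp add: V_def)
  finally have q2: "q\<^sup>2 \<le> 8 * V" .
  have V: "0 \<le> V" "(norm D)\<^sup>2 \<le> V" by (simp_all add: V_def)
  have C: "0 \<le> C" "8 * L\<^sup>2 \<le> C" using L by (simp_all add: C_def)
  have DB: "2 * inner D B \<le> h * (9 * L * V)"
  proof -
    have "inner D B \<le> norm D * (h * (L * q))"
      by (rule order_trans[OF norm_cauchy_schwarz]) (intro mult_left_mono B norm_ge_zero)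
    then have "2 * inner D B \<le> h * (L * (2 * norm D * q))" by (simp add: ac_simps)
    also have "\<dots> \<le> h * (L * ((norm D)\<^sup>2 + q\<^sup>2))"
      using h L by (intro mult_left_mono sum_squares_bound) auto
    also have "\<dots> \<le> h * (L * (9 * V))"
      using h L q2 V by (intro mult_left_mono) auto
    finally show ?thesis by simp
  qed
  have B2: "(norm B)\<^sup>2 \<le> h * (8 * L\<^sup>2 * V)"
  proof -
    have "(norm B)\<^sup>2 \<le> (h * (L * q))\<^sup>2" using B by (intro power_mono) auto
    also have "\<dots> = h\<^sup>2 * (L\<^sup>2 * q\<^sup>2)" by (simp add: power_mult_distrib)
    also have "\<dots> \<le> h * (L\<^sup>2 * (8 * V))"
      using h q2 by (intro mult_mono mult_left_mono) (auto simp: power2_eq_square mult_left_le_one_le)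
    finally show ?thesis by simp
  qed
  have DB2: "(norm (D + B))\<^sup>2 \<le> (norm D)\<^sup>2 + h * (C * V)"
    using DB B2 unfolding norm_add_squared C_def by (simp add: algebra_simps)
  have A2: "(norm A)\<^sup>2 \<le> C * V"
  proof -
    have "(norm A)\<^sup>2 \<le> (L * q)\<^sup>2" using A by (intro power_mono) auto
    also have "\<dots> = L\<^sup>2 * q\<^sup>2" by (simp add: power_mult_distrib)
    also have "\<dots> \<le> L\<^sup>2 * (8 * V)" using q2 by (intro mult_left_mono) auto
    also have "\<dots> = 8 * L\<^sup>2 * V" by simp
    also have "\<dots> \<le> C * V" using C V by (intro mult_right_mono)
    finally show ?thesis .
  qed
  have "norm (2 *\<^sub>R ((D + B) v* A)) \<le> 2 * (norm (D + B) * norm A)"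
    using norm_vector_matrix_mult_le by simp
  also have "\<dots> \<le> (norm (D + B))\<^sup>2 + (norm A)\<^sup>2"
    using sum_squares_bound[of "norm (D + B)" "norm A"] by simp
  also have "\<dots> \<le> V + C * V + C * V"
  proof -
    have "h * (C * V) \<le> C * V" using h C V by (intro mult_left_le_one_le) auto
    then show ?thesis using DB2 A2 V by linarith
  qed
  finally show "norm (2 *\<^sub>R ((D + B) v* A)) \<le> (1 + 2 * C) * V" by (simp add: algebra_simps)
  have "(norm (A *v z))\<^sup>2 \<le> (norm A * norm z)\<^sup>2" by (intro power_mono norm_matrix_vector_mult_le) auto
  also have "\<dots> = (norm A)\<^sup>2 * (norm z)\<^sup>2" by (rule power_mult_distrib)
  also have "\<dots> \<le> (C * V) * (norm z)\<^sup>2" using A2 by (intro mult_right_mono) auto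
  finally have Az: "(norm (A *v z))\<^sup>2 \<le> (C * V) * (norm z)\<^sup>2" .
  have "(norm ((D + B) + A *v z))\<^sup>2 = (norm (D + B))\<^sup>2 + inner (2 *\<^sub>R ((D + B) v* A)) z + (norm (A *v z))\<^sup>2"
    by (simp add: norm_add_squared[of "D + B"] dot_lmul_matrix)
  moreover have "V * (C * (h + (norm z)\<^sup>2)) = h * (C * V) + (C * V) * (norm z)\<^sup>2" by (simp add: algebra_simps)
  ultimately show "(norm ((D + B) + A *v z))\<^sup>2 + \<delta>\<^sup>2 \<le> V + inner (2 *\<^sub>R ((D + B) v* A)) z + V * (C * (h + (norm z)\<^sup>2))"
    using DB2 Az V_def by linarith
qed

text \<open>All conditions concern the single index \<open>k\<close>, so the event is decided at
  time \<open>k\<close> and can serve as the set \<open>G k\<close>.\<close>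

definition good_step :: "real \<Rightarrow> real \<Rightarrow> real \<Rightarrow> nat \<Rightarrow> (real \<Rightarrow> real^'a) \<Rightarrow> bool" where
  "good_step N \<delta> h k \<omega> \<longleftrightarrow> norm (Y h k \<omega>) \<le> N \<and> norm (X (real k * h) \<omega>) \<le> N \<and>
     norm (residual h k \<omega>) \<le> \<delta> \<and> norm (eta_sum h k \<omega>) \<le> \<delta>"

lemma good_step_dist:
  assumes "good_step N \<delta> h k \<omega>"
  shows "norm (Y h k \<omega> - X (real k * h) \<omega>) \<le> norm (scheme_error h k \<omega>) + 2 * \<delta>"
proof -
  have "Y h k \<omega> - X (real k * h) \<omega> = scheme_error h k \<omega> - residual h k \<omega> + eta_sum h k \<omega>"
    by (simp add: scheme_error_def)
  moreover have "norm (u - v + z) \<le> norm u + norm v + norm z" for u v z :: "real^'b" by norm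
  ultimately have "norm (Y h k \<omega> - X (real k * h) \<omega>) \<le> norm (scheme_error h k \<omega>) + norm (residual h k \<omega>) + norm (eta_sum h k \<omega>)"
    by metis
  then show ?thesis using assms unfolding good_step_def by linarith
qed

text \<open>The error starts at 0, so \<open>V\<close> starts at \<open>\<delta>^2\<close>. The
  exponential factor depends only on \<open>L\<close>, \<open>\<tau>\<close> and the dimension,
  which allows \<open>\<delta>\<close> to be chosen after the ball that fixes
  \<open>L\<close>.\<close>

lemma good_step_scheme_error:
  assumes L: "0 < L"
    and lip: "\<And>x y. norm x \<le> N \<Longrightarrow> norm y \<le> N \<Longrightarrow> norm (b x - b y) \<le> L * norm (x - y)"
      "\<And>x y. norm x \<le> N \<Longrightarrow> norm y \<le> N \<Longrightarrow> norm (\<sigma> x - \<sigma> y) \<le> L * norm (x - y)"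
    and h: "0 < h" "h \<le> 1" "real K * h \<le> \<tau>" and \<delta>: "0 < \<delta>" and \<rho>: "0 < \<rho>"
  shows "measure M {\<omega>\<in>space M. (\<forall>j<K. good_step N \<delta> h j \<omega>) \<and> (\<exists>j\<le>K. \<rho> \<le> norm (scheme_error h j \<omega>))}
    \<le> exp ((9 * L + 8 * L\<^sup>2) * (1 + gauss_const CARD('a) 1) * \<tau>) * \<delta>\<^sup>2 / \<rho>\<^sup>2"
proof -
  interpret noise_filtration M "filt h" "dW h" using noise h by blast
  define C where "C = 9 * L + 8 * L\<^sup>2"
  define c where "c = gauss_const CARD('a) 1"
  define V where "V j \<omega> = (norm (scheme_error h j \<omega>))\<^sup>2 + \<delta>\<^sup>2" for j \<omega>
  define w where "w z = C * (h + (norm z)\<^sup>2)" for z :: "real^'a"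
  define B where "B j \<omega> = h *\<^sub>R (b (Y h j \<omega>) - b (X (real j * h) \<omega>))" for j \<omega>
  define A where "A j \<omega> = \<sigma> (Y h j \<omega>) - \<sigma> (X (real j * h) \<omega>)" for j \<omega>
  define G where "G j = {\<omega>\<in>space M. good_step N \<delta> h j \<omega>}" for j
  have C: "0 \<le> C" and c: "0 \<le> c" using L by (simp_all add: C_def c_def gauss_const_nonneg)
  have grid: "real j * h \<le> \<tau>" if "j \<le> K" for j
    using that h by (intro order_trans[OF _ h(3)] mult_right_mono) auto
  have meas: "X (real j * h) \<in> borel_measurable (filt h j)" "Y h j \<in> borel_measurable (filt h j)"
    "residual h j \<in> borel_measurable (filt h j)" "eta_sum h j \<in> borel_measurable (filt h j)"
    "scheme_error h j \<in> borel_measurable (filt h j)" if "j \<le> K" for j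
  proof -
    show *: "X (real j * h) \<in> borel_measurable (filt h j)" "Y h j \<in> borel_measurable (filt h j)"
      "residual h j \<in> borel_measurable (filt h j)" "eta_sum h j \<in> borel_measurable (filt h j)"
      using grid[OF that] h X_filt Y_measurable residual_filt eta_sum_filt by auto
    have "(\<lambda>\<omega>. Y h j \<omega> - X (real j * h) \<omega> + residual h j \<omega> - eta_sum h j \<omega>) \<in> borel_measurable (filt h j)"
      using * by (intro borel_measurable_diff borel_measurable_add)
    then show "scheme_error h j \<in> borel_measurable (filt h j)" by (simp add: scheme_error_def[abs_def])
  qed
  have V_meas: "V j \<in> borel_measurable (filt h j)" if "j \<le> K" for j
  proof -
    note [measurable] = meas(5)[OF that]
    show ?thesis unfolding V_def by measurable
  qed
  have G_sets: "G j \<in> sets (filt h j)" if "j \<le> K" for j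
  proof -
    note [measurable] = meas[OF that]
    have "{\<omega>\<in>space (filt h j). good_step N \<delta> h j \<omega>} \<in> sets (filt h j)"
      unfolding good_step_def by measurable
    then show ?thesis by (simp add: G_def)
  qed
  have "measure M {\<omega>\<in>space M. (\<forall>j<K. \<omega> \<in> G j) \<and> (\<exists>j\<le>K. \<rho>\<^sup>2 \<le> V j \<omega>)} \<le> (1 + C * (1 + c) * h) ^ K * \<delta>\<^sup>2 / \<rho>\<^sup>2"
  proof (rule maximal_inequality[where g="\<lambda>j \<omega>. 2 *\<^sub>R ((scheme_error h j \<omega> + B j \<omega>) v* A j \<omega>)" and w=w and c="1 + 2 * C"])
    fix j assume j: "j < K"
    note [measurable] = meas[OF less_imp_le[OF j]]
    show "(\<lambda>\<omega>. 2 *\<^sub>R ((scheme_error h j \<omega> + B j \<omega>) v* A j \<omega>)) \<in> borel_measurable (filt h j)"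
      unfolding A_def B_def by measurable
    show "integrable M (\<lambda>\<omega>. w (dW h j \<omega>))"
      using dW_moment(1)[OF h(1), of j 1] by (simp add: w_def)
    have "(\<integral>\<omega>. w (dW h j \<omega>) \<partial>M) = C * (h + (\<integral>\<omega>. (norm (dW h j \<omega>))\<^sup>2 \<partial>M))"
      using dW_moment(1)[OF h(1), of j 1] by (simp add: w_def prob_space)
    also have "\<dots> \<le> C * (h + c * h)"
      using dW_moment(2)[OF h(1), of j 1] C by (intro mult_left_mono add_left_mono) (auto simp: c_def)
    finally show "(\<integral>\<omega>. w (dW h j \<omega>) \<partial>M) \<le> C * (1 + c) * h" by (simp add: algebra_simps)
    fix \<omega> assume "\<omega> \<in> G j"
    then have g: "good_step N \<delta> h j \<omega>" by (simp add: G_def)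
    then have YN: "norm (Y h j \<omega>) \<le> N" and XN: "norm (X (real j * h) \<omega>) \<le> N" by (simp_all add: good_step_def)
    have Aj: "norm (A j \<omega>) \<le> L * norm (Y h j \<omega> - X (real j * h) \<omega>)" unfolding A_def by (rule lip(2)[OF YN XN])
    have Bj: "norm (B j \<omega>) \<le> h * (L * norm (Y h j \<omega> - X (real j * h) \<omega>))"
      unfolding B_def using h lip(1)[OF YN XN] by simp
    note st = error_step[OF h(1,2) L norm_ge_zero good_step_dist[OF g] \<delta> Aj Bj]
    show "norm (2 *\<^sub>R ((scheme_error h j \<omega> + B j \<omega>) v* A j \<omega>)) \<le> (1 + 2 * C) * V j \<omega>"
      using st(1) by (simp add: V_def C_def)
    show "V (Suc j) \<omega> \<le> V j \<omega> + inner (2 *\<^sub>R ((scheme_error h j \<omega> + B j \<omega>) v* A j \<omega>)) (dW h j \<omega>) + V j \<omega> * w (dW h j \<omega>)"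
      using st(2)[of "dW h j \<omega>"] unfolding V_def w_def C_def scheme_error_Suc A_def[symmetric] B_def[symmetric] .
  next
    show "w \<in> borel_measurable borel" unfolding w_def by measurable
    show "0 \<le> w z" for z using C h by (simp add: w_def)
    show "V 0 \<omega> = \<delta>\<^sup>2" for \<omega> by (simp add: V_def scheme_error_0)
    show "0 \<le> V j \<omega>" for j \<omega> by (simp add: V_def)
  qed (use V_meas G_sets C c h \<rho> in auto)
  also have "\<dots> \<le> exp (C * (1 + c) * \<tau>) * \<delta>\<^sup>2 / \<rho>\<^sup>2"
    using one_plus_power_le_exp[of "C * (1 + c)" h K \<tau>] C c h
    by (intro divide_right_mono mult_right_mono) auto
  finally have bound: "measure M {\<omega>\<in>space M. (\<forall>j<K. \<omega> \<in> G j) \<and> (\<exists>j\<le>K. \<rho>\<^sup>2 \<le> V j \<omega>)} \<le> exp (C * (1 + c) * \<tau>) * \<delta>\<^sup>2 / \<rho>\<^sup>2" .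
  have sets: "{\<omega>\<in>space M. (\<forall>j<K. \<omega> \<in> G j) \<and> (\<exists>j\<le>K. \<rho>\<^sup>2 \<le> V j \<omega>)} \<in> sets M"
    using V_meas G_sets by (intro maximal_event) auto
  have imp: "\<rho>\<^sup>2 \<le> V j \<omega>" if "\<rho> \<le> norm (scheme_error h j \<omega>)" for j \<omega>
    using power_mono[OF that less_imp_le[OF \<rho>], of 2] zero_le_power2[of \<delta>] unfolding V_def by linarith
  have "measure M {\<omega>\<in>space M. (\<forall>j<K. good_step N \<delta> h j \<omega>) \<and> (\<exists>j\<le>K. \<rho> \<le> norm (scheme_error h j \<omega>))}
      \<le> measure M {\<omega>\<in>space M. (\<forall>j<K. \<omega> \<in> G j) \<and> (\<exists>j\<le>K. \<rho>\<^sup>2 \<le> V j \<omega>)}"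
    by (rule finite_measure_mono[OF _ sets]) (use imp in \<open>unfold G_def, blast\<close>)
  also note bound
  finally show ?thesis by (simp add: C_def c_def)
qed

text \<open>Constants are chosen in the order \<open>N\<close>, \<open>L\<close>,
  \<open>\<delta>\<close>, then \<open>\<theta>\<close> and \<open>x\<close>, and last
  \<open>h0\<close>. Off five events of probability at most \<open>\<epsilon> / 5\<close> each, all
  steps are good and the corrected error is below \<open>\<rho> / 2\<close>; the two corrections add
  at most \<open>2 * \<delta> \<le> \<rho> / 2\<close>.\<close>

lemma scheme_grid_error:
  assumes \<epsilon>: "0 < \<epsilon>" and \<rho>: "0 < \<rho>"
  obtains h0 where "0 < h0" "\<And>h K. 0 < h \<Longrightarrow> h < h0 \<Longrightarrow> real K * h \<le> \<tau> \<Longrightarrow>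
    \<exists>B\<in>sets M. measure M B \<le> \<epsilon> \<and> (\<forall>\<omega>\<in>space M - B. \<forall>k\<le>K. norm (X (real k * h) \<omega> - Y h k \<omega>) \<le> \<rho>)"
proof -
  define e where "e = \<epsilon> / 5"
  have e: "0 < e" using \<epsilon> by (simp add: e_def)
  obtain N1 G1 where N1: "0 < N1" "G1 \<in> sets M" "measure M (space M - G1) < e" "G1 \<subseteq> space M"
    "\<And>\<omega> t. \<omega> \<in> G1 \<Longrightarrow> t \<in> {0..\<tau>} \<Longrightarrow> norm (X t \<omega>) \<le> N1"
    using X_bounded_event[OF e] by metis
  obtain N2 where N2: "0 < N2" "\<And>h n. 0 < h \<Longrightarrow> h \<le> 1 \<Longrightarrow> real n * h \<le> \<tau> \<Longrightarrow>
    measure M {\<omega>\<in>space M. \<exists>k\<le>n. N2 \<le> norm (Y h k \<omega>)} \<le> e"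
    using scheme_bounded[OF e] by blast
  define N where "N = max N1 N2"
  have N: "0 < N" "N1 \<le> N" "N2 \<le> N" using N1 by (auto simp: N_def)
  obtain L where L: "0 < L" "\<And>x y. norm x \<le> N \<Longrightarrow> norm y \<le> N \<Longrightarrow> norm (b x - b y) \<le> L * norm (x - y)"
    "\<And>x y. norm x \<le> N \<Longrightarrow> norm y \<le> N \<Longrightarrow> norm (\<sigma> x - \<sigma> y) \<le> L * norm (x - y)"
    using lipschitz_on_ball[of N] by metis
  define E where "E = exp ((9 * L + 8 * L\<^sup>2) * (1 + gauss_const CARD('a) 1) * \<tau>)"
  have E: "0 < E" by (simp add: E_def)
  define \<delta> where "\<delta> = min (\<rho> / 4) (sqrt (e * (\<rho> / 2)\<^sup>2 / E))"
  have \<delta>: "0 < \<delta>" "\<delta> \<le> \<rho> / 4" using \<rho> e E by (simp_all add: \<delta>_def)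
  have \<delta>2: "E * \<delta>\<^sup>2 / (\<rho> / 2)\<^sup>2 \<le> e"
  proof -
    have "\<delta>\<^sup>2 \<le> (sqrt (e * (\<rho> / 2)\<^sup>2 / E))\<^sup>2" using \<delta> by (intro power_mono) (auto simp: \<delta>_def)
    also have "\<dots> = e * (\<rho> / 2)\<^sup>2 / E" using e E by simp
    finally have "\<delta>\<^sup>2 * E \<le> e * (\<rho> / 2)\<^sup>2" using E by (simp add: pos_le_divide_eq)
    then show ?thesis using \<rho> by (simp add: pos_divide_le_eq mult.commute)
  qed
  obtain h1 where h1: "0 < h1" "\<And>h K. 0 < h \<Longrightarrow> h < h1 \<Longrightarrow> real K * h \<le> \<tau> \<Longrightarrow>
    measure M {\<omega>\<in>space M. \<exists>k\<le>K. \<delta> \<le> norm (residual h k \<omega>)} \<le> e"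
    using residual_small[OF e \<delta>(1)] by blast
  \<comment> \<open>The added 1 makes \<open>k2\<close> a positive divisor also when
    \<open>K2 = 0\<close>.\<close>
  define k2 where "k2 = \<bar>K2\<bar> + 1"
  have k2: "0 < k2" "\<bar>K2\<bar> \<le> k2" by (simp_all add: k2_def)
  \<comment> \<open>With \<open>x\<close> and the bound on \<open>h_pow \<alpha> h\<close> below,
    this gives each of the three terms of \<open>eta_sum_bound\<close> the share
    \<open>\<delta> / 3\<close>.\<close>
  define \<theta> where "\<theta> = \<delta> / (3 * k2 * \<tau>)"
  have \<theta>: "0 < \<theta>" using \<delta> k2 tau by (simp add: \<theta>_def)
  define x where "x = \<theta> * (\<delta> / (3 * k2))"
  have x: "0 < x" using \<delta> k2 \<theta> by (simp add: x_def)
  define c where "c = gauss_const CARD('a) 1 * \<tau> / x"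
  have c: "0 \<le> c" using x tau gauss_const_nonneg by (simp add: c_def)
  have "\<forall>\<^sub>F h in at_right 0. h_pow \<alpha> h < \<delta> / (3 * k2 * \<tau> * N)"
    using \<delta> k2 tau N by (intro order_tendstoD[OF h_pow_tendsto_0]) auto
  then obtain h2 where h2: "0 < h2" "\<And>h. 0 < h \<Longrightarrow> h < h2 \<Longrightarrow> h_pow \<alpha> h < \<delta> / (3 * k2 * \<tau> * N)"
    unfolding eventually_at_right_field by auto
  define h0 where "h0 = min (min 1 h1) (min h2 (e / (c + 1)))"
  have h0: "0 < h0" using h1 h2 e c by (simp add: h0_def)
  show thesis
  proof (rule that[OF h0])
    fix h K assume h: "0 < h" "h < h0" "real K * h \<le> \<tau>"
    have hl: "h \<le> 1" "h < h1" "h < h2" "h < e / (c + 1)" using h by (simp_all add: h0_def)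
    have hc: "h * c \<le> e"
    proof -
      have "h * (c + 1) < e" using hl(4) c by (simp add: pos_less_divide_eq)
      then show ?thesis using h by (simp add: algebra_simps)
    qed
    have grid: "real k * h \<in> {0..\<tau>}" if "k \<le> K" for k
      using that h order_trans[OF mult_right_mono[of "real k" "real K" h] h(3)] by auto
    define B1 where "B1 = space M - G1"
    define B2 where "B2 = {\<omega>\<in>space M. \<exists>k\<in>{..K}. N2 \<le> norm (Y h k \<omega>)}"
    define B3 where "B3 = {\<omega>\<in>space M. \<exists>k\<in>{..K}. \<delta> \<le> norm (residual h k \<omega>)}"
    define B4 where "B4 = {\<omega>\<in>space M. x \<le> h * (\<Sum>j<K. (norm (dW h j \<omega>))\<^sup>2)}"
    \<comment> \<open>\<open>B5\<close> covers large errors only among paths that are good at all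
      steps before \<open>K\<close>. Off \<open>B1\<close> to \<open>B4\<close> every path is of
      this kind, so there avoiding \<open>B5\<close> forces a small error.\<close>
    define B5 where "B5 = {\<omega>\<in>space M. (\<forall>j\<in>{..<K}. good_step N \<delta> h j \<omega>) \<and> (\<exists>j\<in>{..K}. \<rho> / 2 \<le> norm (scheme_error h j \<omega>))}"
    note mf = noise_filtration.measurable_filt[OF noise[OF h(1)]]
    have mX: "X (real k * h) \<in> borel_measurable M" if "k \<le> K" for k
      using grid[OF that] X_measurable by auto
    have mR: "residual h k \<in> borel_measurable M" if "k \<le> K" for k
      using grid[OF that] h by (intro mf[OF residual_filt]) auto
    have mE: "eta_sum h k \<in> borel_measurable M" for k
      using h by (intro mf[OF eta_sum_filt])
    have mD: "scheme_error h k \<in> borel_measurable M" if "k \<le> K" for k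
      unfolding scheme_error_def using mX[OF that] mR[OF that] mE h
      by (intro borel_measurable_diff borel_measurable_add) auto
    have sets: "B1 \<in> sets M" "B2 \<in> sets M" "B3 \<in> sets M" "B4 \<in> sets M" "B5 \<in> sets M"
    proof -
      show "B1 \<in> sets M" using N1 by (simp add: B1_def)
      show "B2 \<in> sets M" unfolding B2_def using h by (intro sets.sets_Collect_finite_Ex) auto
      show "B3 \<in> sets M" unfolding B3_def
      proof (intro sets.sets_Collect_finite_Ex)
        fix k assume "k \<in> {..K}"
        then have [measurable]: "residual h k \<in> borel_measurable M" using mR by auto
        show "{\<omega>\<in>space M. \<delta> \<le> norm (residual h k \<omega>)} \<in> sets M" by measurable
      qed simp
      show "B4 \<in> sets M" unfolding B4_def using h by auto
      show "B5 \<in> sets M" unfolding B5_def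
      proof (intro sets.sets_Collect_conj sets.sets_Collect_finite_Ex sets.sets_Collect_finite_All)
        fix k assume "k \<in> {..<K}"
        then have [measurable]: "residual h k \<in> borel_measurable M" "X (real k * h) \<in> borel_measurable M"
          "eta_sum h k \<in> borel_measurable M" "Y h k \<in> borel_measurable M" using mR mX mE h by auto
        show "{\<omega>\<in>space M. good_step N \<delta> h k \<omega>} \<in> sets M" unfolding good_step_def by measurable
      next
        fix k assume "k \<in> {..K}"
        then have [measurable]: "scheme_error h k \<in> borel_measurable M" using mD by auto
        show "{\<omega>\<in>space M. \<rho> / 2 \<le> norm (scheme_error h k \<omega>)} \<in> sets M" by measurable
      qed auto
    qed
    have ex: "(\<exists>k\<in>{..K}. P k) \<longleftrightarrow> (\<exists>k\<le>K. P k)" "(\<forall>k\<in>{..<K}. P k) \<longleftrightarrow> (\<forall>k<K. P k)" for P :: "nat \<Rightarrow> bool" by auto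
    have m1: "measure M B1 \<le> e" using N1 by (simp add: B1_def)
    have m2: "measure M B2 \<le> e" unfolding B2_def ex by (rule N2(2)[OF h(1) hl(1) h(3)])
    have m3: "measure M B3 \<le> e" unfolding B3_def ex by (rule h1(2)[OF h(1) hl(2) h(3)])
    have m4: "measure M B4 \<le> e"
      unfolding B4_def using noise_square_sum_small[OF h(1,3) x] hc unfolding c_def by linarith
    have m5: "measure M B5 \<le> e"
      unfolding B5_def ex
    proof (rule order_trans[OF _ \<delta>2[unfolded E_def]])
      show "measure M {\<omega>\<in>space M. (\<forall>j<K. good_step N \<delta> h j \<omega>) \<and> (\<exists>j\<le>K. \<rho> / 2 \<le> norm (scheme_error h j \<omega>))}
        \<le> exp ((9 * L + 8 * L\<^sup>2) * (1 + gauss_const CARD('a) 1) * \<tau>) * \<delta>\<^sup>2 / (\<rho> / 2)\<^sup>2"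
        by (rule good_step_scheme_error[OF L(1)]) (use L(2,3) h hl \<delta>(1) \<rho> in auto)
    qed
    define B where "B = B1 \<union> B2 \<union> B3 \<union> B4 \<union> B5"
    have "measure M B \<le> measure M B1 + measure M B2 + measure M B3 + measure M B4 + measure M B5"
      unfolding B_def using sets by (intro order_trans[OF measure_Un_le] add_mono order_refl) (auto intro!: sets.Un)
    with m1 m2 m3 m4 m5 have mB: "measure M B \<le> \<epsilon>" unfolding e_def by linarith
    have "norm (X (real k * h) \<omega> - Y h k \<omega>) \<le> \<rho>" if \<omega>: "\<omega> \<in> space M" "\<omega> \<notin> B" and k: "k \<le> K" for \<omega> k
    proof -
      have n: "\<omega> \<in> G1" "\<omega> \<notin> B2" "\<omega> \<notin> B3" "\<omega> \<notin> B4" "\<omega> \<notin> B5" using \<omega> unfolding B_def B1_def by blast+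
      have YN: "norm (Y h j \<omega>) \<le> N" if "j \<le> K" for j
      proof (rule ccontr)
        assume "\<not> norm (Y h j \<omega>) \<le> N"
        then have "N2 \<le> norm (Y h j \<omega>)" using N(3) by linarith
        then have "\<omega> \<in> B2" using that \<omega>(1) unfolding B2_def by blast
        then show False using n(2) by blast
      qed
      have XN: "norm (X (real j * h) \<omega>) \<le> N" if "j \<le> K" for j
        using N1(5)[OF n(1) grid[OF that]] N(2) by simp
      have R\<delta>: "norm (residual h j \<omega>) \<le> \<delta>" if "j \<le> K" for j
      proof (rule ccontr)
        assume "\<not> norm (residual h j \<omega>) \<le> \<delta>"
        then have "\<delta> \<le> norm (residual h j \<omega>)" by simp
        then have "\<omega> \<in> B3" using that \<omega>(1) unfolding B3_def by blast
        then show False using n(3) by blast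
      qed
      have E\<delta>: "norm (eta_sum h j \<omega>) \<le> \<delta>" if "j \<le> K" for j
      proof -
        define Q where "Q = h * (\<Sum>j<K. (norm (dW h j \<omega>))\<^sup>2)"
        have Q: "Q \<le> x" using n(4) \<omega>(1) by (simp add: B4_def Q_def)
        have "norm (eta_sum h j \<omega>) \<le> \<bar>K2\<bar> * (\<tau> * (h_pow \<alpha> h * N + \<theta>) + Q / \<theta>)"
          unfolding Q_def using grid[OF that] N YN that by (intro eta_sum_bound h(1) hl(1) \<theta>) auto
        also have "\<dots> \<le> k2 * (\<delta> / (3 * k2) + \<delta> / (3 * k2) + \<delta> / (3 * k2))"
        proof (rule mult_mono[OF k2(2)])
          have "h_pow \<alpha> h \<le> \<delta> / (3 * k2 * \<tau> * N)" using h2(2)[OF h(1) hl(3)] by simp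
          then have "\<tau> * (h_pow \<alpha> h * N) \<le> \<tau> * (\<delta> / (3 * k2 * \<tau> * N) * N)"
            using tau N by (intro mult_left_mono mult_right_mono) auto
          also have "\<dots> = \<delta> / (3 * k2)" using tau N by simp
          finally have 1: "\<tau> * (h_pow \<alpha> h * N) \<le> \<delta> / (3 * k2)" .
          have 2: "\<tau> * \<theta> = \<delta> / (3 * k2)" using tau by (simp add: \<theta>_def)
          have "Q / \<theta> \<le> x / \<theta>" using Q \<theta> by (intro divide_right_mono) auto
          also have "\<dots> = \<delta> / (3 * k2)" using \<theta> by (simp add: x_def)
          finally have 3: "Q / \<theta> \<le> \<delta> / (3 * k2)" .
          show "\<tau> * (h_pow \<alpha> h * N + \<theta>) + Q / \<theta> \<le> \<delta> / (3 * k2) + \<delta> / (3 * k2) + \<delta> / (3 * k2)"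
            using 1 2 3 by (simp only: distrib_left)
          have "0 \<le> Q" unfolding Q_def using h by (intro mult_nonneg_nonneg sum_nonneg) auto
          then show "0 \<le> \<tau> * (h_pow \<alpha> h * N + \<theta>) + Q / \<theta>"
            using tau N \<theta> h_pow_nonneg by (intro add_nonneg_nonneg mult_nonneg_nonneg divide_nonneg_nonneg) auto
        qed (use k2 in simp)
        also have "\<dots> = \<delta>" using k2 by (simp add: field_simps)
        finally show ?thesis .
      qed
      have good: "good_step N \<delta> h j \<omega>" if "j \<le> K" for j
        using YN[OF that] XN[OF that] R\<delta>[OF that] E\<delta>[OF that] by (simp add: good_step_def)
      have "norm (scheme_error h k \<omega>) < \<rho> / 2"
      proof (rule ccontr)
        assume "\<not> norm (scheme_error h k \<omega>) < \<rho> / 2"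
        then have "\<rho> / 2 \<le> norm (scheme_error h k \<omega>)" by simp
        moreover have "\<forall>j\<in>{..<K}. good_step N \<delta> h j \<omega>" using good by simp
        ultimately have "\<omega> \<in> B5" using k \<omega>(1) unfolding B5_def by blast
        then show False using n(5) by blast
      qed
      then show ?thesis using good_step_dist[OF good[OF k]] \<delta>(2) norm_minus_commute[of "X (real k * h) \<omega>"] by simp
    qed
    moreover have "B \<in> sets M" using sets by (simp add: B_def)
    ultimately show "\<exists>B\<in>sets M. measure M B \<le> \<epsilon> \<and> (\<forall>\<omega>\<in>space M - B. \<forall>k\<le>K. norm (X (real k * h) \<omega> - Y h k \<omega>) \<le> \<rho>)"
      using mB by (intro bexI[of _ B]) auto
  qed
qed


section \<open>From the grid to the interpolated scheme\<close>

abbreviation Xbar :: "real \<Rightarrow> (real \<Rightarrow> real^'a) \<Rightarrow> real \<Rightarrow> real^'b" where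
  "Xbar h \<omega> t \<equiv> interp (U_map b \<sigma> \<eta>) h x0 \<omega> t"

definition steps :: "real \<Rightarrow> nat" where
  "steps h = nat \<lfloor>\<tau> / h\<rfloor>"

lemma steps_le: "0 < h \<Longrightarrow> real (steps h) * h \<le> \<tau>"
proof -
  assume h: "0 < h"
  have "real (steps h) = of_int \<lfloor>\<tau> / h\<rfloor>" using h tau by (simp add: steps_def)
  also have "\<dots> \<le> \<tau> / h" by simp
  finally show ?thesis using h by (simp add: pos_le_divide_eq)
qed

text \<open>The right end of the cell may have index \<open>Suc (steps h)\<close>, that is, lie
  beyond \<open>\<tau>\<close>; the bounds that follow have to cover this extra point.\<close>

lemma interp_between:
  assumes h: "0 < h" and t: "t \<in> {0..\<tau>}"
  obtains n \<theta> where "n \<le> steps h" "real n * h \<le> t" "t \<le> real n * h + h" "0 \<le> \<theta>" "\<theta> \<le> 1"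
    "\<And>\<omega>. Xbar h \<omega> t = Y h n \<omega> + \<theta> *\<^sub>R (Y h (Suc n) \<omega> - Y h n \<omega>)"
proof -
  define n where "n = nat \<lfloor>t / h\<rfloor>"
  have rn: "real n = of_int \<lfloor>t / h\<rfloor>" using h t by (simp add: n_def)
  have "real n \<le> t / h" "t / h \<le> real n + 1" unfolding rn by linarith+
  then have 1: "real n * h \<le> t" "t \<le> real n * h + h" using h by (auto simp: field_simps)
  have "n \<le> steps h" unfolding n_def steps_def using h t by (intro nat_mono floor_mono divide_right_mono) auto
  moreover have "0 \<le> (t - real n * h) / h" "(t - real n * h) / h \<le> 1" using 1 h by (auto simp: field_simps)
  moreover have "Xbar h \<omega> t = Y h n \<omega> + ((t - real n * h) / h) *\<^sub>R (Y h (Suc n) \<omega> - Y h n \<omega>)" for \<omega>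
    by (simp add: interp_def Let_def Y_def n_def del: scheme.simps)
  ultimately show thesis using that 1 by blast
qed

text \<open>Off the grid the error consists of the oscillation of the solution, the grid error, and
  the increment of the scheme over one cell. In a cell inside \<open>[0, \<tau>]\<close> that
  increment is compared with the solution at both ends. The last cell may end after
  \<open>\<tau>\<close>, where nothing is known of \<open>X\<close>; its increment is bounded
  directly by one Brownian increment and the size of the scheme.\<close>

lemma uniform_error:
  assumes \<epsilon>: "0 < \<epsilon>" and \<rho>: "0 < \<rho>"
  obtains h0 where "0 < h0" "h0 \<le> 1" "\<And>h. 0 < h \<Longrightarrow> h < h0 \<Longrightarrow>
    \<exists>B\<in>sets M. measure M B \<le> \<epsilon> \<and> (\<forall>\<omega>\<in>space M - B. \<forall>t\<in>{0..\<tau>}. norm (X t \<omega> - Xbar h \<omega> t) \<le> \<rho>)"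
proof -
  define e where "e = \<epsilon> / 4"
  define r where "r = \<rho> / 6"
  have e: "0 < e" and r: "0 < r" using \<epsilon> \<rho> by (simp_all add: e_def r_def)
  obtain h1 where h1: "0 < h1" "\<And>h K. 0 < h \<Longrightarrow> h < h1 \<Longrightarrow> real K * h \<le> \<tau> \<Longrightarrow>
    \<exists>B\<in>sets M. measure M B \<le> e \<and> (\<forall>\<omega>\<in>space M - B. \<forall>k\<le>K. norm (X (real k * h) \<omega> - Y h k \<omega>) \<le> r)"
    using scheme_grid_error[OF e r] by blast
  obtain h2 G2 where h2: "0 < h2" "G2 \<in> sets M" "measure M (space M - G2) < e" "G2 \<subseteq> space M"
    "\<And>\<omega> s t. \<omega> \<in> G2 \<Longrightarrow> s \<in> {0..\<tau>} \<Longrightarrow> t \<in> {0..\<tau>} \<Longrightarrow> \<bar>s - t\<bar> \<le> h2 \<Longrightarrow> norm (X s \<omega> - X t \<omega>) \<le> r"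
    using X_modulus_event[OF e r] by blast
  obtain N where N: "0 < N" "\<And>h n. 0 < h \<Longrightarrow> h \<le> 1 \<Longrightarrow> real n * h \<le> \<tau> \<Longrightarrow>
    measure M {\<omega>\<in>space M. \<exists>k\<le>n. N \<le> norm (Y h k \<omega>)} \<le> e"
    using scheme_bounded[OF e] by blast
  define k where "k = K1 + \<bar>K2\<bar> + 1"
  have k: "0 < k" "K1 + \<bar>K2\<bar> \<le> k" using K1_nonneg by (simp_all add: k_def)
  \<comment> \<open>Chosen so that \<open>k * (1 + N) * (x + x) = 3 * r\<close>, the bound that also
    holds in the complete cells.\<close>
  define x where "x = 3 * r / (2 * k * (1 + N))"
  have x: "0 < x" using k N r by (simp add: x_def)
  define c where "c = gauss_const CARD('a) 1"
  have c: "0 \<le> c" by (simp add: c_def gauss_const_nonneg)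
  define h0 where "h0 = min (min 1 h1) (min h2 (min x (e * x\<^sup>2 / (c + 1))))"
  have h0: "0 < h0" "h0 \<le> 1" using h1 h2 x e c by (simp_all add: h0_def)
  show thesis
  proof (rule that[OF h0])
    fix h assume h: "0 < h" "h < h0"
    have hl: "h \<le> 1" "h < h1" "h < h2" "h < x" "h < e * x\<^sup>2 / (c + 1)" using h by (simp_all add: h0_def)
    define K where "K = steps h"
    have K: "real K * h \<le> \<tau>" unfolding K_def using h by (rule_tac steps_le)
    obtain B1 where B1: "B1 \<in> sets M" "measure M B1 \<le> e"
      "\<And>\<omega> k. \<omega> \<in> space M \<Longrightarrow> \<omega> \<notin> B1 \<Longrightarrow> k \<le> K \<Longrightarrow> norm (X (real k * h) \<omega> - Y h k \<omega>) \<le> r"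
      using h1(2)[OF h(1) hl(2) K] by blast
    define B2 where "B2 = space M - G2"
    define B3 where "B3 = {\<omega>\<in>space M. N \<le> norm (Y h K \<omega>)}"
    define B4 where "B4 = {\<omega>\<in>space M. x\<^sup>2 \<le> (norm (dW h K \<omega>))\<^sup>2}"
    have sets: "B2 \<in> sets M" "B3 \<in> sets M" "B4 \<in> sets M"
      using h2 h(1) by (simp_all add: B2_def B3_def B4_def)
    have m2: "measure M B2 \<le> e" using h2(3) by (simp add: B2_def)
    have m3: "measure M B3 \<le> e"
    proof (rule order_trans[OF finite_measure_mono N(2)[OF h(1) hl(1) K]])
      show "B3 \<subseteq> {\<omega>\<in>space M. \<exists>k\<le>K. N \<le> norm (Y h k \<omega>)}" unfolding B3_def by blast
      have eq: "{\<omega>\<in>space M. \<exists>k\<le>K. N \<le> norm (Y h k \<omega>)} = {\<omega>\<in>space M. \<exists>k\<in>{..K}. N \<le> norm (Y h k \<omega>)}" by blast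
      show "{\<omega>\<in>space M. \<exists>k\<le>K. N \<le> norm (Y h k \<omega>)} \<in> sets M"
        unfolding eq using h by (intro sets.sets_Collect_finite_Ex) auto
    qed
    have m4: "measure M B4 \<le> e"
    proof -
      have "measure M B4 \<le> (\<integral>\<omega>. (norm (dW h K \<omega>))\<^sup>2 \<partial>M) / x\<^sup>2"
        unfolding B4_def using dW_moment(1)[OF h(1), of K 1] x
        by (intro integral_Markov_inequality_measure[where A="{}"]) auto
      also have "\<dots> \<le> (c * h) / x\<^sup>2"
        using dW_moment(2)[OF h(1), of K 1] by (intro divide_right_mono) (auto simp: c_def)
      also have "\<dots> \<le> e"
      proof -
        have "h * (c + 1) < e * x\<^sup>2" using hl(5) c by (simp add: pos_less_divide_eq)
        then have "c * h \<le> e * x\<^sup>2" using h by (simp add: algebra_simps)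
        then show ?thesis using x by (simp add: pos_divide_le_eq)
      qed
      finally show ?thesis .
    qed
    define B where "B = B1 \<union> B2 \<union> B3 \<union> B4"
    have "measure M B \<le> measure M B1 + measure M B2 + measure M B3 + measure M B4"
      unfolding B_def using sets B1(1) by (intro order_trans[OF measure_Un_le] add_mono order_refl) (auto intro!: sets.Un)
    with B1(2) m2 m3 m4 have mB: "measure M B \<le> \<epsilon>" unfolding e_def by linarith
    have err: "norm (X t \<omega> - Xbar h \<omega> t) \<le> \<rho>" if \<omega>: "\<omega> \<in> space M" "\<omega> \<notin> B" and t: "t \<in> {0..\<tau>}" for \<omega> t
    proof -
      have no: "\<omega> \<notin> B1" "\<omega> \<in> G2" "\<omega> \<notin> B3" "\<omega> \<notin> B4" using \<omega> unfolding B_def B2_def by blast+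
      have grid: "real j * h \<in> {0..\<tau>}" if "j \<le> K" for j
        using that h order_trans[OF mult_right_mono[of "real j" "real K" h] K] by auto
      obtain n \<theta> where n: "n \<le> K" "real n * h \<le> t" "t \<le> real n * h + h" "0 \<le> \<theta>" "\<theta> \<le> 1"
        "Xbar h \<omega> t = Y h n \<omega> + \<theta> *\<^sub>R (Y h (Suc n) \<omega> - Y h n \<omega>)"
        using interp_between[OF h(1) t] unfolding K_def by metis
      have 1: "norm (X t \<omega> - X (real n * h) \<omega>) \<le> r"
        using n hl(3) by (intro h2(5)[OF no(2) t grid[OF n(1)]]) auto
      have 2: "norm (X (real n * h) \<omega> - Y h n \<omega>) \<le> r" by (rule B1(3)[OF \<omega>(1) no(1) n(1)])
      have 3: "norm (Y h (Suc n) \<omega> - Y h n \<omega>) \<le> 3 * r"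
      proof (cases "n < K")
        case True
        have a: "norm (X (real (Suc n) * h) \<omega> - Y h (Suc n) \<omega>) \<le> r"
          using True by (intro B1(3)[OF \<omega>(1) no(1)]) auto
        have "\<bar>real (Suc n) * h - real n * h\<bar> = h" using h by (simp add: algebra_simps)
        then have c: "norm (X (real (Suc n) * h) \<omega> - X (real n * h) \<omega>) \<le> r"
          using True hl(3) grid[OF n(1)] grid[of "Suc n"] by (intro h2(5)[OF no(2)]) auto
        have "norm (u - v) \<le> norm (p - u) + norm (p - q) + norm (q - v)" for u v p q :: "real^'b" by norm
        from order_trans[OF this add_mono[OF add_mono[OF a c] 2]] show ?thesis by simp
      next
        case False
        then have nK: "n = K" using n by simp
        have YN: "norm (Y h K \<omega>) \<le> N" using no(3) \<omega>(1) by (simp add: B3_def)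
        have "(norm (dW h K \<omega>))\<^sup>2 \<le> x\<^sup>2" using no(4) \<omega>(1) by (simp add: B4_def)
        then have dx: "norm (dW h K \<omega>) \<le> x" using x by (simp add: power2_le_iff_abs_le)
        have "Y h (Suc K) \<omega> - Y h K \<omega> = \<sigma> (Y h K \<omega>) *v dW h K \<omega> + h *\<^sub>R b (Y h K \<omega>) + h *\<^sub>R \<eta> h (Y h K \<omega>) (dW h K \<omega>)"
          by (simp add: Y_Suc)
        then have "norm (Y h (Suc K) \<omega> - Y h K \<omega>) \<le> (K1 + \<bar>K2\<bar>) * (1 + norm (Y h K \<omega>)) * (norm (dW h K \<omega>) + h)"
          using scheme_increment_bound[OF h(1) hl(1)] by simp
        also have "\<dots> \<le> k * (1 + N) * (x + x)"
          using k YN dx hl(4) N h K1_nonneg by (intro mult_mono add_mono) auto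
        also have "\<dots> = x * (2 * k * (1 + N))" by (simp add: algebra_simps)
        also have "\<dots> = 3 * r"
        proof -
          have "2 * k * (1 + N) \<noteq> 0" using k N by simp
          then show ?thesis unfolding x_def by (rule nonzero_eq_divide_eq[THEN iffD1, OF _ refl])
        qed
        finally show ?thesis by (simp add: nK)
      qed
      have 4: "norm (\<theta> *\<^sub>R (Y h (Suc n) \<omega> - Y h n \<omega>)) \<le> 3 * r"
      proof -
        have "norm (\<theta> *\<^sub>R (Y h (Suc n) \<omega> - Y h n \<omega>)) \<le> norm (Y h (Suc n) \<omega> - Y h n \<omega>)"
          using n by (simp add: mult_left_le_one_le)
        then show ?thesis using 3 by linarith
      qed
      have "norm (p - (v + d)) \<le> norm (p - q) + norm (q - v) + norm d" for p q v d :: "real^'b" by norm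
      from order_trans[OF this add_mono[OF add_mono[OF 1 2] 4]] have "norm (X t \<omega> - Xbar h \<omega> t) \<le> r + r + 3 * r"
        unfolding n(6) .
      then show ?thesis using r by (simp add: r_def)
    qed
    moreover have "B \<in> sets M" using sets B1(1) by (simp add: B_def)
    ultimately show "\<exists>B\<in>sets M. measure M B \<le> \<epsilon> \<and> (\<forall>\<omega>\<in>space M - B. \<forall>t\<in>{0..\<tau>}. norm (X t \<omega> - Xbar h \<omega> t) \<le> \<rho>)"
      using mB by blast
  qed
qed

end

section \<open>Uniform integrability and the limit\<close>

text \<open>The series contributes 0 at \<open>n = 0\<close> because \<open>inverse 0 = 0\<close>;
  the leading 1 is the trivial bound for the probability belonging to that index.\<close>

definition tail_const :: "real \<Rightarrow> real" where
  "tail_const C = 1 + C * (\<Sum>n. inverse (real n ^ 2))"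

lemma tail_const_nonneg: "0 \<le> C \<Longrightarrow> 0 \<le> tail_const C"
  using inverse_power_summable[of 2, where 'a=real] by (simp add: tail_const_def suminf_nonneg)

text \<open>The function is raised to its integer ceiling, whose integral is the sum over
  \<open>n\<close> of the probabilities of \<open>n < f\<close>; tails of order
  \<open>1 / n^2\<close> make this sum finite.\<close>

lemma (in prob_space) nn_integral_le_tail_const:
  fixes f :: "'a \<Rightarrow> real"
  assumes f: "f \<in> borel_measurable M" and C: "0 \<le> C"
    and tail: "\<And>n::nat. 0 < n \<Longrightarrow> prob {\<omega>\<in>space M. real n < f \<omega>} \<le> C / (real n)\<^sup>2"
  shows "(\<integral>\<^sup>+\<omega>. ennreal (f \<omega>) \<partial>M) \<le> ennreal (tail_const C)"
proof -
  let ?s = "\<lambda>n::nat. inverse (real n ^ 2)"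
  let ?g = "\<lambda>n. (if n = 0 then 1 else 0) + C * ?s n"
  have [measurable]: "(\<lambda>\<omega>. nat \<lceil>f \<omega>\<rceil>) \<in> measurable M (count_space UNIV)" using f by measurable
  have "(\<integral>\<^sup>+\<omega>. ennreal (f \<omega>) \<partial>M) \<le> (\<integral>\<^sup>+\<omega>. of_nat (nat \<lceil>f \<omega>\<rceil>) \<partial>M)"
  proof (rule nn_integral_mono)
    fix \<omega>
    have "f \<omega> \<le> real (nat \<lceil>f \<omega>\<rceil>)" by linarith
    then show "ennreal (f \<omega>) \<le> of_nat (nat \<lceil>f \<omega>\<rceil>)"
      using ennreal_leI by (fastforce simp: ennreal_of_nat_eq_real_of_nat)
  qed
  also have "\<dots> = (\<Sum>n. emeasure M {\<omega>\<in>space M. n < nat \<lceil>f \<omega>\<rceil>})"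
    by (rule nn_integral_nat_function) measurable
  also have "\<dots> \<le> (\<Sum>n. ennreal (?g n))"
  proof (intro suminf_le summableI)
    fix n :: nat
    have eq: "{\<omega>\<in>space M. n < nat \<lceil>f \<omega>\<rceil>} = {\<omega>\<in>space M. real n < f \<omega>}"
      by (auto simp: zless_nat_eq_int_zless less_ceiling_iff)
    show "emeasure M {\<omega>\<in>space M. n < nat \<lceil>f \<omega>\<rceil>} \<le> ennreal (?g n)"
      unfolding eq emeasure_eq_measure
      using tail[of n] by (intro ennreal_leI) (auto simp: divide_inverse)
  qed
  also have "\<dots> = ennreal (tail_const C)"
  proof (rule suminf_ennreal_eq)
    show "0 \<le> ?g n" for n using C by simp
    have "(\<lambda>n::nat. if n = 0 then 1 else 0 :: real) sums 1" using sums_single[of 0 "\<lambda>_. 1::real"] by simp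
    moreover have "(\<lambda>n. C * ?s n) sums (C * suminf ?s)"
      using inverse_power_summable[of 2, where 'a=real] by (intro sums_mult summable_sums) simp
    ultimately show "?g sums tail_const C" unfolding tail_const_def by (rule sums_add)
  qed
  finally show ?thesis .
qed

text \<open>For \<open>m > 0\<close>, if no index worked, \<open>root m a\<close> would bound all
  values and hence the supremum. The index obtained need not attain the supremum.\<close>

lemma less_cSUP_power:
  fixes f :: "'i \<Rightarrow> real"
  assumes "I \<noteq> {}" "bdd_above (f ` I)" "\<And>i. i \<in> I \<Longrightarrow> 0 \<le> f i" "0 \<le> a" "a < (SUP i\<in>I. f i) ^ m"
  obtains i where "i \<in> I" "a < f i ^ m"
proof (cases "m = 0")
  case True
  then show thesis using assms that by auto
next
  case False
  have "\<exists>i\<in>I. a < f i ^ m"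
  proof (rule ccontr)
    assume "\<not> (\<exists>i\<in>I. a < f i ^ m)"
    then have "f i \<le> root m a" if "i \<in> I" for i
      using that False assms(3)[of i] real_root_le_mono[of m "f i ^ m" a] by (auto simp: not_less real_root_power_cancel)
    then have "(SUP i\<in>I. f i) \<le> root m a" using assms(1) by (intro cSUP_least)
    moreover have "0 \<le> (SUP i\<in>I. f i)" using assms(1-3) by (meson cSUP_upper2 ex_in_conv)
    ultimately have "(SUP i\<in>I. f i) ^ m \<le> root m a ^ m" by (rule power_mono)
    also have "\<dots> = a" using False assms(4) by (simp add: real_root_pow_pos2)
    finally show False using assms(5) by simp
  qed
  then show thesis using that by blast
qed

context repeated_interaction_sde
begin

section \<open>Moments of the suprema of scheme and solution\<close>

text \<open>Restricted to the countable set \<open>times\<close> for the sake of measurability; by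
  continuity it still bounds the path on all of \<open>{0..\<tau>}\<close>.\<close>

definition X_sup :: "(real \<Rightarrow> real^'a) \<Rightarrow> real" where
  "X_sup \<omega> = (SUP t\<in>times. norm (X t \<omega>))"

text \<open>The range includes \<open>Suc (steps h)\<close>, the grid point that the interpolation
  uses in its last cell.\<close>

definition Y_sup :: "real \<Rightarrow> (real \<Rightarrow> real^'a) \<Rightarrow> real" where
  "Y_sup h \<omega> = (SUP k\<in>{..Suc (steps h)}. norm (Y h k \<omega>))"

lemma times_nonempty: "times \<noteq> {}"
proof
  assume "times = {}"
  then have "{0..\<tau>} = {}" using closure_times by simp
  then show False using tau by simp
qed

lemma X_bdd: "\<omega> \<in> space M \<Longrightarrow> bdd_above ((\<lambda>t. norm (X t \<omega>)) ` {0..\<tau>})"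
  using X_continuous by (intro bounded_imp_bdd_above compact_imp_bounded compact_continuous_image continuous_on_norm) auto

lemma X_bdd_times: "\<omega> \<in> space M \<Longrightarrow> bdd_above ((\<lambda>t. norm (X t \<omega>)) ` times)"
  using X_bdd times_subset by (meson bdd_above_mono image_mono)

lemma X_sup_measurable [measurable]: "X_sup \<in> borel_measurable M"
  unfolding X_sup_def[abs_def] using X_bdd_times countable_times times_X
  by (intro borel_measurable_cSUP) auto

lemma norm_X_le_sup:
  assumes "\<omega> \<in> space M" "t \<in> {0..\<tau>}"
  shows "norm (X t \<omega>) \<le> X_sup \<omega>"
proof (rule continuous_on_closure_norm_le[of times])
  show "continuous_on (closure times) (\<lambda>t. X t \<omega>)" using X_continuous assms by (simp add: closure_times)
  show "\<forall>t\<in>times. norm (X t \<omega>) \<le> X_sup \<omega>"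
    unfolding X_sup_def using X_bdd_times[OF assms(1)] by (auto intro: cSUP_upper)
qed (use assms closure_times in auto)

lemma Y_sup_measurable [measurable]: "0 < h \<Longrightarrow> Y_sup h \<in> borel_measurable M"
  unfolding Y_sup_def[abs_def] by (intro borel_measurable_cSUP) auto

lemma norm_Y_le_sup: "k \<le> Suc (steps h) \<Longrightarrow> norm (Y h k \<omega>) \<le> Y_sup h \<omega>"
  unfolding Y_sup_def by (intro cSUP_upper) auto

lemma sup_nonneg: "\<omega> \<in> space M \<Longrightarrow> 0 \<le> X_sup \<omega>" "0 \<le> Y_sup h \<omega>"
  using norm_X_le_sup[of \<omega> 0] tau order_trans[OF norm_ge_zero norm_X_le_sup[of \<omega> 0]]
    order_trans[OF norm_ge_zero norm_Y_le_sup[of 0 h \<omega>]] by auto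

lemma norm_Xbar_le:
  assumes h: "0 < h" and t: "t \<in> {0..\<tau>}"
  obtains k where "k \<le> Suc (steps h)" "norm (Xbar h \<omega> t) \<le> norm (Y h k \<omega>)"
proof -
  obtain n \<theta> where n: "n \<le> steps h" "0 \<le> \<theta>" "\<theta> \<le> 1"
    "Xbar h \<omega> t = Y h n \<omega> + \<theta> *\<^sub>R (Y h (Suc n) \<omega> - Y h n \<omega>)"
    using interp_between[OF h t] by metis
  have eq: "Xbar h \<omega> t = (1 - \<theta>) *\<^sub>R Y h n \<omega> + \<theta> *\<^sub>R Y h (Suc n) \<omega>" unfolding n(4) by (simp add: algebra_simps)
  define m where "m = max (norm (Y h n \<omega>)) (norm (Y h (Suc n) \<omega>))"
  have "norm (Xbar h \<omega> t) \<le> (1 - \<theta>) * norm (Y h n \<omega>) + \<theta> * norm (Y h (Suc n) \<omega>)"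
    unfolding eq using n by (intro order_trans[OF norm_triangle_ineq]) auto
  also have "\<dots> \<le> (1 - \<theta>) * m + \<theta> * m"
    using n unfolding m_def by (intro add_mono mult_left_mono) auto
  also have "\<dots> = m" by (simp add: algebra_simps)
  finally have le: "norm (Xbar h \<omega> t) \<le> m" .
  show thesis
  proof (cases "norm (Y h n \<omega>) \<le> norm (Y h (Suc n) \<omega>)")
    case True
    then show thesis using le n(1) by (intro that[of "Suc n"]) (auto simp: m_def)
  next
    case False
    then show thesis using le n(1) by (intro that[of n]) (auto simp: m_def)
  qed
qed

text \<open>Tails of order \<open>1 / n^2\<close> suffice for a finite mean, and
  \<open>lyap (2 * m)\<close> dominates the square of \<open>|y| ^ m\<close>. The maximal bound at
  level \<open>n^2\<close> is therefore exactly the tail bound required.\<close>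

lemma sup_moments:
  assumes m: "0 < m"
  obtains C where "0 \<le> C" "(\<integral>\<^sup>+\<omega>. ennreal (X_sup \<omega> ^ m) \<partial>M) \<le> ennreal C"
    "\<And>h. 0 < h \<Longrightarrow> h \<le> 1 \<Longrightarrow> (\<integral>\<^sup>+\<omega>. ennreal (Y_sup h \<omega> ^ m) \<partial>M) \<le> ennreal C"
\<comment> \<open>The horizon \<open>\<tau> + 1\<close> reaches the index
  \<open>Suc (steps h)\<close> for every \<open>h \<le> 1\<close>.\<close>
proof (rule scheme_maximal_bound[of "2 * m" "\<tau> + 1"])
  fix C assume C: "0 \<le> C" "\<And>h n lev. 0 < h \<Longrightarrow> h \<le> 1 \<Longrightarrow> real n * h \<le> \<tau> + 1 \<Longrightarrow> 0 < lev \<Longrightarrow>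
    measure M {\<omega>\<in>space M. \<exists>k\<le>n. lev \<le> lyap (2 * m) (Y h k \<omega>)} \<le> C / lev"
  define A where "A h lev = {\<omega>\<in>space M. \<exists>k\<in>{..Suc (steps h)}. lev \<le> lyap (2 * m) (Y h k \<omega>)}" for h lev
  have A_sets: "A h lev \<in> sets M" if "0 < h" for h lev
    unfolding A_def using that by (intro sets.sets_Collect_finite_Ex) (auto simp: lyap_def)
  have A_prob: "measure M (A h lev) \<le> C / lev" if "0 < h" "h \<le> 1" "0 < lev" for h lev
  proof -
    have eq: "A h lev = {\<omega>\<in>space M. \<exists>k\<le>Suc (steps h). lev \<le> lyap (2 * m) (Y h k \<omega>)}" unfolding A_def by blast
    show ?thesis unfolding eq
      using that steps_le[OF that(1)] by (intro C(2)) (auto simp: algebra_simps)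
  qed
  have lyap_ge: "(norm y ^ m)\<^sup>2 \<le> lyap (2 * m) y" "((1 + norm y) ^ m)\<^sup>2 \<le> 4 ^ m * lyap (2 * m) y" for y :: "real^'b"
  proof -
    have "(norm y ^ m)\<^sup>2 = ((norm y)\<^sup>2) ^ m" by (simp only: power_mult[symmetric] mult.commute)
    also have "\<dots> \<le> (1 + (norm y)\<^sup>2) ^ m" by (intro power_mono) auto
    also have "\<dots> \<le> (1 + (norm y)\<^sup>2) ^ (2 * m)" by (intro power_increasing) auto
    finally show "(norm y ^ m)\<^sup>2 \<le> lyap (2 * m) y" by (simp add: lyap_def)
    have "((1 + norm y) ^ m)\<^sup>2 = ((1 + norm y)\<^sup>2) ^ m" by (simp only: power_mult[symmetric] mult.commute)
    also have "\<dots> \<le> (2 * (1 + (norm y)\<^sup>2)) ^ m" by (intro power_mono one_plus_norm_squared_le) auto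
    also have "\<dots> = 2 ^ m * (1 + (norm y)\<^sup>2) ^ m" by (rule power_mult_distrib)
    also have "\<dots> \<le> 4 ^ m * (1 + (norm y)\<^sup>2) ^ (2 * m)"
      by (intro mult_mono power_increasing power_mono) auto
    finally show "((1 + norm y) ^ m)\<^sup>2 \<le> 4 ^ m * lyap (2 * m) y" by (simp add: lyap_def)
  qed
  have Y_tail: "prob {\<omega>\<in>space M. real n < Y_sup h \<omega> ^ m} \<le> C / (real n)\<^sup>2" if h: "0 < h" "h \<le> 1" and n: "0 < n" for h n
  proof -
    have "{\<omega>\<in>space M. real n < Y_sup h \<omega> ^ m} \<subseteq> A h ((real n)\<^sup>2)"
    proof safe
      fix \<omega> assume \<omega>: "\<omega> \<in> space M" "real n < Y_sup h \<omega> ^ m"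
      obtain k where k: "k \<in> {..Suc (steps h)}" "real n < norm (Y h k \<omega>) ^ m"
        by (rule less_cSUP_power[of "{..Suc (steps h)}" "\<lambda>k. norm (Y h k \<omega>)" "real n" m]) (use \<omega> in \<open>auto simp: Y_sup_def\<close>)
      have "(real n)\<^sup>2 \<le> (norm (Y h k \<omega>) ^ m)\<^sup>2" using k by (intro power_mono) auto
      then show "\<omega> \<in> A h ((real n)\<^sup>2)" using \<omega>(1) k(1) order_trans[OF _ lyap_ge(1)] unfolding A_def by blast
    qed
    then have "prob {\<omega>\<in>space M. real n < Y_sup h \<omega> ^ m} \<le> prob (A h ((real n)\<^sup>2))"
      using A_sets[OF h(1)] by (intro finite_measure_mono)
    also have "\<dots> \<le> C / (real n)\<^sup>2" using h n by (intro A_prob) auto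
    finally show ?thesis .
  qed
  \<comment> \<open>Off an event of probability \<open>e\<close> the solution is within 1 of an
    interpolated scheme whose tail bound does not depend on \<open>h\<close>. As \<open>e\<close> is
    arbitrary, the tail passes to the solution; the factor \<open>4 ^ m\<close> absorbs the shift by
    1.\<close>
  have X_tail: "prob {\<omega>\<in>space M. real n < X_sup \<omega> ^ m} \<le> (4 ^ m * C) / (real n)\<^sup>2" if n: "0 < n" for n
  proof (rule field_le_epsilon)
    fix e :: real assume e: "0 < e"
    obtain h0 where h0: "0 < h0" "h0 \<le> 1" "\<And>h. 0 < h \<Longrightarrow> h < h0 \<Longrightarrow>
      \<exists>B\<in>sets M. measure M B \<le> e \<and> (\<forall>\<omega>\<in>space M - B. \<forall>t\<in>{0..\<tau>}. norm (X t \<omega> - Xbar h \<omega> t) \<le> 1)"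
      using uniform_error[OF e zero_less_one] by blast
    define h where "h = h0 / 2"
    have h: "0 < h" "h < h0" "h \<le> 1" using h0 by (simp_all add: h_def)
    obtain B where B: "B \<in> sets M" "measure M B \<le> e"
      "\<And>\<omega> t. \<omega> \<in> space M \<Longrightarrow> \<omega> \<notin> B \<Longrightarrow> t \<in> {0..\<tau>} \<Longrightarrow> norm (X t \<omega> - Xbar h \<omega> t) \<le> 1"
      using h0(3)[OF h(1,2)] by blast
    define lev where "lev = (real n)\<^sup>2 / 4 ^ m"
    have lev: "0 < lev" using n by (simp add: lev_def)
    have "{\<omega>\<in>space M. real n < X_sup \<omega> ^ m} \<subseteq> B \<union> A h lev"
    proof (rule subsetI, rule ccontr)
      fix \<omega> assume "\<omega> \<in> {\<omega>\<in>space M. real n < X_sup \<omega> ^ m}" and no: "\<omega> \<notin> B \<union> A h lev"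
      then have \<omega>: "\<omega> \<in> space M" "real n < X_sup \<omega> ^ m" by auto
      obtain t where t: "t \<in> times" "real n < norm (X t \<omega>) ^ m"
        by (rule less_cSUP_power[of times "\<lambda>t. norm (X t \<omega>)" "real n" m])
          (use \<omega> times_nonempty X_bdd_times in \<open>auto simp: X_sup_def\<close>)
      have t': "t \<in> {0..\<tau>}" using t times_subset by blast
      obtain k where k: "k \<le> Suc (steps h)" "norm (Xbar h \<omega> t) \<le> norm (Y h k \<omega>)"
        using norm_Xbar_le[OF h(1) t', of \<omega>] by blast
      have "norm (X t \<omega>) \<le> 1 + norm (Y h k \<omega>)"
        using B(3)[OF \<omega>(1) _ t'] no k(2) norm_triangle_sub[of "X t \<omega>" "Xbar h \<omega> t"] by auto
      then have "norm (X t \<omega>) ^ m \<le> (1 + norm (Y h k \<omega>)) ^ m" by (intro power_mono) auto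
      then have "(real n)\<^sup>2 \<le> ((1 + norm (Y h k \<omega>)) ^ m)\<^sup>2" using t by (intro power_mono) auto
      also have "\<dots> \<le> 4 ^ m * lyap (2 * m) (Y h k \<omega>)" by (rule lyap_ge)
      finally have "lev \<le> lyap (2 * m) (Y h k \<omega>)" by (simp add: lev_def pos_divide_le_eq mult.commute)
      then have "\<omega> \<in> A h lev" using k(1) \<omega>(1) unfolding A_def by blast
      then show False using no by blast
    qed
    then have "prob {\<omega>\<in>space M. real n < X_sup \<omega> ^ m} \<le> prob (B \<union> A h lev)"
      using A_sets[OF h(1)] B(1) by (intro finite_measure_mono) auto
    also have "\<dots> \<le> prob B + prob (A h lev)" using A_sets[OF h(1)] B(1) by (intro measure_Un_le)
    also have "\<dots> \<le> e + C / lev" using B(2) A_prob[OF h(1,3) lev] by (rule add_mono)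
    also have "C / lev = (4 ^ m * C) / (real n)\<^sup>2" by (simp add: lev_def)
    finally show "prob {\<omega>\<in>space M. real n < X_sup \<omega> ^ m} \<le> (4 ^ m * C) / (real n)\<^sup>2 + e" by simp
  qed
  define D where "D = max (tail_const (4 ^ m * C)) (tail_const C)"
  show thesis
  proof (rule that[of D])
    show "0 \<le> D" using tail_const_nonneg[OF C(1)] by (simp add: D_def)
    have "(\<integral>\<^sup>+\<omega>. ennreal (X_sup \<omega> ^ m) \<partial>M) \<le> ennreal (tail_const (4 ^ m * C))"
      using C(1) X_tail by (intro nn_integral_le_tail_const) auto
    also have "\<dots> \<le> ennreal D" by (intro ennreal_leI) (simp add: D_def)
    finally show "(\<integral>\<^sup>+\<omega>. ennreal (X_sup \<omega> ^ m) \<partial>M) \<le> ennreal D" .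
    fix h :: real assume h: "0 < h" "h \<le> 1"
    have "(\<integral>\<^sup>+\<omega>. ennreal (Y_sup h \<omega> ^ m) \<partial>M) \<le> ennreal (tail_const C)"
      using C(1) Y_tail[OF h] h by (intro nn_integral_le_tail_const) auto
    also have "\<dots> \<le> ennreal D" by (intro ennreal_leI) (simp add: D_def)
    finally show "(\<integral>\<^sup>+\<omega>. ennreal (Y_sup h \<omega> ^ m) \<partial>M) \<le> ennreal D" .
  qed
qed (use m tau in auto)

section \<open>The error in the mean of order \<open>p\<close>\<close>

definition sup_error :: "real \<Rightarrow> (real \<Rightarrow> real^'a) \<Rightarrow> real" where
  "sup_error h \<omega> = (SUP t\<in>{0..\<tau>}. norm (X t \<omega> - Xbar h \<omega> t))"

lemma error_le_sups:
  assumes "0 < h" "\<omega> \<in> space M" "t \<in> {0..\<tau>}"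
  shows "norm (X t \<omega> - Xbar h \<omega> t) \<le> X_sup \<omega> + Y_sup h \<omega>"
proof -
  obtain k where k: "k \<le> Suc (steps h)" "norm (Xbar h \<omega> t) \<le> norm (Y h k \<omega>)"
    using norm_Xbar_le[OF assms(1,3), of \<omega>] by blast
  then have "norm (Xbar h \<omega> t) \<le> Y_sup h \<omega>" using norm_Y_le_sup order_trans by blast
  then show ?thesis
    using norm_X_le_sup[OF assms(2,3)] norm_triangle_ineq4[of "X t \<omega>" "Xbar h \<omega> t"] by linarith
qed

lemma sup_error_bounds:
  assumes "0 < h" "\<omega> \<in> space M"
  shows "0 \<le> sup_error h \<omega>" "sup_error h \<omega> \<le> X_sup \<omega> + Y_sup h \<omega>"
proof -
  have ne: "{0..\<tau>} \<noteq> {}" using tau by simp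
  have bdd: "bdd_above ((\<lambda>t. norm (X t \<omega> - Xbar h \<omega> t)) ` {0..\<tau>})"
    using error_le_sups[OF assms] by (intro bdd_aboveI2)
  show "0 \<le> sup_error h \<omega>"
    unfolding sup_error_def using tau by (intro cSUP_upper2[OF bdd, of 0]) auto
  show "sup_error h \<omega> \<le> X_sup \<omega> + Y_sup h \<omega>"
    unfolding sup_error_def using error_le_sups[OF assms] by (intro cSUP_least ne)
qed

text \<open>Uniform integrability in quantitative form: with \<open>x\<close> the error to the power
  \<open>p\<close>, one has \<open>x \<le> lev + x^2 / lev\<close>, and \<open>x^2\<close> is
  bounded by powers of order \<open>m \<ge> 2 * p\<close>. The first summand is charged only on
  \<open>B\<close>, the second everywhere but with the factor \<open>1 / lev\<close>.\<close>

lemma sup_error_powr_le: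
  assumes p: "0 < p" and m: "2 * p \<le> real m" and h: "0 < h" and \<omega>: "\<omega> \<in> space M" and lev: "0 < lev" and \<rho>: "0 \<le> \<rho>"
    and B: "\<omega> \<notin> B \<Longrightarrow> sup_error h \<omega> \<le> \<rho>"
  shows "sup_error h \<omega> powr p \<le> \<rho> powr p + lev * indicator B \<omega> + (1 + 2 ^ m * (X_sup \<omega> ^ m + Y_sup h \<omega> ^ m)) / lev"
proof -
  let ?D = "sup_error h \<omega>"
  let ?R = "1 + 2 ^ m * (X_sup \<omega> ^ m + Y_sup h \<omega> ^ m)"
  note D = sup_error_bounds[OF h \<omega>] and s = sup_nonneg(1)[OF \<omega>] sup_nonneg(2)[of h \<omega>]
  have in_B: "?D powr p \<le> lev + ?R / lev"
  proof -
    let ?x = "?D powr p"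
    have "?x\<^sup>2 = ?D powr (2 * p)" by (simp add: powr_add[symmetric] power2_eq_square)
    also have "\<dots> \<le> 1 + ?D ^ m"
    proof (cases "?D \<le> 1")
      case True
      then have "?D powr (2 * p) \<le> 1" using D p by (intro powr_le1) auto
      then show ?thesis using D by (simp add: add_increasing2)
    next
      case False
      then have "?D powr (2 * p) \<le> ?D powr real m" using m by (intro powr_mono) auto
      then show ?thesis using False by (simp add: powr_realpow)
    qed
    also have "?D ^ m \<le> (X_sup \<omega> + Y_sup h \<omega>) ^ m" using D by (intro power_mono)
    also have "\<dots> \<le> 2 ^ m * (X_sup \<omega> ^ m + Y_sup h \<omega> ^ m)" using s by (rule power_add_le_two_power)
    finally have x2: "?x\<^sup>2 \<le> ?R" by simp
    have "?x \<le> lev + ?x\<^sup>2 / lev"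
    proof (cases "?x \<le> lev")
      case True then show ?thesis using lev by (simp add: add_increasing2)
    next
      case False
      then have "?x * lev \<le> ?x * ?x" by (intro mult_left_mono) auto
      then have "?x \<le> ?x\<^sup>2 / lev" using lev by (simp add: pos_le_divide_eq power2_eq_square)
      then show ?thesis using lev by simp
    qed
    also have "?x\<^sup>2 / lev \<le> ?R / lev"
      using x2 lev by (intro divide_right_mono) auto
    finally show ?thesis by simp
  qed
  have not_B: "?D powr p \<le> \<rho> powr p" if "\<omega> \<notin> B" using B[OF that] D p by (intro powr_mono2) auto
  have nonneg: "0 \<le> ?R / lev" "0 \<le> \<rho> powr p" using s lev by simp_all
  show ?thesis
  proof (cases "\<omega> \<in> B")
    case True
    then have "lev * indicator B \<omega> = lev" by simp
    then show ?thesis using in_B nonneg by linarith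
  next
    case False
    then have "lev * indicator B \<omega> = 0" by simp
    then show ?thesis using not_B[OF False] nonneg by linarith
  qed
qed

lemma sup_error_Lp:
  assumes p: "1 \<le> p"
  shows "((\<lambda>h. \<integral>\<^sup>+ \<omega>. ennreal (sup_error h \<omega> powr p) \<partial>M) \<longlongrightarrow> 0) (at_right 0)"
proof -
  obtain m where m: "2 * p \<le> real m" using real_arch_simple by blast
  have m0: "0 < m" using m p by (cases m) auto
  obtain C where C: "0 \<le> C" "(\<integral>\<^sup>+\<omega>. ennreal (X_sup \<omega> ^ m) \<partial>M) \<le> ennreal C"
    "\<And>h. 0 < h \<Longrightarrow> h \<le> 1 \<Longrightarrow> (\<integral>\<^sup>+\<omega>. ennreal (Y_sup h \<omega> ^ m) \<partial>M) \<le> ennreal C"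
    using sup_moments[OF m0] by blast
  define Q where "Q = 1 + 2 ^ m * (C + C)"
  have Q: "0 < Q" using C(1) by (simp add: Q_def add_pos_nonneg)
  have small: "\<forall>\<^sub>F h in at_right 0. (\<integral>\<^sup>+ \<omega>. ennreal (sup_error h \<omega> powr p) \<partial>M) \<le> ennreal e" if e: "0 < e" for e :: real
  proof -
    \<comment> \<open>Three shares of \<open>e / 3\<close>: \<open>\<rho> \<le> 1\<close> gives
      \<open>\<rho> powr p \<le> \<rho>\<close>; \<open>lev\<close> makes the moment term
      \<open>Q / lev\<close> equal to \<open>e / 3\<close>; \<open>\<epsilon>\<close> is chosen
      after \<open>lev\<close>, so that \<open>lev * \<epsilon> = e / 3\<close>.\<close>
    define \<rho> where "\<rho> = min 1 (e / 3)"
    have \<rho>: "0 < \<rho>" "\<rho> \<le> 1" "\<rho> \<le> e / 3" using e by (simp_all add: \<rho>_def)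
    define lev where "lev = 3 * Q / e"
    have lev: "0 < lev" using Q e by (simp add: lev_def)
    define \<epsilon> where "\<epsilon> = e / (3 * lev)"
    have \<epsilon>: "0 < \<epsilon>" using e lev by (simp add: \<epsilon>_def)
    obtain h0 where h0: "0 < h0" "h0 \<le> 1" "\<And>h. 0 < h \<Longrightarrow> h < h0 \<Longrightarrow>
      \<exists>B\<in>sets M. measure M B \<le> \<epsilon> \<and> (\<forall>\<omega>\<in>space M - B. \<forall>t\<in>{0..\<tau>}. norm (X t \<omega> - Xbar h \<omega> t) \<le> \<rho>)"
      using uniform_error[OF \<epsilon> \<rho>(1)] by blast
    have "(\<integral>\<^sup>+ \<omega>. ennreal (sup_error h \<omega> powr p) \<partial>M) \<le> ennreal e" if h: "0 < h" "h < h0" for h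
    proof -
      have h1: "h \<le> 1" using h h0 by simp
      let ?xm = "\<lambda>\<omega>. X_sup \<omega> ^ m" and ?ym = "\<lambda>\<omega>. Y_sup h \<omega> ^ m" and ?c = "2 ^ m / lev"
      obtain B where B: "B \<in> sets M" "measure M B \<le> \<epsilon>"
        "\<And>\<omega> t. \<omega> \<in> space M \<Longrightarrow> \<omega> \<notin> B \<Longrightarrow> t \<in> {0..\<tau>} \<Longrightarrow> norm (X t \<omega> - Xbar h \<omega> t) \<le> \<rho>"
        using h0(3)[OF h] by blast
      have supB: "sup_error h \<omega> \<le> \<rho>" if "\<omega> \<in> space M" "\<omega> \<notin> B" for \<omega>
        unfolding sup_error_def using B(3)[OF that] tau by (intro cSUP_least) auto
      note [measurable] = Y_sup_measurable[OF h(1)] B(1)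
      \<comment> \<open>The majorant is built from measurable functions, with \<open>X_sup\<close>
        and \<open>Y_sup\<close> in place of the supremum of the error, so its integral can be
        evaluated term by term.\<close>
      have pt: "ennreal (sup_error h \<omega> powr p) \<le> ennreal \<rho> + ennreal lev * indicator B \<omega>
          + ennreal (1 / lev) + ennreal ?c * ennreal (?xm \<omega>) + ennreal ?c * ennreal (?ym \<omega>)"
        if \<omega>: "\<omega> \<in> space M" for \<omega>
      proof -
        note s = sup_nonneg(1)[OF \<omega>] sup_nonneg(2)[of h \<omega>]
        have "\<rho> powr p \<le> \<rho> powr 1" using \<rho> p by (intro powr_mono') auto
        then have "sup_error h \<omega> powr p \<le> \<rho> + lev * indicator B \<omega> + (1 + 2 ^ m * (?xm \<omega> + ?ym \<omega>)) / lev"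
          using sup_error_powr_le[OF _ m h(1) \<omega> lev less_imp_le[OF \<rho>(1)] supB[OF \<omega>], of B] p \<rho> by simp
        also have "\<dots> = \<rho> + lev * indicator B \<omega> + 1 / lev + ?c * ?xm \<omega> + ?c * ?ym \<omega>"
          by (simp add: add_divide_distrib distrib_left)
        finally have "ennreal (sup_error h \<omega> powr p) \<le> ennreal (\<rho> + lev * indicator B \<omega> + 1 / lev + ?c * ?xm \<omega> + ?c * ?ym \<omega>)"
          by (rule ennreal_leI)
        also have "\<dots> = ennreal \<rho> + ennreal (lev * indicator B \<omega>)
          + ennreal (1 / lev) + ennreal (?c * ?xm \<omega>) + ennreal (?c * ?ym \<omega>)"
          using \<rho> lev s by (simp add: ennreal_plus add_nonneg_nonneg del: times_divide_eq_left)
        finally show ?thesis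
          using lev s by (simp add: ennreal_mult ennreal_indicator del: times_divide_eq_left)
      qed
      have "(\<integral>\<^sup>+ \<omega>. ennreal (sup_error h \<omega> powr p) \<partial>M) \<le> (\<integral>\<^sup>+\<omega>. ennreal \<rho> + ennreal lev * indicator B \<omega>
          + ennreal (1 / lev) + ennreal ?c * ennreal (?xm \<omega>) + ennreal ?c * ennreal (?ym \<omega>) \<partial>M)"
        by (intro nn_integral_mono pt)
      also have "\<dots> = ennreal \<rho> + ennreal lev * emeasure M B + ennreal (1 / lev)
          + ennreal ?c * (\<integral>\<^sup>+\<omega>. ennreal (?xm \<omega>) \<partial>M) + ennreal ?c * (\<integral>\<^sup>+\<omega>. ennreal (?ym \<omega>) \<partial>M)"
        by (simp add: nn_integral_add nn_integral_cmult emeasure_space_1)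
      also have "\<dots> \<le> ennreal \<rho> + ennreal lev * ennreal \<epsilon> + ennreal (1 / lev)
          + ennreal ?c * ennreal C + ennreal ?c * ennreal C"
        using C(2) C(3)[OF h(1) h1] B(2)
        by (intro add_mono mult_left_mono order_refl) (auto simp: emeasure_eq_measure intro!: ennreal_leI)
      also have "\<dots> = ennreal (\<rho> + lev * \<epsilon> + 1 / lev + ?c * C + ?c * C)"
      proof -
        have e: "ennreal lev * ennreal \<epsilon> = ennreal (lev * \<epsilon>)" "ennreal ?c * ennreal C = ennreal (?c * C)"
          using lev \<epsilon> C(1) by (intro ennreal_mult[symmetric]; simp)+
        have sum5: "ennreal a1 + ennreal a2 + ennreal a3 + ennreal a4 + ennreal a5 = ennreal (a1 + a2 + a3 + a4 + a5)"
          if "0 \<le> a1" "0 \<le> a2" "0 \<le> a3" "0 \<le> a4" "0 \<le> a5" for a1 a2 a3 a4 a5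
          using that by (simp add: ennreal_plus)
        show ?thesis unfolding e by (rule sum5) (use \<rho> lev \<epsilon> C(1) in simp_all)
      qed
      also have "\<dots> \<le> ennreal e"
      proof (rule ennreal_leI)
        have "1 / lev + ?c * C + ?c * C = Q / lev" by (simp add: Q_def add_divide_distrib distrib_left)
        also have "\<dots> = e / 3" using Q by (simp add: lev_def)
        finally have "1 / lev + ?c * C + ?c * C = e / 3" .
        moreover have "lev * \<epsilon> = e / 3" using lev by (simp add: \<epsilon>_def)
        ultimately show "\<rho> + lev * \<epsilon> + 1 / lev + ?c * C + ?c * C \<le> e" using \<rho>(3) by linarith
      qed
      finally show ?thesis .
    qed
    then show ?thesis
      unfolding eventually_at_right_field using h0(1) by blast
  qed
  show ?thesis
  proof (rule order_tendstoI)
    fix a :: ennreal assume a: "0 < a"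
    \<comment> \<open>The threshold \<open>a\<close> may be infinite, so a finite positive value
      below it is taken first.\<close>
    obtain e where e: "0 < e" "ennreal e < a"
    proof -
      obtain q where q: "0 < q" "q < a" using a dense by blast
      then have "q < top" using less_top order_less_trans top_greatest by (metis neq_top_trans order_less_imp_le)
      then obtain e where "q = ennreal e" "0 \<le> e" by (cases q) auto
      then show thesis using q by (intro that[of e]) auto
    qed
    show "\<forall>\<^sub>F h in at_right 0. (\<integral>\<^sup>+ \<omega>. ennreal (sup_error h \<omega> powr p) \<partial>M) < a"
      using small[OF e(1)] by (rule eventually_mono) (use e(2) in \<open>auto intro: le_less_trans\<close>)
  qed simp
qed

end

theorem theorem5p5:
  fixes M :: "(real \<Rightarrow> real^'d) measure"
    and b :: "real^'m \<Rightarrow> real^'m" and \<sigma> :: "real^'m \<Rightarrow> real^'d^'m"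
    and \<eta> :: "real \<Rightarrow> real^'m \<Rightarrow> real^'d \<Rightarrow> real^'m"
    and \<alpha> :: ereal and K1 K2 \<tau> :: real and x0 :: "real^'m"
    and X :: "real \<Rightarrow> (real \<Rightarrow> real^'d) \<Rightarrow> real^'m"
  assumes W: "wiener_measure M"
    and loc_lip: "\<forall>N>0. \<exists>K. \<forall>x y. norm x \<le> N \<longrightarrow> norm y \<le> N \<longrightarrow>
                   norm (b x - b y) \<le> K * norm (x - y) \<and> norm (\<sigma> x - \<sigma> y) \<le> K * norm (x - y)"
    and lin_growth: "\<forall>x. norm (b x) \<le> K1 * (1 + norm x) \<and> norm (\<sigma> x) \<le> K1 * (1 + norm x)"
    and eta_meas: "\<forall>h>0. (\<lambda>(x, y). \<eta> h x y) \<in> borel_measurable borel"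
    and alpha: "0 < \<alpha>"
    and eta_bound: "\<forall>h>0. \<forall>x y. norm (\<eta> h x y) \<le> K2 * (h_pow \<alpha> h * norm x + norm y)"
    and tau: "0 < \<tau>"
    and sol: "sde_solution M b \<sigma> x0 \<tau> X"
  shows "\<forall>p>2. ((\<lambda>h. \<integral>\<^sup>+ \<omega>. ennreal ((SUP t\<in>{0..\<tau>}. norm (X t \<omega> - interp (U_map b \<sigma> \<eta>) h x0 \<omega> t)) powr p) \<partial>M)
                 \<longlongrightarrow> 0) (at_right 0)"
proof (intro allI impI)
  fix p :: real assume "2 < p"
  interpret repeated_interaction_sde M b \<sigma> \<eta> \<alpha> K1 K2 x0 \<tau> X
    by unfold_locales fact+
  show "((\<lambda>h. \<integral>\<^sup>+ \<omega>. ennreal ((SUP t\<in>{0..\<tau>}. norm (X t \<omega> - interp (U_map b \<sigma> \<eta>) h x0 \<omega> t)) powr p) \<partial>M)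
                 \<longlongrightarrow> 0) (at_right 0)"
    using sup_error_Lp[of p] \<open>2 < p\<close> unfolding sup_error_def by simp
qed

end
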